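(* Let $p$ be a fixed prime. For a positive integer $n$, the number of isomorphism classes of rings with identity that have cardinality $p^{n}$ is $p^{\frac{4}{27}n^{3} + O(n^{5/2})}$.
   Context: Rings are associative and not assumed commutative; here only rings possessing a multiplicative identity are counted. The prime $p$ is fixed and $n$ varies; a quantity is $p^{a(n)+O(h(n))}$ if it equals $p^{\delta(n)}$ with $|\delta(n)-a(n)|\le C\,h(n)$ for all $n\ge 1$, for some constant $C$ not depending on $n$ ($C$ may depend on $p$). *)

theory Defs
  imports Complex_Main "HOL-Algebra.Algebra" "HOL-Computational_Algebra.Primes"
begin

text \<open>The locale \<^locale>\<open>ring\<close> requires an identity but not commutativity. Carriers are taken inside
  \<^typ>\<open>nat\<close>, so that the rings form a set; no isomorphism class of finite rings is lost by this, see
  \<open>finite_ring_iso_nat_ring\<close> below. There are infinitely many records representing the same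
  ring (the operations are arbitrary outside the carrier), but only the isomorphism classes are
  counted.\<close>

definition rings_of_card :: "nat \<Rightarrow> nat ring set" where
  "rings_of_card m = {R. ring R \<and> finite (carrier R) \<and> card (carrier R) = m}"

definition ring_iso_rel :: "nat \<Rightarrow> nat ring rel" where
  "ring_iso_rel m = {(R, S). R \<in> rings_of_card m \<and> S \<in> rings_of_card m \<and> R \<simeq> S}"

definition num_rings_upto_iso :: "nat \<Rightarrow> nat" where
  "num_rings_upto_iso m = card (rings_of_card m // ring_iso_rel m)"

lemma equiv_ring_iso_rel: "equiv (rings_of_card m) (ring_iso_rel m)"
proof (rule equivI)
  show "refl_on (rings_of_card m) (ring_iso_rel m)"
    by (auto simp: refl_on_def ring_iso_rel_def ring_iso_refl)
  show "sym (ring_iso_rel m)"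
    by (auto simp: sym_def ring_iso_rel_def rings_of_card_def intro: ring_iso_sym)
  show "trans (ring_iso_rel m)"
    by (auto simp: trans_def ring_iso_rel_def intro: ring_iso_trans)
qed (auto simp: ring_iso_rel_def)

lemma finite_ring_iso_nat_ring:
  assumes "ring R" and "finite (carrier R)"
  obtains S where "S \<in> rings_of_card (card (carrier R))" and "R \<simeq> S"
proof -
  interpret R: ring R by fact
  obtain f :: "'a \<Rightarrow> nat" where f: "inj_on f (carrier R)"
    using assms(2) finite_imp_inj_to_nat_seg by blast
  have "ring (image_ring f R)"
    by (rule R.inj_imp_image_ring_is_ring[OF f])
  moreover have "f \<in> ring_iso R (image_ring f R)"
    by (rule inj_imp_image_ring_iso[OF f])
  ultimately show ?thesis
    using that[of "image_ring f R"] assms(2) card_image[OF f]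
    by (auto simp: rings_of_card_def image_ring_carrier is_ring_iso_def)
qed

end

(*
  Upper bound.  Let R have order p^n and radical J, and put t = ceiling (sqrt n).  Modulo J, the ring R
  is generated by O(t) elements g.  Choose y_1, ..., y_t in J greedily so that, with
  W = J y_1 + ... + J y_t, every right multiplication by an element of J has image of order at most
  p^t modulo W.  Pick b_1, ..., b_u generating J modulo W.  Record the additive group, the left and right
  multiplications by the g and the y, and for every b_j a set of t generators of J b_j + W modulo W: this
  takes O(n^(5/2)) digits in base p.  Since J is nilpotent and J = <b_1, ..., b_u> + J y_1 + ... + J y_t,
  the whole multiplication is determined once the products b_i b_j are known, and each of them lies in
  the recorded group J b_j + W.  This leaves at most u^2 (n - u + t) <= 4/27 n^3 + O(n^(5/2)) digits.

  Lower bound.  The algebras F_p + V + W with V V inside W, dim V about 2n/3 and dim W about n/3 realise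
  p^(4/27 n^3 - O(n^2)) multiplications on one additive group, whose automorphism group has order at
  most p^(n^2).
*)

theory Submission
  imports Defs "HOL-Computational_Algebra.Group_Closure"
begin

section \<open>Additive subgroups and nilpotent rings\<close>

text \<open>Recording how one element multiplies costs about n^2 base-p digits (n basis elements, n
  coordinates each), so only O(sqrt n) elements can be recorded in this way. Two devices respect
  this limit. Modulo J there may be of the order of n orthogonal idempotents; placing them in the
  cells of a square grid and recording only row and column sums leaves O(sqrt n) elements. Inside J,
  each further y can be required to raise the order of W by a factor p^t, so about n/t of them are
  enough; t near sqrt n balances their cost against the excess t u^2 in the products. With |W| =
  p^v, a product b_i b_j then has at most p^(t+v) possible values, and u + v <= n. The constant is
  the maximum of u^2 v under this constraint, attained at u = 2v, and the lower bound uses these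
  same proportions. The groups J b_j + W have to belong to the record, because the range of the
  products must be known before the products are counted.\<close>

definition add_subgroup :: "'a::ab_group_add set \<Rightarrow> bool" where
  "add_subgroup A \<longleftrightarrow> 0 \<in> A \<and> (\<forall>x\<in>A. \<forall>y\<in>A. x - y \<in> A)"

lemma add_subgroup_zero: "add_subgroup A \<Longrightarrow> 0 \<in> A"
  by (simp add: add_subgroup_def)

lemma add_subgroup_diff: "add_subgroup A \<Longrightarrow> x \<in> A \<Longrightarrow> y \<in> A \<Longrightarrow> x - y \<in> A"
  by (simp add: add_subgroup_def)

lemma add_subgroup_uminus: "add_subgroup A \<Longrightarrow> x \<in> A \<Longrightarrow> - x \<in> A"
  using add_subgroup_diff[of A 0 x] by (simp add: add_subgroup_zero)

lemma add_subgroup_add: "add_subgroup A \<Longrightarrow> x \<in> A \<Longrightarrow> y \<in> A \<Longrightarrow> x + y \<in> A"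
  using add_subgroup_diff[of A x "- y"] by (simp add: add_subgroup_uminus)

lemma add_subgroup_sum:
  "add_subgroup A \<Longrightarrow> (\<And>i. i \<in> I \<Longrightarrow> f i \<in> A) \<Longrightarrow> sum f I \<in> A"
  by (induction I rule: infinite_finite_induct) (auto simp: add_subgroup_zero intro: add_subgroup_add)

lemma add_subgroup_of_nat_mult:
  "add_subgroup A \<Longrightarrow> x \<in> A \<Longrightarrow> of_nat k * x \<in> A" for x :: "'a::ring_1"
  by (induction k) (auto simp: add_subgroup_zero distrib_right intro: add_subgroup_add)

lemma add_subgroup_of_int_mult:
  "add_subgroup A \<Longrightarrow> x \<in> A \<Longrightarrow> of_int k * x \<in> A" for x :: "'a::ring_1"
  by (cases k rule: int_cases2) (auto intro: add_subgroup_of_nat_mult add_subgroup_uminus)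

lemma add_subgroup_group_closure [simp]: "add_subgroup (group_closure S)"
  by (simp add: add_subgroup_def group_closure.diff)

lemma subset_group_closure: "S \<subseteq> group_closure S"
  by (auto intro: group_closure.base)

lemma group_closure_subset: "add_subgroup A \<Longrightarrow> S \<subseteq> A \<Longrightarrow> group_closure S \<subseteq> A"
proof
  fix x assume "add_subgroup A" "S \<subseteq> A" "x \<in> group_closure S"
  from this(3) show "x \<in> A"
    by induction (use \<open>add_subgroup A\<close> \<open>S \<subseteq> A\<close> in \<open>auto simp: add_subgroup_def\<close>)
qed

lemma group_closure_mono: "S \<subseteq> T \<Longrightarrow> group_closure S \<subseteq> group_closure T"
  by (meson add_subgroup_group_closure group_closure_subset subset_group_closure subset_trans)

lemma group_closure_of_subgroup: "add_subgroup A \<Longrightarrow> group_closure A = A"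
  using group_closure_subset[of A A] subset_group_closure[of A] by blast

lemma group_closure_map:
  assumes "add_subgroup T" "\<And>s. s \<in> S \<Longrightarrow> f s \<in> T" "f 0 = 0"
    and "\<And>x y. x \<in> group_closure S \<Longrightarrow> y \<in> group_closure S \<Longrightarrow> f (x - y) = f x - f y"
    and "x \<in> group_closure S"
  shows "f x \<in> T"
  using assms(5) by induction (use assms in \<open>auto simp: add_subgroup_def\<close>)

lemma group_closure_Un_iff:
  assumes "add_subgroup A" "add_subgroup B"
  shows "x \<in> group_closure (A \<union> B) \<longleftrightarrow> (\<exists>a\<in>A. \<exists>b\<in>B. x = a + b)"
proof
  assume "x \<in> group_closure (A \<union> B)"
  then show "\<exists>a\<in>A. \<exists>b\<in>B. x = a + b"
  proof induction
    case (base s)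
    then consider "s = 0" | "s \<in> A" | "s \<in> B" by auto
    then show ?case
      using assms by cases (force simp: add_subgroup_def)+
  next
    case (diff s t)
    then obtain a b a' b' where "a \<in> A" "b \<in> B" "a' \<in> A" "b' \<in> B" "s = a + b" "t = a' + b'"
      by blast
    moreover have "a + b - (a' + b') = (a - a') + (b - b')" by simp
    ultimately show ?case using assms by (metis add_subgroup_diff)
  qed
next
  assume "\<exists>a\<in>A. \<exists>b\<in>B. x = a + b"
  then show "x \<in> group_closure (A \<union> B)"
    by (metis UnCI group_closure.base group_closure_add insertCI)
qed

lemma group_closure_Un_closure: "group_closure (S \<union> group_closure T) = group_closure (S \<union> T)"
proof (rule subset_antisym)
  show "group_closure (S \<union> group_closure T) \<subseteq> group_closure (S \<union> T)"
    by (rule group_closure_subset)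
      (use subset_group_closure[of "S \<union> T"] group_closure_mono[of T "S \<union> T"] in auto)
  show "group_closure (S \<union> T) \<subseteq> group_closure (S \<union> group_closure T)"
    by (rule group_closure_mono) (use subset_group_closure in auto)
qed

section \<open>Orders and generators of finite additive p-groups\<close>

lemma card_add_subgroup_dvd:
  assumes "add_subgroup A" "add_subgroup H" "H \<subseteq> A" "finite A"
  shows "card H dvd card A"
proof -
  let ?G = "\<lparr>carrier = A, monoid.mult = (+), one = 0\<rparr>"
  have "group ?G"
  proof (rule groupI)
    show "\<exists>y\<in>carrier ?G. y \<otimes>\<^bsub>?G\<^esub> x = \<one>\<^bsub>?G\<^esub>" if "x \<in> carrier ?G" for x
      using that assms(1) add_subgroup_uminus by (intro bexI[of _ "- x"]) auto
  qed (use assms(1) in \<open>auto simp: add_subgroup_add add_subgroup_zero add.assoc\<close>)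
  then interpret group ?G .
  have inv: "inv\<^bsub>?G\<^esub> x = - x" if "x \<in> A" for x
    using that assms(1) by (intro inv_equality) (auto simp: add_subgroup_uminus)
  have "subgroup H ?G"
    by (rule subgroupI)
      (use assms inv in \<open>auto simp: add_subgroup_add add_subgroup_uminus subsetD dest: add_subgroup_zero\<close>)
  from lagrange[OF this] show ?thesis
    by (simp add: order_def) (metis dvd_triv_right)
qed

lemma prime_power_card_add_subgroup:
  assumes "Factorial_Ring.prime (p::nat)" "add_subgroup A" "add_subgroup H" "H \<subseteq> A" "finite A"
    "card A = p ^ n"
  obtains h where "h \<le> n" "card H = p ^ h"
  using card_add_subgroup_dvd[OF assms(2-5)] divides_primepow_nat[OF assms(1)] assms(6) by metis

text \<open>An element outside \<open>H\<close> raises the order by a factor of at least p, so u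
  steps use up the index. Once \<open>A\<close> is reached the list is filled with 0: lists of a
  prescribed length are what gets counted later.\<close>

lemma ex_generators_mod:
  assumes p: "Factorial_Ring.prime (p::nat)" and A: "add_subgroup A" "finite A" "card A = p ^ n"
    and H: "add_subgroup H" "H \<subseteq> A" and le: "card A \<le> p ^ u * card H"
  shows "\<exists>bs. length bs = u \<and> set bs \<subseteq> A \<and> group_closure (set bs \<union> H) = A"
  using H le
proof (induction u arbitrary: H)
  case 0
  then have "H = A"
    using A by (simp add: card_seteq)
  then show ?case
    using A by (simp add: group_closure_of_subgroup)
next
  case (Suc u)
  show ?case
  proof (cases "H = A")
    case True
    moreover have "set (replicate (Suc u) 0) \<union> A = A"
      using A(1) add_subgroup_zero by auto
    ultimately show ?thesis
      using A(1) by (intro exI[of _ "replicate (Suc u) 0"]) (auto simp: group_closure_of_subgroup add_subgroup_zero)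
  next
    case False
    then obtain x where x: "x \<in> A" "x \<notin> H" using Suc.prems by blast
    let ?H' = "group_closure (insert x H)"
    have H': "?H' \<subseteq> A" using x Suc.prems A by (intro group_closure_subset) auto
    have sub: "H \<subset> ?H'" using x subset_group_closure[of "insert x H"] by auto
    obtain h where h: "card H = p ^ h"
      using prime_power_card_add_subgroup[OF p A(1) Suc.prems(1,2) A(2,3)] .
    obtain h' where h': "card ?H' = p ^ h'"
      using prime_power_card_add_subgroup[OF p A(1) _ H' A(2,3)] by auto
    have "p ^ h < p ^ h'"
      using psubset_card_mono[OF _ sub] h h' finite_subset[OF H' A(2)] by simp
    then have "Suc h \<le> h'"
      using prime_gt_1_nat[OF p] by (simp add: Suc_leI)
    then have "p ^ Suc h \<le> p ^ h'"
      using prime_gt_1_nat[OF p] by (intro power_increasing) auto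
    then have "p ^ Suc u * card H \<le> p ^ u * card ?H'"
      using h h' by (simp add: mult.assoc mult.left_commute)
    with Suc.prems have "card A \<le> p ^ u * card ?H'" by linarith
    from Suc.IH[OF _ H' this] obtain bs where bs: "length bs = u" "set bs \<subseteq> A"
      "group_closure (set bs \<union> ?H') = A" by auto
    then show ?thesis
      using x by (intro exI[of _ "x # bs"]) (auto simp: group_closure_Un_closure)
  qed
qed

lemma card_le_mult_card_image:
  assumes "finite D" "\<And>y. y \<in> F ` D \<Longrightarrow> card {x \<in> D. F x = y} \<le> k"
  shows "card D \<le> k * card (F ` D)"
proof -
  have "D \<subseteq> (\<Union>y\<in>F ` D. {x \<in> D. F x = y})" by blast
  then have "card D \<le> card (\<Union>y\<in>F ` D. {x \<in> D. F x = y})"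
    using assms(1) by (intro card_mono) auto
  also have "\<dots> \<le> (\<Sum>y\<in>F ` D. card {x \<in> D. F x = y})"
    using assms(1) by (intro card_UN_le) auto
  also have "\<dots> \<le> k * card (F ` D)"
    using sum_bounded_above[of "F ` D", OF assms(2)] by (simp add: mult.commute)
  finally show ?thesis .
qed

section \<open>Rings without identity and nilpotence\<close>

definition subrng :: "'a::ring set \<Rightarrow> bool" where
  "subrng R \<longleftrightarrow> add_subgroup R \<and> (\<forall>x\<in>R. \<forall>y\<in>R. x * y \<in> R)"

lemma subrng_add_subgroup: "subrng R \<Longrightarrow> add_subgroup R"
  by (simp add: subrng_def)

lemma subrng_mult: "subrng R \<Longrightarrow> x \<in> R \<Longrightarrow> y \<in> R \<Longrightarrow> x * y \<in> R"
  by (simp add: subrng_def)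

text \<open>Exponent 0 is excluded because the 1 of the type may lie outside the subring: the
  radical, and a corner with its own identity, must count as subrings too.\<close>

lemma subrng_power: "0 < k \<Longrightarrow> subrng R \<Longrightarrow> x \<in> R \<Longrightarrow> x ^ k \<in> R" for x :: "'a::ring_1"
  by (induction k rule: nat_induct_non_zero) (auto intro: subrng_mult)

inductive_set rng_closure :: "'a::ring set \<Rightarrow> 'a set" for S where
  base: "s \<in> insert 0 S \<Longrightarrow> s \<in> rng_closure S"
| diff: "s \<in> rng_closure S \<Longrightarrow> t \<in> rng_closure S \<Longrightarrow> s - t \<in> rng_closure S"
| mult: "s \<in> rng_closure S \<Longrightarrow> t \<in> rng_closure S \<Longrightarrow> s * t \<in> rng_closure S"

lemma subrng_rng_closure [simp]: "subrng (rng_closure S)"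
  by (auto simp: subrng_def add_subgroup_def intro: rng_closure.intros)

lemma subset_rng_closure: "S \<subseteq> rng_closure S"
  by (auto intro: rng_closure.base)

lemma rng_closure_subset: "subrng A \<Longrightarrow> S \<subseteq> A \<Longrightarrow> rng_closure S \<subseteq> A"
proof
  fix x assume "subrng A" "S \<subseteq> A" "x \<in> rng_closure S"
  from this(3) show "x \<in> A"
    by induction (use \<open>subrng A\<close> \<open>S \<subseteq> A\<close> in \<open>auto simp: subrng_def add_subgroup_def\<close>)
qed

text \<open>The powers of x are eventually periodic, x^(a+d) = x^a. The exponent a d is at least a
  and is a multiple of the period d, so doubling it does not change the power.\<close>

lemma ex_idempotent_power:
  fixes x :: "'a::ring_1"
  assumes "subrng R" "finite R" "x \<in> R"
  obtains N where "N > 0" "x ^ N * x ^ N = x ^ N"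
proof -
  have "\<not> inj (\<lambda>i. x ^ Suc i)"
  proof
    assume "inj (\<lambda>i. x ^ Suc i)"
    moreover have "range (\<lambda>i. x ^ Suc i) \<subseteq> R"
      using assms subrng_power[of _ R x] by (metis image_subsetI zero_less_Suc)
    ultimately show False
      using assms(2) finite_subset finite_imageD infinite_UNIV_nat by blast
  qed
  then obtain i j where ij: "i < j" "x ^ Suc i = x ^ Suc j"
    unfolding inj_def by (metis nat_neq_iff)
  define a where "a = Suc i"
  define d where "d = j - i"
  have d: "d > 0" "x ^ (a + d) = x ^ a" using ij by (simp_all add: a_def d_def)
  have *: "x ^ (a + q * d) = x ^ a" for q
  proof (induction q)
    case (Suc q)
    have "x ^ (a + Suc q * d) = x ^ (a + d) * x ^ (q * d)"
      by (simp add: power_add[symmetric] algebra_simps)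
    then show ?case using Suc d by (simp add: power_add)
  qed simp
  obtain r where r: "a * d = a + r"
    using d by (metis le_add_diff_inverse mult_le_mono2 nat_mult_1_right One_nat_def Suc_leI)
  have "x ^ (a * d) * x ^ (a * d) = x ^ (a + a * d) * x ^ r"
    using r by (simp add: power_add[symmetric] algebra_simps)
  also have "\<dots> = x ^ (a * d)"
    using *[of a] r by (simp add: power_add)
  finally show ?thesis
    using that[of "a * d"] d by (simp add: a_def)
qed

lemma prod_list_mem_subrng:
  "xs \<noteq> [] \<Longrightarrow> subrng R \<Longrightarrow> set xs \<subseteq> R \<Longrightarrow> prod_list xs \<in> R" for xs :: "'a::ring_1 list"
  by (induction xs rule: list_nonempty_induct) (auto intro: subrng_mult)

text \<open>Two of the partial products of a long product agree, so one of them, say \<open>u\<close>,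
  satisfies \<open>u = u * a\<close> with \<open>a\<close> nilpotent.\<close>

lemma nil_prod_list_eq_0:
  fixes J :: "'a::ring_1 set"
  assumes J: "subrng J" "finite J" and nil: "\<And>x. x \<in> J \<Longrightarrow> \<exists>m. x ^ m = 0"
    and xs: "set xs \<subseteq> J" "card J < length xs"
  shows "prod_list xs = 0"
proof -
  let ?f = "\<lambda>i. prod_list (take i xs)"
  have "?f ` {1..length xs} \<subseteq> J"
  proof
    fix y assume "y \<in> ?f ` {1..length xs}"
    then obtain i where "i \<ge> 1" "i \<le> length xs" "y = ?f i" by auto
    then show "y \<in> J" using xs set_take_subset[of i xs] by (auto intro!: prod_list_mem_subrng[OF _ J(1)])
  qed
  then have "card (?f ` {1..length xs}) < card {1..length xs}"
    using card_mono[OF J(2), of "?f ` {1..length xs}"] xs by simp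
  then have "\<not> inj_on ?f {1..length xs}"
    using pigeonhole by blast
  then obtain i j where ij: "1 \<le> i" "i < j" "j \<le> length xs" "?f i = ?f j"
    unfolding inj_on_def by (metis atLeastAtMost_iff nat_neq_iff)
  define a where "a = prod_list (drop i (take j xs))"
  have "a \<in> J"
    unfolding a_def using ij xs set_take_subset[of j xs] set_drop_subset[of i "take j xs"]
    by (intro prod_list_mem_subrng[OF _ J(1)]) auto
  then obtain m where m: "a ^ m = 0" using nil by blast
  have "?f j = ?f i * a"
  proof -
    have "take j xs = take i xs @ drop i (take j xs)"
      using ij append_take_drop_id[of i "take j xs"] by (simp add: min_def)
    then show ?thesis unfolding a_def by (metis prod_list.append)
  qed
  then have *: "?f i = ?f i * a" using ij by simp
  have "?f i = ?f i * a ^ q" for q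
    by (induction q) (use * in \<open>auto simp: mult.assoc[symmetric] power_Suc2 simp del: power_Suc\<close>)
  from this[of m] m have "?f i = 0" by simp
  moreover have "prod_list xs = ?f i * prod_list (drop i xs)"
    by (metis append_take_drop_id prod_list.append)
  ultimately show ?thesis by simp
qed

text \<open>Iterating the generation hypothesis pushes the remainder into ever longer products of elements
  of \<open>J\<close>, and those vanish.\<close>

lemma nil_generation:
  fixes J :: "'a::ring_1 set"
  assumes J: "subrng J" "finite J" and nil: "\<And>x. x \<in> J \<Longrightarrow> \<exists>m. x ^ m = 0"
    and Y: "Y \<subseteq> J" and K: "add_subgroup K" "B \<subseteq> K" "\<And>x y. x \<in> K \<Longrightarrow> y \<in> Y \<Longrightarrow> x * y \<in> K"
    and gen: "J \<subseteq> group_closure (B \<union> {x * y |x y. x \<in> J \<and> y \<in> Y})"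
  shows "J \<subseteq> K"
proof -
  define L where "L i = group_closure {prod_list xs |xs. set xs \<subseteq> J \<and> length xs = Suc i}" for i
  have step: "z * y \<in> L (Suc i)" if "z \<in> L i" "y \<in> Y" for z y i
  proof (rule group_closure_map[where f = "\<lambda>z. z * y"])
    show "z \<in> group_closure {prod_list xs |xs. set xs \<subseteq> J \<and> length xs = Suc i}"
      using that(1) by (simp add: L_def)
    show "s * y \<in> L (Suc i)" if s: "s \<in> {prod_list xs |xs. set xs \<subseteq> J \<and> length xs = Suc i}" for s
    proof -
      obtain xs where xs: "s = prod_list xs" "set xs \<subseteq> J" "length xs = Suc i" using s by blast
      then have "s * y = prod_list (xs @ [y])" by simp
      then show ?thesis unfolding L_def
        using xs \<open>y \<in> Y\<close> Y
        by (intro subset_group_closure[THEN subsetD] CollectI exI[of _ "xs @ [y]"]) auto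
    qed
  qed (auto simp: L_def left_diff_distrib)
  have "J \<subseteq> group_closure (K \<union> L i)" for i
  proof (induction i)
    case 0
    have "J \<subseteq> L 0"
      unfolding L_def by (intro subsetI subset_group_closure[THEN subsetD] CollectI) (force intro: exI[of _ "[_]"])
    then show ?case using subset_group_closure[of "K \<union> L 0"] by blast
  next
    case (Suc i)
    have "x * y \<in> group_closure (K \<union> L (Suc i))" if "x \<in> J" "y \<in> Y" for x y
    proof (rule group_closure_map[where f = "\<lambda>z. z * y"])
      show "x \<in> group_closure (K \<union> L i)" using Suc that by blast
      show "s * y \<in> group_closure (K \<union> L (Suc i))" if "s \<in> K \<union> L i" for s
        using that K(3) \<open>y \<in> Y\<close> step by (auto intro!: subset_group_closure[THEN subsetD])
    qed (auto simp: left_diff_distrib)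
    then have "B \<union> {x * y |x y. x \<in> J \<and> y \<in> Y} \<subseteq> group_closure (K \<union> L (Suc i))"
      using K(2) subset_group_closure[of "K \<union> L (Suc i)"] by auto
    then show ?case
      using gen group_closure_subset[OF add_subgroup_group_closure] by blast
  qed
  moreover have "L (card J) = {0}"
  proof -
    have "{prod_list xs |xs. set xs \<subseteq> J \<and> length xs = Suc (card J)} \<subseteq> {0}"
      using nil_prod_list_eq_0[OF J nil] by auto
    from group_closure_subset[OF _ this] show ?thesis
      unfolding L_def using zero_in_group_closure by (auto simp: add_subgroup_def)
  qed
  ultimately have "J \<subseteq> group_closure (K \<union> {0})" by metis
  also have "\<dots> \<subseteq> K"
    by (rule group_closure_subset) (use K add_subgroup_zero in auto)
  finally show ?thesis .
qed

section \<open>Generators modulo the radical\<close>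

text \<open>The identity \<open>e\<close> is kept apart from the 1 of the type, because finite rings
  will be realised as subrings of one large ring without sharing its identity.\<close>

locale finite_rng =
  fixes R :: "'a::ring_1 set" and e :: 'a
  assumes R: "subrng R" and finite_R: "finite R" and e_mem: "e \<in> R"
    and e_left: "x \<in> R \<Longrightarrow> e * x = x" and e_right: "x \<in> R \<Longrightarrow> x * e = x"
begin

section \<open>The Jacobson radical of a finite ring\<close>

lemma R_add: "add_subgroup R"
  using R by (rule subrng_add_subgroup)

lemma R_mult: "x \<in> R \<Longrightarrow> y \<in> R \<Longrightarrow> x * y \<in> R"
  using R by (rule subrng_mult)

lemma R_power: "0 < k \<Longrightarrow> x \<in> R \<Longrightarrow> x ^ k \<in> R"
  using R by (rule subrng_power[rotated])

text \<open>In a finite ring this is the Jacobson radical: x belongs to it iff the right ideal xR is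
  nil. Being nil is the form in which the radical is used, and no maximal ideals or modules are
  needed.\<close>

definition rad :: "'a set" where
  "rad = {x \<in> R. \<forall>y\<in>R. \<exists>m. (x * y) ^ m = 0}"

lemma rad_subset: "rad \<subseteq> R"
  by (auto simp: rad_def)

lemma rad_nil: "x \<in> rad \<Longrightarrow> \<exists>m. x ^ m = 0"
  using e_mem e_right by (auto simp: rad_def dest!: bspec[where x = e])

lemma rad_right: "x \<in> rad \<Longrightarrow> z \<in> R \<Longrightarrow> x * z \<in> rad"
  using R_mult by (auto simp: rad_def mult.assoc)

lemma power_swap: "(y * x) ^ Suc m = y * (x * y) ^ m * x" for x y :: 'a
  by (induction m) (simp_all add: mult.assoc)

text \<open>This makes the one-sided definition of \<open>rad\<close> symmetric.\<close>

lemma nil_swap: "\<exists>m. (x * y) ^ m = 0 \<Longrightarrow> \<exists>m. (y * x) ^ m = 0" for x y :: 'a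
  using power_swap by (metis mult_zero_left mult_zero_right)

lemma rad_left: "x \<in> rad \<Longrightarrow> z \<in> R \<Longrightarrow> z * x \<in> rad"
proof -
  assume x: "x \<in> rad" and z: "z \<in> R"
  have "\<exists>m. (z * x * y) ^ m = 0" if "y \<in> R" for y
  proof -
    have "\<exists>m. (x * (y * z)) ^ m = 0" using x z that R_mult by (auto simp: rad_def)
    then have "\<exists>m. ((x * y) * z) ^ m = 0" by (simp add: mult.assoc)
    then show ?thesis using nil_swap[of "x * y" z] by (simp add: mult.assoc)
  qed
  then show "z * x \<in> rad" using x z R_mult by (auto simp: rad_def)
qed

text \<open>Finiteness enters here: if (x + x')y is not nilpotent, one of its powers is a non-zero
  idempotent f = xt + x't. Compressing by f gives f = b + b' with both summands in
  \<open>rad\<close>. Then b = f - b' acts invertibly on fR, since b' is nilpotent, yet b is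
  nilpotent as well.\<close>

lemma rad_add:
  assumes x: "x \<in> rad" and x': "x' \<in> rad"
  shows "x + x' \<in> rad"
proof (rule ccontr)
  assume "x + x' \<notin> rad"
  moreover have xR: "x \<in> R" "x' \<in> R" "x + x' \<in> R"
    using x x' rad_subset add_subgroup_add[OF R_add] by auto
  ultimately obtain y where y: "y \<in> R" "\<And>m. ((x + x') * y) ^ m \<noteq> 0"
    by (auto simp: rad_def)
  define a where "a = (x + x') * y"
  have a: "a \<in> R" using xR y R_mult by (auto simp: a_def)
  obtain N where N: "N > 0" "a ^ N * a ^ N = a ^ N"
    using ex_idempotent_power[OF R finite_R a] .
  define f where "f = a ^ N"
  define t where "t = y * a ^ (N - 1 + N)"
  have f: "f \<noteq> 0" "f * f = f" "f \<in> R"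
    using N y R_power a by (auto simp: f_def a_def)
  have t: "t \<in> R" using N y R_mult R_power a by (auto simp: t_def)
  have "f = a ^ N * a ^ N" using N by (simp add: f_def)
  also have "\<dots> = a * a ^ (N - 1 + N)"
    using N by (metis Suc_pred' add_Suc power_Suc power_add)
  finally have "f = x * t + x' * t"
    by (simp add: a_def t_def distrib_right mult.assoc)
  then have "f * f * f = f * (x * t) * f + f * (x' * t) * f"
    by (metis distrib_left distrib_right)
  then have ff: "f = f * (x * t) * f + f * (x' * t) * f" using f by simp
  define b where "b = f * (x * t) * f"
  define b' where "b' = f * (x' * t) * f"
  have "b \<in> rad" "b' \<in> rad"
    unfolding b_def b'_def by (intro rad_right rad_left x x' f t)+
  then obtain m k where mk: "b ^ m = 0" "b' ^ k = 0" using rad_nil by blast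
  have "f = b + b'" unfolding b_def b'_def by (rule ff)
  then have bf: "b = f - b'" by (metis add_diff_cancel_right')
  have fb: "f * b = b" using f by (simp add: b_def mult.assoc[symmetric])
  \<comment> \<open>If b z = 0 then z = b' z, hence z = b'^q z for all q, and some power of b' is
    0.\<close>
  have inj: "z = 0" if "b * z = 0" "f * z = z" for z
  proof -
    have "z = b' * z" using that bf by (simp add: left_diff_distrib)
    then have "z = b' ^ q * z" for q by (induction q) (simp_all add: mult.assoc)
    from this[of k] mk show ?thesis by simp
  qed
  have "b ^ i * f = 0 \<Longrightarrow> f = 0" for i
  proof (induction i)
    case (Suc i)
    have "f * (b ^ i * f) = b ^ i * f"
      using f fb by (cases i) (simp_all add: mult.assoc[symmetric])
    moreover have "b * (b ^ i * f) = 0"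
      using Suc.prems by (simp add: mult.assoc)
    ultimately have "b ^ i * f = 0" by (rule inj[rotated])
    then show ?case by (rule Suc.IH)
  qed simp
  from this[of m] mk f show False by simp
qed

lemma subrng_rad: "subrng rad"
proof -
  have "- y \<in> rad" if "y \<in> rad" for y
    using rad_right[OF that add_subgroup_uminus[OF R_add e_mem]] that rad_subset e_right by auto
  then have "x - y \<in> rad" if "x \<in> rad" "y \<in> rad" for x y
    using rad_add[of x "- y"] that by simp
  moreover have "0 \<in> rad" using add_subgroup_zero[OF R_add] power_Suc0_right[of "0::'a"]
    by (auto simp: rad_def intro!: exI[of _ 1])
  ultimately show ?thesis
    using rad_right rad_subset by (auto simp: subrng_def add_subgroup_def)
qed

section \<open>Primitive idempotents and their corner rings\<close>

definition primitive_idem :: "'a \<Rightarrow> bool" where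
  "primitive_idem f \<longleftrightarrow> f \<in> R \<and> f \<noteq> 0 \<and> f * f = f \<and>
     (\<forall>g\<in>R. g * g = g \<and> f * g = g \<and> g * f = g \<longrightarrow> g = 0 \<or> g = f)"

text \<open>In effect fRf is local: the idempotent power of a non-nilpotent element is non-zero and
  lies below f, so it is f itself.\<close>

lemma primitive_idem_power:
  assumes f: "primitive_idem f" and z: "z \<in> R" "f * z = z" "z * f = z" and "\<And>m. z ^ m \<noteq> 0"
  obtains N where "N > 0" "z ^ N = f"
proof -
  obtain N where N: "N > 0" "z ^ N * z ^ N = z ^ N"
    using ex_idempotent_power[OF R finite_R z(1)] .
  obtain M where M: "N = Suc M" using N gr0_implies_Suc by blast
  have "f * z ^ N = z ^ N" using z by (simp add: M mult.assoc[symmetric])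
  moreover have "z ^ N * f = z ^ N" using z by (simp add: M power_Suc2 mult.assoc del: power_Suc)
  ultimately have "z ^ N = f"
    using f N R_power z assms(5)[of N] by (auto simp: primitive_idem_def)
  with N that show ?thesis by blast
qed

text \<open>A non-radical element of fRg is an isomorphism between f and g. Some x y0 is not
  nilpotent, so after compression one of its powers is f, which yields y with x y = f. Then y x is a
  non-zero idempotent below g, hence equal to g.\<close>

lemma primitive_idem_inverse:
  assumes f: "primitive_idem f" and g: "primitive_idem g"
    and x: "x \<in> R" "f * x = x" "x * g = x" "x \<notin> rad"
  obtains y where "y \<in> R" "g * y = y" "y * f = y" "x * y = f" "y * x = g"
proof -
  have fR: "f \<in> R" "f * f = f" "f \<noteq> 0" and gR: "g \<in> R" "g * g = g"
    using f g by (auto simp: primitive_idem_def)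
  obtain y0 where y0: "y0 \<in> R" "\<nexists>m. (x * y0) ^ m = 0" using x by (auto simp: rad_def)
  define z where "z = x * y0 * f"
  have "\<nexists>m. z ^ m = 0"
  proof
    assume "\<exists>m. z ^ m = 0"
    then have "\<exists>m. (f * (x * y0)) ^ m = 0" unfolding z_def by (rule nil_swap)
    with y0 x show False by (simp add: mult.assoc[symmetric])
  qed
  moreover have z: "z \<in> R" "f * z = z" "z * f = z"
    using x y0 fR R_mult by (simp_all add: z_def mult.assoc) (simp_all add: mult.assoc[symmetric])
  ultimately obtain N where N: "N > 0" "z ^ N = f"
    using primitive_idem_power[OF f z] by metis
  obtain M where M: "N = Suc M" using N gr0_implies_Suc by blast
  \<comment> \<open>The exponent M alone would give z w = z^N = f, but for M = 0 the element z^M is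
    the 1 of the type, possibly outside \<open>R\<close>; adding N keeps the exponent
    positive.\<close>
  define w where "w = z ^ (M + N)"
  have w: "w \<in> R" "w * f = w" "z * w = f"
  proof -
    show "w \<in> R" using R_power z N by (simp add: w_def)
    show "w * f = w" using z by (simp add: w_def M power_Suc2 mult.assoc del: power_Suc)
    have "z * w = z ^ (N + N)" by (simp add: w_def M)
    then have "z * w = z ^ N * z ^ N" by (simp only: power_add)
    then show "z * w = f" using N fR by simp
  qed
  define y where "y = g * (y0 * (f * w))"
  have y: "y \<in> R" "g * y = y" "y * f = y"
    using w y0 fR gR R_mult by (simp_all add: y_def mult.assoc) (simp add: mult.assoc[symmetric])
  have xy: "x * y = f"
  proof -
    have "x * y = (x * g) * y0 * f * w" by (simp add: y_def mult.assoc)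
    also have "\<dots> = z * w" using x by (simp add: z_def)
    finally show ?thesis using w by simp
  qed
  have "y * x = 0 \<or> y * x = g"
  proof -
    have "(y * x) * (y * x) = y * (x * y) * x" by (simp add: mult.assoc)
    also have "\<dots> = y * x" using xy y by simp
    finally have "(y * x) * (y * x) = y * x" .
    moreover have "g * (y * x) = y * x" using y by (simp add: mult.assoc[symmetric])
    moreover have "(y * x) * g = y * x" using x by (simp add: mult.assoc)
    ultimately show ?thesis using g R_mult x y by (auto simp: primitive_idem_def)
  qed
  moreover have "y * x \<noteq> 0"
  proof
    assume "y * x = 0"
    then have "(x * y) * (x * y) = 0" by (metis mult.assoc mult_zero_left mult_zero_right)
    with xy fR show False by simp
  qed
  ultimately show ?thesis using that[of y] y xy by simp
qed

definition corner :: "'a \<Rightarrow> 'a set" where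
  "corner f = {z \<in> R. f * z = z \<and> z * f = z}"

lemma subrng_corner: "subrng (corner f)"
  using R_add R_mult
  by (auto simp: subrng_def add_subgroup_def corner_def right_diff_distrib left_diff_distrib mult.assoc)
    (simp_all add: mult.assoc[symmetric])

text \<open>Outside \<open>rad\<close>, z would have an inverse y in the corner, and then z^k y^k =
  f for all k >= 1, which is impossible when z is nilpotent.\<close>

lemma corner_nil_rad:
  assumes f: "primitive_idem f" and z: "z \<in> corner f" "z ^ m = 0"
  shows "z \<in> rad"
proof (rule ccontr)
  assume "z \<notin> rad"
  then obtain y where y: "y \<in> R" "f * y = y" "z * y = f"
    using primitive_idem_inverse[OF f f, of z] z by (auto simp: corner_def)
  have "z ^ Suc k * y ^ Suc k = f" for k
  proof (induction k)
    case (Suc k)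
    have "z ^ Suc (Suc k) * y ^ Suc (Suc k) = z * (z ^ Suc k * y ^ Suc k) * y"
      by (simp only: power_Suc[of z "Suc k"] power_Suc2[of y "Suc k"] mult.assoc)
    also have "\<dots> = z * (f * y)" by (simp only: Suc.IH mult.assoc)
    finally show ?case using y by simp
  qed (use y in simp)
  from this[of m] z f show False by (simp add: primitive_idem_def)
qed

text \<open>The residue ring of the corner is a division ring D. If x lies outside a subring T, then
  s + t x determines t up to \<open>rad\<close>, because a non-radical difference of two values of t
  could be inverted and would force x into T. So, when T contains the radical part, its image in D
  at least squares in size as soon as T grows.\<close>

lemma corner_rad_quotient_growth:
  assumes f: "primitive_idem f"
    and T: "subrng T" "T \<subseteq> corner f"
    and T': "subrng T'" "T \<subseteq> T'" "T' \<subseteq> corner f" "x \<in> T'" "x \<notin> T"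
  shows "card T * card T \<le> card (rad \<inter> corner f) * card T'"
proof -
  have finC: "finite (corner f)" using finite_R by (simp add: corner_def)
  define \<phi> where "\<phi> = (\<lambda>(s, t). s + t * x)"
  have fibre: "card {q \<in> T \<times> T. \<phi> q = b} \<le> card (rad \<inter> corner f)" if b: "b \<in> \<phi> ` (T \<times> T)" for b
  proof -
    obtain s0 t0 where st: "s0 \<in> T" "t0 \<in> T" "b = s0 + t0 * x"
      using b unfolding \<phi>_def by force
    have "(\<lambda>(s, t). t - t0) ` {q \<in> T \<times> T. \<phi> q = b} \<subseteq> rad \<inter> corner f"
    proof (rule image_subsetI)
      fix q assume "q \<in> {q \<in> T \<times> T. \<phi> q = b}"
      then obtain s t where q: "q = (s, t)" and *: "s \<in> T" "t \<in> T" "\<phi> (s, t) = b"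
        by (cases q) auto
      define a where "a = t - t0"
      have a: "a \<in> T" using * st T(1) by (auto simp: a_def subrng_def intro: add_subgroup_diff)
      have "a * x = s0 - s" using * st by (simp add: \<phi>_def a_def algebra_simps)
      then have ax: "a * x \<in> T" using * st T(1) by (auto simp: subrng_def intro: add_subgroup_diff)
      have aC: "a \<in> corner f" using a T by blast
      have "a \<in> rad"
      proof (rule ccontr)
        assume "a \<notin> rad"
        then have "\<And>m. a ^ m \<noteq> 0" using corner_nil_rad[OF f aC] by blast
        then obtain N where N: "N > 0" "a ^ N = f"
          using primitive_idem_power[OF f, of a] aC by (auto simp: corner_def)
        obtain M where M: "N = Suc M" using N gr0_implies_Suc by blast
        \<comment> \<open>Multiplying a x by a^(N-1) gives f x = x, so x would lie in
          \<open>T\<close>.\<close>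
        have "a ^ q * (a * x) \<in> T" for q
          using ax a T(1) by (induction q) (auto simp: mult.assoc intro: subrng_mult)
        from this[of M] have "f * x \<in> T"
          using N M by (simp add: mult.assoc[symmetric] power_Suc2[symmetric])
        then show False using T' by (auto simp: corner_def)
      qed
      with aC show "(case q of (s, t) \<Rightarrow> t - t0) \<in> rad \<inter> corner f" by (simp add: a_def q)
    qed
    moreover have "inj_on (\<lambda>(s, t). t - t0) {q \<in> T \<times> T. \<phi> q = b}"
      by (auto simp: inj_on_def \<phi>_def)
    ultimately show ?thesis
      using finC by (intro card_inj_on_le[where f = "\<lambda>(s, t). t - t0"]) auto
  qed
  have finT: "finite T" "finite T'" using T T' finC finite_subset by blast+
  have "s + t * x \<in> T'" if "s \<in> T" "t \<in> T" for s t
    using that T'(2) add_subgroup_add[OF subrng_add_subgroup[OF T'(1)] _ subrng_mult[OF T'(1) _ T'(4)]]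
    by blast
  then have img: "\<phi> ` (T \<times> T) \<subseteq> T'" by (auto simp: \<phi>_def)
  have "card (T \<times> T) \<le> card (rad \<inter> corner f) * card (\<phi> ` (T \<times> T))"
    by (rule card_le_mult_card_image[OF _ fibre]) (use finT in auto)
  also have "\<dots> \<le> card (rad \<inter> corner f) * card T'"
    using card_mono[OF finT(2) img] by simp
  finally show ?thesis by (simp add: card_cartesian_product)
qed

text \<open>The index over the radical part is at least 2 at the start, since f is not in
  \<open>rad\<close>, and it squares with each new generator. Hence the double exponential, and
  hence few generators for a corner.\<close>

lemma primitive_idem_corner_generators:
  assumes f: "primitive_idem f"
  defines "T \<equiv> \<lambda>gs. group_closure (rng_closure (insert f (set gs)) \<union> (rad \<inter> corner f))"
  shows "\<exists>gs. length gs = l \<and> set gs \<subseteq> corner f \<and>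
           (corner f \<subseteq> T gs \<or> 2 ^ 2 ^ l * card (rad \<inter> corner f) \<le> card (T gs))"
proof -
  have finC: "finite (corner f)" using finite_R by (simp add: corner_def)
  have fC: "f \<in> corner f" using f by (simp add: corner_def primitive_idem_def)
  have JC: "add_subgroup (rad \<inter> corner f)"
    using subrng_rad subrng_corner[of f] by (auto simp: subrng_def add_subgroup_def)
  have j0: "card (rad \<inter> corner f) > 0"
    using JC finC by (auto simp: card_gt_0_iff dest: add_subgroup_zero)
  have T: "subrng (T gs)" "T gs \<subseteq> corner f" if gs: "set gs \<subseteq> corner f" for gs
  proof -
    have S: "rng_closure (insert f (set gs)) \<subseteq> corner f"
      using gs fC by (intro rng_closure_subset subrng_corner) auto
    then show "T gs \<subseteq> corner f" unfolding T_def
      by (intro group_closure_subset) (auto intro: subrng_add_subgroup subrng_corner)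
    have "x * y \<in> T gs" if xy: "x \<in> T gs" "y \<in> T gs" for x y
    proof -
      note iff = group_closure_Un_iff[OF subrng_add_subgroup[OF subrng_rng_closure] JC]
      obtain s c s' c' where *: "s \<in> rng_closure (insert f (set gs))" "c \<in> rad \<inter> corner f" "x = s + c"
          "s' \<in> rng_closure (insert f (set gs))" "c' \<in> rad \<inter> corner f" "y = s' + c'"
        using xy unfolding T_def iff by blast
      \<comment> \<open>The radical part is an ideal of the corner, so adding it to a subring gives
        a subring again.\<close>
      have m: "a * b \<in> rad \<inter> corner f"
        if "a \<in> corner f" "b \<in> corner f" "a \<in> rad \<or> b \<in> rad" for a b
        using that rad_left rad_right subrng_mult[OF subrng_corner] by (auto simp: corner_def)
      have sub: "s \<in> corner f" "s' \<in> corner f" "c \<in> corner f" "c' \<in> corner f"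
        using * S by auto
      have "x * y = s * s' + (s * c' + (c * s' + c * c'))" using * by (simp add: algebra_simps)
      moreover have "s * s' \<in> rng_closure (insert f (set gs))"
        using * by (intro rng_closure.mult)
      moreover have "s * c' + (c * s' + c * c') \<in> rad \<inter> corner f"
        using * sub by (intro add_subgroup_add[OF JC] m) auto
      ultimately show ?thesis unfolding T_def iff by blast
    qed
    then show "subrng (T gs)" by (auto simp: subrng_def T_def)
  qed
  show ?thesis
  proof (induction l)
    case 0
    have "f ^ m \<noteq> 0" for m
    proof -
      have "f ^ m * f = f" using f by (induction m) (simp_all add: primitive_idem_def mult.assoc)
      then show ?thesis using f by (auto simp: primitive_idem_def)
    qed
    then have fJ: "f \<notin> rad" using rad_nil by blast
    have fT: "f \<in> T []"
      using subset_rng_closure[of "{f}"] subset_group_closure[of "rng_closure {f} \<union> _"] by (auto simp: T_def)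
    have sub: "rad \<inter> corner f \<subseteq> T []"
      using subset_group_closure[of "_ \<union> (rad \<inter> corner f)"] by (auto simp: T_def)
    have finT: "finite (T [])" using T[of "[]"] finC finite_subset by auto
    have "card (rad \<inter> corner f) < card (T [])"
      using fT fJ sub finT by (intro psubset_card_mono) auto
    moreover have "card (rad \<inter> corner f) dvd card (T [])"
      using T[of "[]"] JC sub finT by (intro card_add_subgroup_dvd) (auto simp: subrng_def)
    ultimately have "2 * card (rad \<inter> corner f) \<le> card (T [])"
      by (auto elim!: dvdE)
    then show ?case by (intro exI[of _ "[]"]) simp
  next
    case (Suc l)
    then obtain gs where gs: "length gs = l" "set gs \<subseteq> corner f"
      "corner f \<subseteq> T gs \<or> 2 ^ 2 ^ l * card (rad \<inter> corner f) \<le> card (T gs)" by blast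
    show ?case
    proof (cases "corner f \<subseteq> T gs")
      case True
      then show ?thesis
        using gs fC by (intro exI[of _ "f # gs"]) (auto simp: T_def)
    next
      case False
      then obtain x where x: "x \<in> corner f" "x \<notin> T gs" by blast
      have xgs: "set (x # gs) \<subseteq> corner f" using x gs by auto
      have sub: "T gs \<subseteq> T (x # gs)"
      proof -
        have "rng_closure (insert f (set gs)) \<subseteq> rng_closure (insert f (set (x # gs)))"
          using subset_rng_closure[of "insert f (set (x # gs))"] by (intro rng_closure_subset) auto
        then show ?thesis unfolding T_def by (intro group_closure_mono) auto
      qed
      have xT: "x \<in> T (x # gs)"
        using subset_rng_closure[of "insert f (set (x # gs))"]
          subset_group_closure[of "rng_closure (insert f (set (x # gs))) \<union> _"] by (auto simp: T_def)
      have "card (T gs) * card (T gs) \<le> card (rad \<inter> corner f) * card (T (x # gs))"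
        using corner_rad_quotient_growth[OF f T[OF gs(2)] T(1)[OF xgs] sub T(2)[OF xgs] xT x(2)] .
      moreover have "(2 ^ 2 ^ l * card (rad \<inter> corner f)) * (2 ^ 2 ^ l * card (rad \<inter> corner f))
          \<le> card (T gs) * card (T gs)"
        using gs False by (intro mult_mono) auto
      moreover have "(2::nat) ^ 2 ^ Suc l = 2 ^ 2 ^ l * 2 ^ 2 ^ l"
        by (simp only: power_add[symmetric] mult_2[symmetric] power_Suc)
      then have "card (rad \<inter> corner f) * (2 ^ 2 ^ Suc l * card (rad \<inter> corner f))
          = (2 ^ 2 ^ l * card (rad \<inter> corner f)) * (2 ^ 2 ^ l * card (rad \<inter> corner f))"
        by (simp only: mult_ac)
      ultimately have "card (rad \<inter> corner f) * (2 ^ 2 ^ Suc l * card (rad \<inter> corner f))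
          \<le> card (rad \<inter> corner f) * card (T (x # gs))"
        by (simp only:)
      then have "2 ^ 2 ^ Suc l * card (rad \<inter> corner f) \<le> card (T (x # gs))"
        using j0 by simp
      then show ?thesis using gs xgs by (intro exI[of _ "x # gs"]) auto
    qed
  qed
qed

section \<open>Complete systems of orthogonal idempotents\<close>

definition orthogonal_idems :: "'a set \<Rightarrow> bool" where
  "orthogonal_idems E \<longleftrightarrow> E \<subseteq> R \<and> 0 \<notin> E \<and> (\<forall>f\<in>E. f * f = f) \<and>
     (\<forall>f\<in>E. \<forall>g\<in>E. f \<noteq> g \<longrightarrow> f * g = 0) \<and> \<Sum>E = e"

text \<open>Multiplication by g extracts the g-component. One ring element can therefore store a
  separate element for every idempotent, which is how the number of generators is kept
  small.\<close>

lemma orthogonal_idems_mult_left: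
  assumes "orthogonal_idems E" "g \<in> E" "A \<subseteq> E" "\<And>f. f \<in> A \<Longrightarrow> f * u f = u f"
  shows "g * (\<Sum>f\<in>A. u f) = (if g \<in> A then u g else 0)"
proof -
  have fin: "finite A" using assms finite_R by (meson finite_subset orthogonal_idems_def)
  have "g * u f = (if f = g then u g else 0)" if "f \<in> A" for f
  proof (cases "f = g")
    case False
    have "g * u f = g * f * u f" using assms(4)[OF that] by (simp add: mult.assoc)
    then show ?thesis using False assms that by (auto simp: orthogonal_idems_def)
  qed (use assms(4)[OF that] in simp)
  then have "g * (\<Sum>f\<in>A. u f) = (\<Sum>f\<in>A. if f = g then u g else 0)"
    by (simp add: sum_distrib_left)
  with fin show ?thesis by simp
qed

lemma orthogonal_idems_mult_right:
  assumes "orthogonal_idems E" "g \<in> E" "A \<subseteq> E" "\<And>f. f \<in> A \<Longrightarrow> u f * f = u f"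
  shows "(\<Sum>f\<in>A. u f) * g = (if g \<in> A then u g else 0)"
proof -
  have fin: "finite A" using assms finite_R by (meson finite_subset orthogonal_idems_def)
  have "u f * g = (if f = g then u g else 0)" if "f \<in> A" for f
  proof (cases "f = g")
    case False
    have "u f * g = u f * (f * g)" using assms(4)[OF that] by (simp add: mult.assoc[symmetric])
    then show ?thesis using False assms that by (auto simp: orthogonal_idems_def)
  qed (use assms(4)[OF that] in simp)
  then have "(\<Sum>f\<in>A. u f) * g = (\<Sum>f\<in>A. if f = g then u g else 0)"
    by (simp add: sum_distrib_right)
  with fin show ?thesis by simp
qed

text \<open>Different subsets have different sums: f belongs to a subset iff f times its sum is
  non-zero.\<close>

lemma card_orthogonal_idems:
  assumes E: "orthogonal_idems E"
  shows "2 ^ card E \<le> card R"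
proof -
  have fin: "finite E" using E finite_R finite_subset by (auto simp: orthogonal_idems_def)
  have "inj_on \<Sum> (Pow E)"
  proof (rule inj_onI)
    fix A B assume AB: "A \<in> Pow E" "B \<in> Pow E" "\<Sum>A = \<Sum>B"
    have *: "f \<in> C \<longleftrightarrow> f * \<Sum>C \<noteq> 0" if "f \<in> E" "C \<in> Pow E" for f C
      using orthogonal_idems_mult_left[OF E that(1), of C "\<lambda>f. f"] that E
      by (auto simp: orthogonal_idems_def subset_iff split: if_splits)
    show "A = B" using AB *[of _ A] *[of _ B] by auto
  qed
  moreover have "\<Sum> ` Pow E \<subseteq> R"
    using E R_add by (auto simp: orthogonal_idems_def intro!: add_subgroup_sum)
  ultimately have "card (Pow E) \<le> card R"
    using finite_R by (intro card_inj_on_le)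
  then show ?thesis using fin by (simp add: card_Pow)
qed

text \<open>In a system of largest size every member is primitive, since a smaller idempotent g
  below f would allow f to be replaced by g and f - g.\<close>

lemma ex_primitive_decomposition:
  assumes "e \<noteq> 0"
  obtains E where "orthogonal_idems E" "\<And>f. f \<in> E \<Longrightarrow> primitive_idem f"
proof -
  have "orthogonal_idems {e}"
    using assms e_mem e_left by (auto simp: orthogonal_idems_def)
  moreover have "card E < Suc (card R)" if "orthogonal_idems E" for E
    using that finite_R by (auto simp: orthogonal_idems_def less_Suc_eq_le intro: card_mono)
  ultimately obtain E where E: "orthogonal_idems E"
    and max: "\<And>E'. orthogonal_idems E' \<Longrightarrow> card E' \<le> card E"
    using ex_has_greatest_nat[of orthogonal_idems "{e}" card "Suc (card R)"] by blast
  have fin: "finite E" using E finite_R finite_subset by (auto simp: orthogonal_idems_def)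
  have "primitive_idem f" if f: "f \<in> E" for f
  proof (rule ccontr)
    assume "\<not> primitive_idem f"
    then obtain g where g: "g \<in> R" "g * g = g" "f * g = g" "g * f = g" "g \<noteq> 0" "g \<noteq> f"
      using E f by (auto simp: orthogonal_idems_def primitive_idem_def)
    have fE: "f \<in> R" "f * f = f" using E f by (auto simp: orthogonal_idems_def)
    define E' where "E' = insert g (insert (f - g) (E - {f}))"
    have o: "h * g = 0" "g * h = 0" "h * (f - g) = 0" "(f - g) * h = 0" if h: "h \<in> E - {f}" for h
    proof -
      have hf: "h * f = 0" "f * h = 0" using h f E by (auto simp: orthogonal_idems_def)
      have "h * g = h * f * g" "g * h = g * (f * h)" using g by (simp_all add: mult.assoc[symmetric]) (simp_all add: mult.assoc)
      then show "h * g = 0" "g * h = 0" using hf by simp_all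
      then show "h * (f - g) = 0" "(f - g) * h = 0" using hf by (simp_all add: algebra_simps)
    qed
    have o': "g * (f - g) = 0" "(f - g) * g = 0" "(f - g) * (f - g) = f - g"
      using g fE by (simp_all add: algebra_simps)
    have gE: "g \<notin> E - {f}"
      using o(1)[of g] g by auto
    have fgE: "f - g \<notin> E - {f}"
      using o(3)[of "f - g"] o' g by auto
    have gfg: "g \<noteq> f - g" using o' g by auto
    have "\<Sum>E' = g + ((f - g) + \<Sum>(E - {f}))"
      unfolding E'_def using fin gE fgE gfg by (simp add: sum.insert)
    also have "\<dots> = e"
      using fin f E by (simp add: sum_diff1 orthogonal_idems_def)
    finally have "\<Sum>E' = e" .
    moreover have "E' \<subseteq> R"
      using g fE E R_add by (auto simp: E'_def orthogonal_idems_def intro: add_subgroup_diff)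
    moreover have "0 \<notin> E'" using g E by (auto simp: E'_def orthogonal_idems_def)
    moreover have "\<forall>h\<in>E'. h * h = h" using g o' E by (auto simp: E'_def orthogonal_idems_def)
    moreover have "\<forall>h\<in>E'. \<forall>k\<in>E'. h \<noteq> k \<longrightarrow> h * k = 0"
      using g o o' E by (auto simp: E'_def orthogonal_idems_def)
    ultimately have "orthogonal_idems E'" by (simp add: orthogonal_idems_def)
    from max[OF this] have "card E' \<le> card E" .
    moreover have "card E' = Suc (card E)"
      using fin f gE fgE gfg card_Suc_Diff1[OF fin f] by (simp add: E'_def)
    ultimately show False by simp
  qed
  with E that show ?thesis by blast
qed

text \<open>Isomorphism of idempotents: the right modules fR and gR are isomorphic, with a and b
  giving mutually inverse maps.\<close>

definition linked :: "'a \<Rightarrow> 'a \<Rightarrow> bool" where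
  "linked f g \<longleftrightarrow> (\<exists>a\<in>R. \<exists>b\<in>R. f * a = a \<and> a * g = a \<and> g * b = b \<and> b * f = b \<and> a * b = f \<and> b * a = g)"

lemma linked_refl: "primitive_idem f \<Longrightarrow> linked f f"
  unfolding linked_def primitive_idem_def by blast

lemma linked_sym: "linked f g \<Longrightarrow> linked g f"
  unfolding linked_def by blast

lemma linked_trans:
  assumes "linked f g" "linked g h"
  shows "linked f h"
proof -
  obtain a b where ab: "a \<in> R" "b \<in> R" "f * a = a" "a * g = a" "g * b = b" "b * f = b" "a * b = f" "b * a = g"
    using assms(1) unfolding linked_def by blast
  obtain c d where cd: "c \<in> R" "d \<in> R" "g * c = c" "c * h = c" "h * d = d" "d * g = d" "c * d = g" "d * c = h"
    using assms(2) unfolding linked_def by blast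
  have "(a * c) * (d * b) = a * (c * d) * b" "(d * b) * (a * c) = d * (b * a) * c"
    by (simp_all add: mult.assoc)
  then have "(a * c) * (d * b) = f" "(d * b) * (a * c) = h" using ab cd by simp_all
  moreover have "f * (a * c) = a * c" "h * (d * b) = d * b" using ab cd by (simp_all add: mult.assoc[symmetric])
  moreover have "(a * c) * h = a * c" "(d * b) * f = d * b" using ab cd by (simp_all add: mult.assoc)
  ultimately show ?thesis using ab cd R_mult unfolding linked_def by blast
qed

text \<open>Modulo the radical, \<open>R\<close> is a product of matrix rings over division rings. One sum of matrix
  units in each direction connects all isomorphic diagonal blocks, and the \<open>s\<^sup>2\<close> diagonal idempotents
  are products of \<open>2 * s\<close> partial sums.\<close>

theorem ex_generators_mod_rad:
  assumes "e \<noteq> 0" and s: "card R < 2 ^ Suc (s * s)" and L: "card R < 2 ^ 2 ^ L"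
  obtains gs where "length gs = 2 * s + 2 + L" "set gs \<subseteq> R"
    "R = group_closure (rng_closure (set gs) \<union> rad)"
proof -
  obtain E where E: "orthogonal_idems E" and prim: "\<And>f. f \<in> E \<Longrightarrow> primitive_idem f"
    using ex_primitive_decomposition[OF assms(1)] by blast
  have fin: "finite E" using E finite_R finite_subset by (auto simp: orthogonal_idems_def)
  have ER: "f \<in> R" "f * f = f" "f \<noteq> 0" if "f \<in> E" for f
    using prim[OF that] by (auto simp: primitive_idem_def)
  have "2 ^ card E < (2::nat) ^ Suc (s * s)"
    using card_orthogonal_idems[OF E] s by linarith
  then have "card E \<le> s * s" by (simp only: power_strict_increasing_iff less_Suc_eq_le)
  then have "card E \<le> card ({..<s} \<times> {..<s})" by (simp add: card_cartesian_product)
  then obtain lab where lab: "lab ` E \<subseteq> {..<s} \<times> {..<s}" "inj_on lab E"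
    using card_le_inj[OF fin, of "{..<s} \<times> {..<s}"] by auto
  \<comment> \<open>Each idempotent occupies its own cell of an s by s grid. A row sum times a
    column sum is the idempotent in their common cell, so 2 s elements generate all of
    \<open>E\<close>.\<close>
  define row where "row a = \<Sum>{f \<in> E. fst (lab f) = a}" for a
  define col where "col b = \<Sum>{f \<in> E. snd (lab f) = b}" for b
  have lab_prod: "row (fst (lab f)) * col (snd (lab f)) = f" if f: "f \<in> E" for f
  proof -
    let ?A = "{g \<in> E. fst (lab g) = fst (lab f)}" and ?B = "{g \<in> E. snd (lab g) = snd (lab f)}"
    have "row (fst (lab f)) * col (snd (lab f)) = (\<Sum>g\<in>?A. g * \<Sum>?B)"
      by (simp add: row_def col_def sum_distrib_right)
    also have "\<dots> = (\<Sum>g\<in>?A. if g \<in> ?B then g else 0)"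
      using orthogonal_idems_mult_left[OF E, of _ ?B "\<lambda>f. f"] ER by (intro sum.cong) auto
    also have "\<dots> = (\<Sum>g\<in>?A. if g = f then g else 0)"
      using lab(2) f by (intro sum.cong) (auto simp: inj_on_def prod_eq_iff)
    also have "\<dots> = f" using fin f by simp
    finally show ?thesis .
  qed
  \<comment> \<open>A representative of the isomorphism class. Linked idempotents define the same
    predicate, so the choice operator returns the same representative for both.\<close>
  define r where "r f = (SOME g. g \<in> E \<and> linked f g)" for f
  have r: "r f \<in> E" "linked f (r f)" if "f \<in> E" for f
    unfolding r_def using someI[of "\<lambda>g. g \<in> E \<and> linked f g" f] linked_refl[OF prim[OF that]] that by auto
  have r_eq: "r f = r g" if "linked f g" for f g
  proof -
    have "linked f h \<longleftrightarrow> linked g h" for h using that linked_sym linked_trans by blast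
    then show ?thesis by (simp add: r_def)
  qed
  have "\<exists>a b. a \<in> R \<and> b \<in> R \<and> f * a = a \<and> a * r f = a \<and> r f * b = b \<and> b * f = b \<and> a * b = f \<and> b * a = r f"
    if "f \<in> E" for f
    using r(2)[OF that] unfolding linked_def by blast
  then obtain u v where uv: "\<And>f. f \<in> E \<Longrightarrow> u f \<in> R \<and> v f \<in> R \<and> f * u f = u f \<and> u f * r f = u f \<and>
      r f * v f = v f \<and> v f * f = v f \<and> u f * v f = f \<and> v f * u f = r f"
    by metis
  \<comment> \<open>\<open>h\<close> and \<open>h'\<close> hold all connecting elements at once; f h
    = \<open>u f\<close> and h' f = \<open>v f\<close> recover them.\<close>
  define h where "h = (\<Sum>f\<in>E. u f)"
  define h' where "h' = (\<Sum>f\<in>E. v f)"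
  have h: "f * h = u f" "h' * f = v f" if "f \<in> E" for f
    unfolding h_def h'_def
    using orthogonal_idems_mult_left[OF E that, of E u] orthogonal_idems_mult_right[OF E that, of E v]
      uv that by auto
  have "\<exists>gs. length gs = L \<and> set gs \<subseteq> corner f \<and>
      corner f \<subseteq> group_closure (rng_closure (insert f (set gs)) \<union> (rad \<inter> corner f))" if f: "f \<in> E" for f
  proof -
    let ?T = "\<lambda>gs. group_closure (rng_closure (insert f (set gs)) \<union> (rad \<inter> corner f))"
    obtain gs where gs: "length gs = L" "set gs \<subseteq> corner f"
      "corner f \<subseteq> ?T gs \<or> 2 ^ 2 ^ L * card (rad \<inter> corner f) \<le> card (?T gs)"
      using primitive_idem_corner_generators[OF prim[OF f], of L] by blast
    have "?T gs \<subseteq> R"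
    proof -
      have "rng_closure (insert f (set gs)) \<subseteq> R"
        using gs(2) ER[OF f] by (intro rng_closure_subset R) (auto simp: corner_def)
      then show ?thesis using rad_subset by (intro group_closure_subset R_add) auto
    qed
    then have "card (?T gs) < 2 ^ 2 ^ L"
      using L card_mono[OF finite_R, of "?T gs"] by simp
    moreover have "0 \<in> rad \<inter> corner f"
      using add_subgroup_zero[OF subrng_add_subgroup[OF subrng_rad]]
        add_subgroup_zero[OF subrng_add_subgroup[OF subrng_corner]] by blast
    then have "card (rad \<inter> corner f) > 0"
      using finite_R by (auto simp: card_gt_0_iff corner_def)
    then have "2 ^ 2 ^ L \<le> 2 ^ 2 ^ L * card (rad \<inter> corner f)" by simp
    ultimately show ?thesis using gs by (intro exI[of _ gs]) linarith
  qed
  then obtain loc where loc: "\<And>f. f \<in> E \<Longrightarrow> length (loc f) = L \<and> set (loc f) \<subseteq> corner f \<and>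
      corner f \<subseteq> group_closure (rng_closure (insert f (set (loc f))) \<union> (rad \<inter> corner f))"
    by metis
  \<comment> \<open>The i-th local generators of all corners share one sum, so L elements serve
    every corner simultaneously.\<close>
  define \<gamma> where "\<gamma> i = (\<Sum>f\<in>E. loc f ! i)" for i
  have loc_nth: "loc f ! i \<in> corner f" if "f \<in> E" "i < L" for f i
    using loc[OF that(1)] that(2) by (metis nth_mem subsetD)
  have \<gamma>: "f * \<gamma> i = loc f ! i" if "f \<in> E" "i < L" for f i
    unfolding \<gamma>_def using orthogonal_idems_mult_left[OF E that(1), of E "\<lambda>f. loc f ! i"]
      loc_nth that by (auto simp: corner_def)
  define gs where "gs = map row [0..<s] @ map col [0..<s] @ [h, h'] @ map \<gamma> [0..<L]"
  let ?S = "rng_closure (set gs)"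
  have len: "length gs = 2 * s + 2 + L" by (simp add: gs_def)
  have gsR: "set gs \<subseteq> R"
    using ER uv loc_nth
    by (auto simp: gs_def row_def col_def h_def h'_def \<gamma>_def corner_def intro!: add_subgroup_sum[OF R_add])
  have Smem: "i < s \<Longrightarrow> row i \<in> ?S" "i < s \<Longrightarrow> col i \<in> ?S" "h \<in> ?S" "h' \<in> ?S" "i < L \<Longrightarrow> \<gamma> i \<in> ?S" for i
    by (rule subset_rng_closure[of "set gs", THEN subsetD], simp add: gs_def)+
  have ES: "f \<in> ?S" if f: "f \<in> E" for f
  proof -
    have "fst (lab f) < s" "snd (lab f) < s" using lab(1) f by auto
    then have "row (fst (lab f)) \<in> ?S" "col (snd (lab f)) \<in> ?S"
      by (simp_all add: Smem)
    from rng_closure.mult[OF this] show ?thesis using lab_prod[OF f] by simp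
  qed
  have uS: "u f \<in> ?S" and vS: "v f \<in> ?S" if f: "f \<in> E" for f
  proof -
    show "u f \<in> ?S" "v f \<in> ?S" using Smem(3,4) rng_closure.mult ES[OF f] h[OF f] by metis+
  qed
  let ?T = "group_closure (?S \<union> rad)"
  have iff: "x \<in> ?T \<longleftrightarrow> (\<exists>a\<in>?S. \<exists>b\<in>rad. x = a + b)" for x
    by (intro group_closure_Un_iff subrng_add_subgroup subrng_rng_closure subrng_rad)
  have SR: "?S \<subseteq> R" using gsR by (intro rng_closure_subset R)
  have cornerT: "corner f \<subseteq> ?T" if f: "f \<in> E" for f
  proof -
    have "insert f (set (loc f)) \<subseteq> ?S"
    proof -
      have "loc f ! i \<in> ?S" if i: "i < L" for i
      proof -
        show ?thesis using Smem(5)[OF i] rng_closure.mult[OF ES[OF f]] \<gamma>[OF f i] by metis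
      qed
      then show ?thesis using loc[OF f] ES[OF f] by (auto simp: in_set_conv_nth)
    qed
    then have "rng_closure (insert f (set (loc f))) \<subseteq> ?S"
      by (intro rng_closure_subset subrng_rng_closure)
    then have "group_closure (rng_closure (insert f (set (loc f))) \<union> (rad \<inter> corner f)) \<subseteq> ?T"
      by (intro group_closure_mono) auto
    with loc[OF f] show ?thesis by blast
  qed
  \<comment> \<open>A piece outside \<open>rad\<close> links f and g, so both have the same
    representative. Conjugating by \<open>v f\<close> and \<open>u g\<close> moves the piece into
    the corner of the representative, where it is generated modulo \<open>rad\<close>; conjugating
    back restores it.\<close>
  have piece: "f * x * g \<in> ?T" if x: "x \<in> R" and f: "f \<in> E" and g: "g \<in> E" for f x g
  proof (cases "f * x * g \<in> rad")
    case True
    then show ?thesis using subset_group_closure[of "?S \<union> rad"] by auto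
  next
    case False
    define y where "y = f * x * g"
    have y: "y \<in> R" "f * y = y" "y * g = y" "y \<notin> rad"
      using x ER[OF f] ER[OF g] R_mult False
      by (auto simp: y_def mult.assoc) (auto simp: mult.assoc[symmetric])
    obtain y' where y': "y' \<in> R" "g * y' = y'" "y' * f = y'" "y * y' = f" "y' * y = g"
      using primitive_idem_inverse[OF prim[OF f] prim[OF g] y] .
    have "linked f g" unfolding linked_def using y y' by blast
    then have rr: "r f = r g" by (rule r_eq)
    define z where "z = v f * y * u g"
    have "z \<in> corner (r f)"
      using uv[OF f] uv[OF g] y R_mult rr
      by (auto simp: z_def corner_def mult.assoc) (auto simp: mult.assoc[symmetric])
    then have "z \<in> ?T" using cornerT[OF r(1)[OF f]] by blast
    then obtain a b where ab: "a \<in> ?S" "b \<in> rad" "z = a + b" using iff by blast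
    have "y = (f * y) * g" using y by simp
    also have "\<dots> = (u f * v f) * y * (u g * v g)" using uv[OF f] uv[OF g] by simp
    also have "\<dots> = u f * z * v g" by (simp add: z_def mult.assoc)
    also have "\<dots> = u f * a * v g + u f * b * v g" using ab by (simp add: algebra_simps)
    finally have "y = u f * a * v g + u f * b * v g" .
    moreover have "u f * a * v g \<in> ?S" using ab uS[OF f] vS[OF g] by (intro rng_closure.mult)
    moreover have "u f * b * v g \<in> rad" using ab uv[OF f] uv[OF g] by (intro rad_right rad_left) auto
    ultimately show ?thesis unfolding iff y_def[symmetric] by blast
  qed
  have "x \<in> ?T" if x: "x \<in> R" for x
  proof -
    have "x = e * x * e" using x e_left e_right by simp
    also have "\<dots> = \<Sum>E * x * \<Sum>E" using E by (simp add: orthogonal_idems_def)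
    also have "\<dots> = (\<Sum>f\<in>E. \<Sum>g\<in>E. f * x * g)"
      by (simp add: sum_distrib_left sum_distrib_right) (rule sum.swap)
    finally have "x = (\<Sum>f\<in>E. \<Sum>g\<in>E. f * x * g)" .
    moreover have "(\<Sum>f\<in>E. \<Sum>g\<in>E. f * x * g) \<in> ?T"
      using piece x by (intro add_subgroup_sum add_subgroup_group_closure)
    ultimately show ?thesis by simp
  qed
  moreover have "?T \<subseteq> R" using SR rad_subset by (intro group_closure_subset R_add) auto
  ultimately show ?thesis using that[of gs] len gsR by blast
qed

end

section \<open>Reconstructing a ring from partial multiplication data\<close>

text \<open>Compatibility is extended from \<open>B\<close> times \<open>B\<close> to
  \<open>B\<close> times \<open>J\<close>, then to \<open>J\<close> times \<open>J\<close>, then to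
  all of \<open>R\<close>. Within \<open>J\<close> the extension is by
  \<open>nil_generation\<close>: associativity shifts a factor from \<open>Y\<close> to a place
  where its multiplication is already known.\<close>

lemma mult_hom_of_generators:
  fixes R :: "'a::ring_1 set" and \<psi> :: "'a \<Rightarrow> 'b::ring_1"
  assumes R: "subrng R" and \<psi>: "\<And>x y. x \<in> R \<Longrightarrow> y \<in> R \<Longrightarrow> \<psi> (x - y) = \<psi> x - \<psi> y"
    and J: "subrng J" "finite J" "J \<subseteq> R" "\<And>x. x \<in> J \<Longrightarrow> \<exists>m. x ^ m = 0"
    and G: "G \<subseteq> R" "R \<subseteq> group_closure (rng_closure G \<union> J)"
    and Y: "Y \<subseteq> J" and B: "B \<subseteq> J"
    and gen: "J \<subseteq> group_closure (B \<union> {x * y |x y. x \<in> J \<and> y \<in> Y})"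
    and left: "\<And>g x. g \<in> G \<union> Y \<Longrightarrow> x \<in> R \<Longrightarrow> \<psi> (g * x) = \<psi> g * \<psi> x"
    and right: "\<And>g x. g \<in> G \<union> Y \<Longrightarrow> x \<in> R \<Longrightarrow> \<psi> (x * g) = \<psi> x * \<psi> g"
    and BB: "\<And>b b'. b \<in> B \<Longrightarrow> b' \<in> B \<Longrightarrow> \<psi> (b * b') = \<psi> b * \<psi> b'"
    and xy: "x \<in> R" "y \<in> R"
  shows "\<psi> (x * y) = \<psi> x * \<psi> y"
proof -
  note Ra = subrng_add_subgroup[OF R]
  note Ja = subrng_add_subgroup[OF J(1)]
  have \<psi>0: "\<psi> 0 = 0" using \<psi>[of 0 0] add_subgroup_zero[OF Ra] by simp
  note mem = subrng_mult[OF R] subrng_mult[OF J(1)] add_subgroup_diff[OF Ra] add_subgroup_diff[OF Ja]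
    add_subgroup_zero[OF Ra] add_subgroup_zero[OF Ja]
  have YR: "Y \<subseteq> R" and BR: "B \<subseteq> R" using Y B J by auto
  have BJ: "\<psi> (b * x) = \<psi> b * \<psi> x" if b: "b \<in> B" and x: "x \<in> J" for b x
  proof -
    have bR: "b \<in> R" using b BR by auto
    \<comment> \<open>Closure under right multiplication by y in \<open>Y\<close> comes from b(zy) =
      (bz)y and the known right multiplication by y.\<close>
    define K where "K = {x \<in> J. \<psi> (b * x) = \<psi> b * \<psi> x}"
    have "J \<subseteq> K"
    proof (rule nil_generation[OF J(1,2,4) Y _ _ _ gen])
      show "add_subgroup K"
        using J(3) bR by (auto simp: K_def add_subgroup_def mem \<psi>0 right_diff_distrib \<psi> subset_iff)
      show "B \<subseteq> K" using b B BB by (auto simp: K_def)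
      show "z * y \<in> K" if z: "z \<in> K" and y: "y \<in> Y" for z y
      proof -
        have m: "z \<in> J" "z \<in> R" "y \<in> J" "y \<in> R" using z y Y YR J(3) by (auto simp: K_def)
        have "\<psi> (b * (z * y)) = \<psi> ((b * z) * y)" by (simp add: mult.assoc)
        also have "\<dots> = \<psi> (b * z) * \<psi> y" using y m bR mem by (intro right) auto
        also have "\<dots> = \<psi> b * (\<psi> z * \<psi> y)" using z by (simp add: K_def mult.assoc)
        also have "\<psi> z * \<psi> y = \<psi> (z * y)" using y m by (intro right[symmetric]) auto
        finally show ?thesis using m mem by (simp add: K_def)
      qed
    qed
    with x show ?thesis by (auto simp: K_def)
  qed
  have JJ: "\<psi> (a * x) = \<psi> a * \<psi> x" if a: "a \<in> J" and x: "x \<in> J" for a x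
  proof -
    \<comment> \<open>Here (zy)w = z(yw): the known left multiplication by y is used, and yw lies in
      \<open>J\<close>, where z is already compatible.\<close>
    define K where "K = {a \<in> J. \<forall>x\<in>J. \<psi> (a * x) = \<psi> a * \<psi> x}"
    have "J \<subseteq> K"
    proof (rule nil_generation[OF J(1,2,4) Y _ _ _ gen])
      show "add_subgroup K"
        using J(3) by (auto simp: K_def add_subgroup_def mem \<psi>0 left_diff_distrib \<psi> subset_iff)
      show "B \<subseteq> K" using B BJ by (auto simp: K_def)
      show "z * y \<in> K" if z: "z \<in> K" and y: "y \<in> Y" for z y
      proof -
        have m: "z \<in> J" "z \<in> R" "y \<in> J" "y \<in> R" using z y Y YR J(3) by (auto simp: K_def)
        have "\<psi> (z * y * w) = \<psi> (z * y) * \<psi> w" if w: "w \<in> J" for w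
        proof -
          have wR: "w \<in> R" using w J(3) by auto
          have "\<psi> (z * y * w) = \<psi> (z * (y * w))" by (simp add: mult.assoc)
          also have "\<dots> = \<psi> z * \<psi> (y * w)" using z w m mem by (auto simp: K_def)
          also have "\<psi> (y * w) = \<psi> y * \<psi> w" using y wR by (intro left) auto
          also have "\<psi> z * (\<psi> y * \<psi> w) = \<psi> (z * y) * \<psi> w"
            using right[of y z] y m by (simp add: mult.assoc)
          finally show ?thesis .
        qed
        then show ?thesis using m mem by (simp add: K_def)
      qed
    qed
    with a x show ?thesis by (auto simp: K_def)
  qed
  define HL where "HL = {a \<in> R. \<forall>x\<in>R. \<psi> (a * x) = \<psi> a * \<psi> x}"
  define HR where "HR = {a \<in> R. \<forall>x\<in>R. \<psi> (x * a) = \<psi> x * \<psi> a}"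
  have addL: "add_subgroup HL"
    by (auto simp: HL_def add_subgroup_def mem \<psi>0 left_diff_distrib \<psi>)
  have "a * b \<in> HL" if ab: "a \<in> HL" "b \<in> HL" for a b
  proof -
    have "\<psi> (a * b * z) = \<psi> (a * b) * \<psi> z" if "z \<in> R" for z
    proof -
      have "\<psi> (a * b * z) = \<psi> (a * (b * z))" by (simp add: mult.assoc)
      also have "\<dots> = \<psi> (a * b) * \<psi> z"
        using ab that mem by (simp add: HL_def mult.assoc)
      finally show ?thesis .
    qed
    then show ?thesis using ab mem by (simp add: HL_def)
  qed
  with addL have HL: "subrng HL" by (simp add: subrng_def)
  have addR: "add_subgroup HR"
    by (auto simp: HR_def add_subgroup_def mem \<psi>0 right_diff_distrib \<psi>)
  have "a * b \<in> HR" if ab: "a \<in> HR" "b \<in> HR" for a b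
  proof -
    have "\<psi> (z * (a * b)) = \<psi> z * \<psi> (a * b)" if "z \<in> R" for z
    proof -
      have "\<psi> (z * (a * b)) = \<psi> ((z * a) * b)" by (simp add: mult.assoc)
      also have "\<dots> = \<psi> (z * a) * \<psi> b"
        using ab that mem(1) by (simp add: HR_def)
      also have "\<dots> = \<psi> z * (\<psi> a * \<psi> b)"
        using ab that by (simp add: HR_def mult.assoc)
      also have "\<psi> a * \<psi> b = \<psi> (a * b)" using ab by (simp add: HR_def)
      finally show ?thesis .
    qed
    then show ?thesis using ab mem by (simp add: HR_def)
  qed
  with addR have HR: "subrng HR" by (simp add: subrng_def)
  have GL: "rng_closure G \<subseteq> HL" using HL G left by (intro rng_closure_subset) (auto simp: HL_def)
  have GR: "rng_closure G \<subseteq> HR" using HR G right by (intro rng_closure_subset) (auto simp: HR_def)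
  have "J \<subseteq> HL"
  proof
    fix a assume a: "a \<in> J"
    then have aR: "a \<in> R" using J by auto
    \<comment> \<open>The right factors compatible with a form a subgroup that contains the part
      generated by \<open>G\<close>, through \<open>HR\<close>, and \<open>J\<close>, through
      \<open>JJ\<close>; so it is all of \<open>R\<close>.\<close>
    define K where "K = {x \<in> R. \<psi> (a * x) = \<psi> a * \<psi> x}"
    have "add_subgroup K"
      using aR by (auto simp: K_def add_subgroup_def mem \<psi>0 right_diff_distrib \<psi>)
    moreover have "rng_closure G \<union> J \<subseteq> K"
      using GR JJ[OF a] J(3) aR by (auto simp: K_def HR_def)
    ultimately have "R \<subseteq> K" using G(2) group_closure_subset by blast
    then show "a \<in> HL" using aR by (auto simp: HL_def K_def)
  qed
  with GL have "R \<subseteq> HL"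
    using G(2) group_closure_subset[OF addL, of "rng_closure G \<union> J"] by blast
  with xy show ?thesis by (auto simp: HL_def)
qed

text \<open>A longest list of elements each of which multiplies the size of \<open>W\<close> by at least \<open>p ^ k\<close>.\<close>

lemma ex_greedy_multipliers:
  fixes J :: "'a::ring_1 set"
  assumes p: "p > 1" and J: "subrng J" "finite J" "card J \<le> p ^ n" and l: "n \<le> l * k" "k > 0"
  shows "\<exists>ys. length ys = l \<and> set ys \<subseteq> J \<and>
    (\<forall>v\<in>J. card (group_closure ({x * v |x. x \<in> J} \<union> group_closure {x * y |x y. x \<in> J \<and> y \<in> set ys}))
        \<le> p ^ k * card (group_closure {x * y |x y. x \<in> J \<and> y \<in> set ys}))"
proof -
  define W where "W ys = group_closure {x * y |x y. x \<in> J \<and> y \<in> set ys}" for ys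
  define P where "P ys \<longleftrightarrow> set ys \<subseteq> J \<and> p ^ (k * length ys) \<le> card (W ys)" for ys
  have WJ: "W ys \<subseteq> J" if "set ys \<subseteq> J" for ys
    unfolding W_def using that J(1)
    by (intro group_closure_subset) (auto intro: subrng_add_subgroup subrng_mult)
  have len: "length ys \<le> l" if "P ys" for ys
  proof -
    have "p ^ (k * length ys) \<le> p ^ n"
      using that WJ[of ys] card_mono[OF J(2), of "W ys"] J(3) by (auto simp: P_def)
    then have "k * length ys \<le> n" using p by (metis power_le_imp_le_exp)
    then have "k * length ys \<le> k * l" using l(1) by (metis mult.commute le_trans)
    then show ?thesis using l(2) nat_mult_le_cancel1 by blast
  qed
  have "W [] = {0}" by (simp add: W_def)
  then have "P []" by (simp add: P_def)
  then obtain ys where ys: "P ys" and max: "\<And>zs. P zs \<Longrightarrow> length zs \<le> length ys"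
    using ex_has_greatest_nat[of P "[]" length "Suc l"] len by (metis less_Suc_eq_le)
  have bound: "card (group_closure ({x * v |x. x \<in> J} \<union> W ys)) \<le> p ^ k * card (W ys)" if v: "v \<in> J" for v
  proof -
    have "W (v # ys) = group_closure ({x * v |x. x \<in> J} \<union> W ys)"
      unfolding W_def group_closure_Un_closure by (rule arg_cong[where f = group_closure]) auto
    moreover have "\<not> P (v # ys)" using max[of "v # ys"] by auto
    then have "card (W (v # ys)) \<le> p ^ (k * length (v # ys))"
      using v ys by (auto simp: P_def)
    moreover have "p ^ (k * length (v # ys)) \<le> p ^ k * card (W ys)"
      using ys by (simp add: P_def power_add)
    ultimately show ?thesis by simp
  qed
  \<comment> \<open>Padding by 0 leaves W unchanged and gives the list the prescribed
    length.\<close>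
  define zs where "zs = ys @ replicate (l - length ys) 0"
  have J0: "0 \<in> J" using J(1) by (intro add_subgroup_zero subrng_add_subgroup)
  have "W zs = W ys"
  proof (rule subset_antisym)
    show "W zs \<subseteq> W ys" unfolding W_def
    proof (rule group_closure_subset[OF add_subgroup_group_closure], clarify)
      fix x y assume "x \<in> J" "y \<in> set zs"
      then show "x * y \<in> group_closure {x * y |x y. x \<in> J \<and> y \<in> set ys}"
        by (cases "y = 0") (auto simp: zs_def intro!: subset_group_closure[THEN subsetD])
    qed
    show "W ys \<subseteq> W zs" unfolding W_def by (rule group_closure_mono) (auto simp: zs_def)
  qed
  moreover have "set zs \<subseteq> J" using ys J0 by (auto simp: zs_def P_def)
  moreover have "length zs = l" using len[OF ys] by (simp add: zs_def)
  ultimately show ?thesis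
    using bound unfolding W_def by (intro exI[of _ zs]) simp
qed

section \<open>Base-p coordinates on a finite abelian p-group\<close>

definition digit_val :: "nat \<Rightarrow> (nat \<Rightarrow> 'a::ring_1) \<Rightarrow> (nat \<Rightarrow> nat) \<Rightarrow> 'a" where
  "digit_val n c a = (\<Sum>j<n. of_nat (a j) * c j)"

definition digits :: "nat \<Rightarrow> nat \<Rightarrow> (nat \<Rightarrow> nat) set" where
  "digits p n = {..<n} \<rightarrow>\<^sub>E {..<p}"

lemma card_digits: "card (digits p n) = p ^ n"
  by (simp add: digits_def card_PiE)

lemma finite_digits: "finite (digits p n)"
  by (simp add: digits_def finite_PiE)

text \<open>A subgroup chain with successive quotients of order p. The additive group need not be
  elementary abelian; this gives unique digit expansions for any abelian p-group without decomposing
  it into cyclic factors.\<close>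

definition digit_chain :: "nat \<Rightarrow> nat \<Rightarrow> (nat \<Rightarrow> 'a::ring_1) \<Rightarrow> bool" where
  "digit_chain p n c \<longleftrightarrow>
     (\<forall>i<n. of_nat p * c i \<in> group_closure (c ` {..<i}) \<and> c i \<notin> group_closure (c ` {..<i}))"

text \<open>The top coefficient is reduced modulo p; the carry is a multiple of p
  \<open>c i\<close>, which lies in the subgroup of the lower positions.\<close>

lemma ex_digit_val:
  assumes "p > 0" "digit_chain p n c" "i \<le> n" "x \<in> group_closure (c ` {..<i})"
  shows "\<exists>a\<in>digits p i. x = digit_val i c a"
  using assms(3,4)
proof (induction i arbitrary: x)
  case 0
  then show ?case by (simp add: digits_def digit_val_def)
next
  case (Suc i)
  let ?H = "group_closure (c ` {..<i})"
  have "\<exists>h\<in>?H. \<exists>m. x = h + of_int m * c i"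
    using Suc.prems(2)
  proof induction
    case (base s)
    then consider "s = c i" | "s \<in> ?H"
      using subset_group_closure[of "c ` {..<i}"] by (auto simp: lessThan_Suc)
    then show ?case
    proof cases
      case 1
      then show ?thesis by (intro bexI[of _ 0] exI[of _ 1]) auto
    next
      case 2
      then show ?thesis by (intro bexI[of _ s] exI[of _ 0]) auto
    qed
  next
    case (diff s t)
    then obtain h m h' m' where "h \<in> ?H" "h' \<in> ?H" "s = h + of_int m * c i" "t = h' + of_int m' * c i"
      by blast
    then show ?case
      by (intro bexI[of _ "h - h'"] exI[of _ "m - m'"]) (auto simp: algebra_simps intro: group_closure.diff)
  qed
  then obtain h m where h: "h \<in> ?H" "x = h + of_int m * c i" by blast
  define r where "r = nat (m mod int p)"
  have r: "r < p" "int r = m mod int p" using assms(1) by (auto simp: r_def nat_less_iff)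
  have "of_int m * c i = of_int (m div int p) * (of_nat p * c i) + of_nat r * c i"
  proof -
    have "m = (m div int p) * int p + int r" using r by simp
    then have "of_int m = of_int (m div int p) * of_nat p + (of_nat r :: 'a)"
      by (metis of_int_add of_int_mult of_int_of_nat_eq)
    then show ?thesis by (simp add: algebra_simps)
  qed
  moreover have "of_int (m div int p) * (of_nat p * c i) \<in> ?H"
    using assms(2) Suc.prems(1) by (intro add_subgroup_of_int_mult) (auto simp: digit_chain_def)
  ultimately have "x - of_nat r * c i \<in> ?H"
    using h by (auto intro: group_closure_add)
  then obtain a where a: "a \<in> digits p i" "x - of_nat r * c i = digit_val i c a"
    using Suc.IH Suc.prems(1) by auto
  have "a(i := r) \<in> digits p (Suc i)"
    using a(1) r(1) by (auto simp: digits_def PiE_iff extensional_def)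
  moreover have "x = digit_val (Suc i) c (a(i := r))"
    using a(2) by (simp add: digit_val_def algebra_simps)
  ultimately show ?case by blast
qed

lemma digit_chain_closure_le:
  assumes "p > 0" "digit_chain p n c" "i \<le> n"
  shows "finite (group_closure (c ` {..<i}))" "card (group_closure (c ` {..<i})) \<le> p ^ i"
proof -
  have sub: "group_closure (c ` {..<i}) \<subseteq> digit_val i c ` digits p i"
    using ex_digit_val[OF assms] by blast
  then show "finite (group_closure (c ` {..<i}))"
    using finite_digits finite_surj by blast
  have "card (group_closure (c ` {..<i})) \<le> card (digits p i)"
    using surj_card_le[OF finite_digits sub] .
  then show "card (group_closure (c ` {..<i})) \<le> p ^ i" by (simp add: card_digits)
qed

text \<open>Translation by x permutes \<open>A\<close>; comparing the sums of all elements before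
  and after gives the claim.\<close>

lemma card_mult_eq_0:
  fixes A :: "'a::ring_1 set"
  assumes "add_subgroup A" "finite A" "x \<in> A"
  shows "of_nat (card A) * x = 0"
proof -
  have "bij_betw (\<lambda>a. a + x) A A"
    using assms by (intro bij_betwI[where g = "\<lambda>a. a - x"]) (auto intro: add_subgroup_add add_subgroup_diff)
  then have "(\<Sum>a\<in>A. a) = (\<Sum>a\<in>A. a + x)"
    using sum.reindex_bij_betw[of "\<lambda>a. a + x" A A "\<lambda>a. a"] by simp
  then show ?thesis by (simp add: sum.distrib)
qed

lemma ex_digit_chain:
  fixes A :: "'a::ring_1 set"
  assumes p: "Factorial_Ring.prime (p::nat)" and A: "add_subgroup A" "finite A" "card A = p ^ n"
  obtains c where "digit_chain p n c" "group_closure (c ` {..<n}) = A" "c ` {..<n} \<subseteq> A"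
proof -
  have p1: "p > 1" by (rule prime_gt_1_nat[OF p])
  have "\<exists>c. digit_chain p i c \<and> group_closure (c ` {..<i}) \<subseteq> A \<and> p ^ i \<le> card (group_closure (c ` {..<i}))"
    if "i \<le> n" for i
    using that
  proof (induction i)
    case 0
    show ?case using add_subgroup_zero[OF A(1)] by (intro exI[of _ undefined]) (simp add: digit_chain_def)
  next
    case (Suc i)
    then obtain c where c: "digit_chain p i c" "group_closure (c ` {..<i}) \<subseteq> A"
      "p ^ i \<le> card (group_closure (c ` {..<i}))" by auto
    let ?H = "group_closure (c ` {..<i})"
    have "card ?H \<le> p ^ i" using digit_chain_closure_le[OF _ c(1)] p1 by simp
    moreover have "p ^ i < p ^ n" using p1 Suc.prems by simp
    ultimately have "?H \<noteq> A" using A(3) by auto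
    then obtain x where x: "x \<in> A" "x \<notin> ?H" using c(2) by blast
    have "of_nat (p ^ n) * x \<in> ?H" using card_mult_eq_0[OF A(1,2) x(1)] A(3) by simp
    \<comment> \<open>The last multiple p^(m-1) x still outside the subgroup is the next member of
      the chain.\<close>
    then obtain m where m: "of_nat (p ^ m) * x \<in> ?H" "\<And>k. k < m \<Longrightarrow> of_nat (p ^ k) * x \<notin> ?H"
      using exists_least_iff[of "\<lambda>m. of_nat (p ^ m) * x \<in> ?H"] by blast
    have "m > 0" using m(1) x(2) by (cases m) auto
    define y where "y = of_nat (p ^ (m - 1)) * x"
    have y: "y \<in> A" "y \<notin> ?H" "of_nat p * y \<in> ?H"
    proof -
      show "y \<in> A" using x A by (auto simp: y_def intro: add_subgroup_of_nat_mult simp del: of_nat_power)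
      show "y \<notin> ?H" using m(2)[of "m - 1"] \<open>m > 0\<close> by (simp add: y_def)
      have "of_nat p * y = of_nat (p ^ m) * x"
        using \<open>m > 0\<close> by (simp add: y_def mult.assoc[symmetric] flip: power_Suc)
      then show "of_nat p * y \<in> ?H" using m(1) by simp
    qed
    define c' where "c' = c(i := y)"
    have eq: "c' ` {..<j} = c ` {..<j}" if "j \<le> i" for j using that by (auto simp: c'_def)
    have "digit_chain p (Suc i) c'"
      unfolding digit_chain_def
    proof (intro allI impI)
      fix j assume "j < Suc i"
      then consider "j < i" | "j = i" by linarith
      then show "of_nat p * c' j \<in> group_closure (c' ` {..<j}) \<and> c' j \<notin> group_closure (c' ` {..<j})"
      proof cases
        case 1
        then have "c' j = c j" by (simp add: c'_def)
        with 1 show ?thesis using c(1) eq[of j] by (simp add: digit_chain_def)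
      next
        case 2
        then have "c' j = y" by (simp add: c'_def)
        with 2 show ?thesis using y eq[of i] by simp
      qed
    qed
    moreover have H': "c' ` {..<Suc i} = insert y (c ` {..<i})"
      unfolding lessThan_Suc image_insert eq[OF order_refl] by (simp add: c'_def)
    moreover have H'A: "group_closure (c' ` {..<Suc i}) \<subseteq> A"
      unfolding H' using y c(2) subset_group_closure[of "c ` {..<i}"] by (intro group_closure_subset A) auto
    moreover have "p ^ Suc i \<le> card (group_closure (c' ` {..<Suc i}))"
    proof -
      have "?H \<subset> group_closure (c' ` {..<Suc i})"
        unfolding H' using group_closure_mono[of "c ` {..<i}" "insert y (c ` {..<i})"] y(2)
          subset_group_closure[of "insert y (c ` {..<i})"] by auto
      then have "card ?H < card (group_closure (c' ` {..<Suc i}))"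
        using finite_subset[OF H'A A(2)] by (intro psubset_card_mono)
      moreover obtain h where h: "card (group_closure (c' ` {..<Suc i})) = p ^ h"
        using prime_power_card_add_subgroup[OF p A(1) _ H'A A(2,3)] by auto
      ultimately have "p ^ i < p ^ h" using c(3) by simp
      then have "Suc i \<le> h" using p1 by (simp add: Suc_leI)
      then show ?thesis using p1 h by (metis power_increasing less_imp_le)
    qed
    ultimately show ?case by metis
  qed
  then obtain c where c: "digit_chain p n c" "group_closure (c ` {..<n}) \<subseteq> A" "p ^ n \<le> card (group_closure (c ` {..<n}))"
    by blast
  have "group_closure (c ` {..<n}) = A"
    using card_seteq[OF A(2) c(2)] c(3) A(3) by simp
  then show ?thesis using that c subset_group_closure by metis
qed

lemma bij_betw_digit_val:
  assumes "p > 0" "digit_chain p n c" "group_closure (c ` {..<n}) = A" "card A = p ^ n"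
  shows "bij_betw (digit_val n c) (digits p n) A"
proof -
  have img: "digit_val n c ` digits p n = A"
  proof (rule subset_antisym)
    have "digit_val n c a \<in> group_closure (c ` {..<n})" for a
      unfolding digit_val_def
      by (intro add_subgroup_sum add_subgroup_of_nat_mult subset_group_closure[THEN subsetD]) auto
    then show "digit_val n c ` digits p n \<subseteq> A" using assms(3) by blast
    show "A \<subseteq> digit_val n c ` digits p n"
      using ex_digit_val[OF assms(1,2), of n] assms(3) by blast
  qed
  then have "inj_on (digit_val n c) (digits p n)"
    using assms(4) by (intro eq_card_imp_inj_on finite_digits) (simp add: card_digits)
  with img show ?thesis by (simp add: bij_betw_def)
qed

lemma digit_chain_dvd:
  assumes p: "Factorial_Ring.prime (p::nat)" and c: "digit_chain p n c" "i < n"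
    and m: "of_int m * c i \<in> group_closure (c ` {..<i})"
  shows "int p dvd m"
proof (rule ccontr)
  assume "\<not> int p dvd m"
  then have "coprime (int p) m" using p by (simp add: prime_imp_coprime)
  then obtain u v where uv: "u * int p + v * m = 1"
    by (metis coprime_iff_gcd_eq_1 bezout_int)
  have "c i = of_int (u * int p + v * m) * c i" by (simp add: uv)
  also have "\<dots> = of_int u * (of_nat p * c i) + of_int v * (of_int m * c i)"
    by (simp only: of_int_add of_int_mult of_int_of_nat_eq distrib_right mult.assoc)
  also have "\<dots> \<in> group_closure (c ` {..<i})"
    using c m by (intro group_closure_add add_subgroup_of_int_mult[of _ "of_int m * c i"]
        add_subgroup_of_int_mult[of _ "of_nat p * c i"]) (auto simp: digit_chain_def)
  finally show False using c by (simp add: digit_chain_def)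
qed

text \<open>In a relation the top coefficient is divisible by p, so the expansion of p
  \<open>c i\<close> rewrites it as a relation among lower positions. Hence these expansions
  determine all additive relations.\<close>

lemma digit_chain_relation_transfer:
  fixes c :: "nat \<Rightarrow> 'a::ring_1" and c' :: "nat \<Rightarrow> 'b::ring_1"
  assumes p: "Factorial_Ring.prime (p::nat)" and c: "digit_chain p n c"
    and rel: "\<And>i. i < n \<Longrightarrow> \<exists>\<epsilon>. of_nat p * c i = digit_val i c \<epsilon> \<and> of_nat p * c' i = digit_val i c' \<epsilon>"
    and "i \<le> n" "(\<Sum>j<i. of_int (a j) * c j) = 0"
  shows "(\<Sum>j<i. of_int (a j) * c' j) = 0"
  using assms(4,5)
proof (induction i arbitrary: a)
  case (Suc i)
  have "of_int (a i) * c i = - (\<Sum>j<i. of_int (a j) * c j)"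
    using Suc.prems(2) by (simp add: eq_neg_iff_add_eq_0 add.commute)
  moreover have "(\<Sum>j<i. of_int (a j) * c j) \<in> group_closure (c ` {..<i})"
    by (intro add_subgroup_sum add_subgroup_of_int_mult subset_group_closure[THEN subsetD]) auto
  ultimately have "of_int (a i) * c i \<in> group_closure (c ` {..<i})" by simp
  then have "int p dvd a i" using digit_chain_dvd[OF p c, of i "a i"] Suc.prems(1) by simp
  then obtain q where q: "a i = q * int p" by (metis dvdE mult.commute)
  obtain \<epsilon> where \<epsilon>: "of_nat p * c i = digit_val i c \<epsilon>" "of_nat p * c' i = digit_val i c' \<epsilon>"
    using rel Suc.prems(1) by (meson Suc_le_lessD)
  define b where "b j = a j + q * int (\<epsilon> j)" for j
  have 1: "(\<Sum>j<Suc i. of_int (a j) * c j) = (\<Sum>j<i. of_int (b j) * c j)"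
    using \<epsilon>(1) by (simp add: q b_def mult.assoc digit_val_def sum.distrib sum_distrib_left distrib_right)
  have 2: "(\<Sum>j<Suc i. of_int (a j) * c' j) = (\<Sum>j<i. of_int (b j) * c' j)"
    using \<epsilon>(2) by (simp add: q b_def mult.assoc digit_val_def sum.distrib sum_distrib_left distrib_right)
  show ?case using Suc.IH[of b] Suc.prems 1 2 by simp
qed simp

text \<open>A presentation of a ring \<open>R\<close> of order \<open>p ^ n\<close>: \<open>c\<close> fixes coordinates on the additive group,
  \<open>h\<close> lists the elements whose left and right multiplications are recorded, \<open>b\<close> generates the
  nilpotent part modulo a subgroup \<open>W\<close> of order \<open>p ^ v\<close> generated by \<open>w\<close>, and the products
  \<open>b i * b j\<close> lie in a group generated by \<open>W\<close> and the \<open>d _ j\<close>.\<close>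

definition nil_generators where
  "nil_generators R m h u b J Y \<longleftrightarrow> subrng J \<and> J \<subseteq> R \<and> (\<forall>x\<in>J. \<exists>q. x ^ q = 0) \<and> Y \<subseteq> J \<and> Y \<subseteq> h ` {..<m} \<and>
     R \<subseteq> group_closure (rng_closure (h ` {..<m}) \<union> J) \<and> b ` {..<u} \<subseteq> J \<and>
     J \<subseteq> group_closure (b ` {..<u} \<union> {x * y |x y. x \<in> J \<and> y \<in> Y})"

definition presents where
  "presents p n m k R u v c h w b d \<longleftrightarrow>
     digit_chain p n c \<and> group_closure (c ` {..<n}) = R \<and> h ` {..<m} \<subseteq> R \<and> w ` {..<n} \<subseteq> R \<and>
     b ` {..<n} \<subseteq> R \<and> (\<forall>i j. d i j \<in> R) \<and> u + v \<le> n \<and>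
     (\<exists>J Y. nil_generators R m h u b J Y) \<and>
     (\<forall>i<u. \<forall>j<u. b i * b j \<in> group_closure ((\<lambda>i. d i j) ` {..<k} \<union> w ` {..<n}) \<and>
        card (group_closure ((\<lambda>i. d i j) ` {..<k} \<union> w ` {..<n})) \<le> p ^ (k + v))"

lemma nth_image_lessThan: "(!) xs ` {..<length xs} = set xs"
  by (auto simp: set_conv_nth)

lemma (in finite_rng) ex_presents:
  assumes p: "Factorial_Ring.prime (p::nat)" and card: "card R = p ^ n" "n > 0"
    and s: "card R < 2 ^ Suc (s * s)" and L: "card R < 2 ^ 2 ^ L" and k: "n \<le> k * k" "k > 0"
  shows "\<exists>u v c h w b d. presents p n (2 * s + 2 + L + k) k R u v c h w b d"
proof -
  have p1: "p > 1" by (rule prime_gt_1_nat[OF p])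
  have "e \<noteq> 0"
  proof
    assume "e = 0"
    then have "R \<subseteq> {0}" using e_left by fastforce
    then have "card R \<le> 1" by (metis card_mono finite.emptyI finite_insert is_singletonI is_singleton_altdef)
    moreover have "card R > 1" using one_less_power[OF p1 card(2)] card(1) by simp
    ultimately show False by simp
  qed
  from ex_generators_mod_rad[OF this s L] obtain gs where gs: "length gs = 2 * s + 2 + L" "set gs \<subseteq> R"
    "R = group_closure (rng_closure (set gs) \<union> rad)" .
  obtain c where c: "digit_chain p n c" "group_closure (c ` {..<n}) = R" "c ` {..<n} \<subseteq> R"
    using ex_digit_chain[OF p R_add finite_R card(1)] .
  note Ja = subrng_add_subgroup[OF subrng_rad]
  have finJ: "finite rad" using rad_subset finite_R finite_subset by blast
  have Jn: "card rad \<le> p ^ n" using card_mono[OF finite_R rad_subset] card by simp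
  obtain ys where ys: "length ys = k" "set ys \<subseteq> rad" and
    ys_bound: "\<forall>x\<in>rad. card (group_closure ({z * x |z. z \<in> rad} \<union> group_closure {x * y |x y. x \<in> rad \<and> y \<in> set ys}))
        \<le> p ^ k * card (group_closure {x * y |x y. x \<in> rad \<and> y \<in> set ys})"
    using ex_greedy_multipliers[OF p1 subrng_rad finJ Jn k] by blast
  define W where "W = group_closure {x * y |x y. x \<in> rad \<and> y \<in> set ys}"
  have W: "add_subgroup W" "W \<subseteq> rad"
    unfolding W_def using ys(2) subrng_mult[OF subrng_rad] by (auto intro!: group_closure_subset[OF Ja])
  have WR: "W \<subseteq> R" using W rad_subset by blast
  have finW: "finite W" using WR finite_R finite_subset by blast
  obtain q where q: "q \<le> n" "card rad = p ^ q"
    using prime_power_card_add_subgroup[OF p R_add Ja rad_subset finite_R card(1)] .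
  obtain v where v: "v \<le> q" "card W = p ^ v"
    using prime_power_card_add_subgroup[OF p Ja W finJ q(2)] .
  \<comment> \<open>J/W has order p^(q-v), so u = q - v generators are enough, and u + v = q <= n is
    the constraint under which u^2 v is maximised.\<close>
  define u where "u = q - v"
  have "card rad \<le> p ^ u * card W" using q v by (simp add: u_def power_add[symmetric])
  from ex_generators_mod[OF p Ja finJ q(2) W this] obtain bs where bs: "length bs = u" "set bs \<subseteq> rad"
    "group_closure (set bs \<union> W) = rad" by blast
  \<comment> \<open>Since |W| = p^v with v <= n, a generating list of the fixed length n
    exists.\<close>
  have "card W \<le> p ^ n * card {0::'a}" using v q p1 by (simp add: power_increasing)
  from ex_generators_mod[OF p W(1) finW v(2) _ _ this] obtain ws where ws: "length ws = n" "set ws \<subseteq> W"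
    "group_closure (set ws \<union> {0}) = W" using add_subgroup_zero[OF W(1)] by (auto simp: add_subgroup_def)
  then have ws': "group_closure (set ws) = W" by simp
  define I where "I x = group_closure ({z * x |z. z \<in> rad} \<union> W)" for x
  have "\<exists>ds. length ds = k \<and> set ds \<subseteq> I x \<and> group_closure (set ds \<union> W) = I x \<and> card (I x) \<le> p ^ (k + v) \<and> I x \<subseteq> R"
    if x: "x \<in> rad" for x
  proof -
    have IR: "I x \<subseteq> R" unfolding I_def using x rad_subset WR R_mult
      by (intro group_closure_subset R_add) (auto simp: subset_iff)
    have le: "card (I x) \<le> p ^ k * card W" using bspec[OF ys_bound x] by (simp add: I_def W_def)
    have WI: "W \<subseteq> I x" using subset_group_closure[of "_ \<union> W"] by (auto simp: I_def)
    have Ia: "add_subgroup (I x)" by (simp add: I_def)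
    have finI: "finite (I x)" using IR finite_R finite_subset by blast
    obtain r where r: "card (I x) = p ^ r"
      using prime_power_card_add_subgroup[OF p R_add Ia IR finite_R card(1)] .
    from ex_generators_mod[OF p Ia finI r W(1) WI le] show ?thesis
      using IR le v by (auto simp: power_add)
  qed
  then obtain ds where ds: "\<And>x. x \<in> rad \<Longrightarrow> length (ds x) = k \<and> set (ds x) \<subseteq> I x \<and>
      group_closure (set (ds x) \<union> W) = I x \<and> card (I x) \<le> p ^ (k + v) \<and> I x \<subseteq> R"
    by metis
  define m where "m = 2 * s + 2 + L + k"
  define h where "h = (!) (gs @ ys)"
  define w where "w = (!) ws"
  \<comment> \<open>Outside the meaningful index ranges \<open>b\<close> and \<open>d\<close> are 0,
    because the table records them for index ranges that do not depend on \<open>u\<close>.\<close>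
  define b where "b j = (if j < u then bs ! j else 0)" for j
  define d where "d i j = (if i < k \<and> j < u then ds (bs ! j) ! i else 0)" for i j
  have hm: "h ` {..<m} = set gs \<union> set ys"
    using nth_image_lessThan[of "gs @ ys"] gs(1) ys(1) by (simp add: h_def m_def)
  have wn: "w ` {..<n} = set ws" using nth_image_lessThan[of ws] ws by (simp add: w_def)
  have bu: "b ` {..<u} = set bs"
    using nth_image_lessThan[of bs] bs by (auto simp: b_def image_def)
  have bj: "b j \<in> rad" "b j = bs ! j" if "j < u" for j
    using that bs by (auto simp: b_def dest: subsetD[OF _ nth_mem])
  have dk: "(\<lambda>i. d i j) ` {..<k} = set (ds (b j))" if "j < u" for j
    using nth_image_lessThan[of "ds (b j)"] ds[OF bj(1)[OF that]] that bj(2)[OF that] by (simp add: d_def)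
  have Ij: "group_closure ((\<lambda>i. d i j) ` {..<k} \<union> w ` {..<n}) = I (b j)" if "j < u" for j
    using ds[OF bj(1)[OF that]] ws' by (simp add: dk[OF that] wn flip: group_closure_Un_closure[of _ "set ws"])
  have "presents p n m k R u v c h w b d"
    unfolding presents_def
  proof (intro conjI allI impI)
    show "digit_chain p n c" "group_closure (c ` {..<n}) = R" by fact+
    show "h ` {..<m} \<subseteq> R" using gs(2) ys(2) rad_subset by (simp add: hm)
    show "w ` {..<n} \<subseteq> R" using ws(2) WR by (simp add: wn)
    show "b ` {..<n} \<subseteq> R"
      using bj(1) rad_subset add_subgroup_zero[OF R_add] by (auto simp: b_def)
    show "d i j \<in> R" for i j
    proof (cases "i < k \<and> j < u")
      case True
      then have "j < u" by simp
      then have "d i j \<in> I (b j)" using ds[OF bj(1)] dk True by blast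
      then show ?thesis using ds[OF bj(1)[OF \<open>j < u\<close>]] by blast
    qed (use add_subgroup_zero[OF R_add] in \<open>auto simp: d_def\<close>)
    show "u + v \<le> n" using q v by (simp add: u_def)
    have "rad \<subseteq> group_closure (b ` {..<u} \<union> {x * y |x y. x \<in> rad \<and> y \<in> set ys})"
      using bs(3) by (simp add: bu W_def group_closure_Un_closure)
    moreover have "R \<subseteq> group_closure (rng_closure (h ` {..<m}) \<union> rad)"
    proof -
      have "rng_closure (set gs) \<subseteq> rng_closure (h ` {..<m})"
        using subset_rng_closure[of "h ` {..<m}"] by (intro rng_closure_subset) (auto simp: hm)
      then have "group_closure (rng_closure (set gs) \<union> rad) \<subseteq> group_closure (rng_closure (h ` {..<m}) \<union> rad)"
        by (intro group_closure_mono) auto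
      with gs(3) show ?thesis by simp
    qed
    ultimately show "\<exists>J Y. nil_generators R m h u b J Y"
      using subrng_rad rad_subset rad_nil ys(2) bs(2)
      by (intro exI[of _ rad] exI[of _ "set ys"]) (auto simp: nil_generators_def hm bu)
    fix i j assume ij: "i < u" "j < u"
    show "b i * b j \<in> group_closure ((\<lambda>i. d i j) ` {..<k} \<union> w ` {..<n})"
      unfolding Ij[OF ij(2)] I_def using bj(1)[OF ij(1)] by (intro subset_group_closure[THEN subsetD]) auto
    show "card (group_closure ((\<lambda>i. d i j) ` {..<k} \<union> w ` {..<n})) \<le> p ^ (k + v)"
      unfolding Ij[OF ij(2)] using ds[OF bj(1)[OF ij(2)]] by simp
  qed
  then show ?thesis unfolding m_def by blast
qed

section \<open>Coding a presented ring by digits\<close>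

definition coords :: "nat \<Rightarrow> nat \<Rightarrow> (nat \<Rightarrow> 'a::ring_1) \<Rightarrow> 'a \<Rightarrow> nat \<Rightarrow> nat" where
  "coords p n c = inv_into (digits p n) (digit_val n c)"

text \<open>The tag t distinguishes seven kinds of entries, p \<open>c j\<close> fixing the addition
  and the others the partial products and generators. A common index set for all kinds repeats
  entries, which costs only a constant factor, but makes the record a single function.\<close>

definition base_table where
  "base_table p c h w b d = (\<lambda>(t::nat, i::nat, j::nat).
     if t = 0 then of_nat p * c j else if t = 1 then h i else if t = 2 then h i * c j
     else if t = 3 then c j * h i else if t = 4 then w j else if t = 5 then b j else d i j)"

locale presented_rng =
  fixes p n m k :: nat and R :: "'a::ring_1 set" and u v :: nat
    and c h w b :: "nat \<Rightarrow> 'a" and d :: "nat \<Rightarrow> nat \<Rightarrow> 'a"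
  assumes p: "Factorial_Ring.prime p" and R: "subrng R" and finR: "finite R" and cardR: "card R = p ^ n"
    and km: "k \<le> m"
    and pres: "presents p n m k R u v c h w b d"
begin

lemma p_pos: "p > 0"
  using p by (rule prime_gt_0_nat)

lemma chain: "digit_chain p n c" and closure_c: "group_closure (c ` {..<n}) = R"
  using pres by (auto simp: presents_def)

lemma uv_le: "u + v \<le> n"
  using pres by (simp add: presents_def)

lemma bij_val: "bij_betw (digit_val n c) (digits p n) R"
  by (rule bij_betw_digit_val[OF p_pos chain closure_c cardR])

lemma val_coords: "x \<in> R \<Longrightarrow> digit_val n c (coords p n c x) = x"
  unfolding coords_def using bij_val by (metis bij_betw_imp_surj_on f_inv_into_f)

lemma coords_digits: "x \<in> R \<Longrightarrow> coords p n c x \<in> digits p n"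
  unfolding coords_def using bij_val by (metis bij_betw_imp_surj_on inv_into_into)

lemma coords_val: "a \<in> digits p n \<Longrightarrow> coords p n c (digit_val n c a) = a"
  unfolding coords_def using bij_val by (metis bij_betw_imp_inj_on inv_into_f_f)

lemma c_mem: "i < n \<Longrightarrow> c i \<in> R"
  using closure_c subset_group_closure[of "c ` {..<n}"] by auto

lemma int_comb_mem: "(\<Sum>j<n. of_int (a j) * c j) \<in> R"
  by (intro add_subgroup_sum add_subgroup_of_int_mult subrng_add_subgroup R c_mem) auto

definition table_indices :: "(nat \<times> nat \<times> nat) set" where
  "table_indices = {..<7} \<times> {..<m} \<times> {..<n}"

definition table where "table = base_table p c h w b d"

text \<open>Kept apart from \<open>final_code\<close>: this first part already determines the set in
  which the second part can vary.\<close>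

definition code where
  "code = (u, v, restrict (\<lambda>t. coords p n c (table t)) table_indices)"

definition final_code where
  "final_code = (\<lambda>(i, j)\<in>{..<u} \<times> {..<u}. coords p n c (b i * b j))"

definition block :: "nat \<Rightarrow> 'a set" where
  "block j = group_closure ((\<lambda>i. d i j) ` {..<k} \<union> w ` {..<n})"

lemma table_mem:
  assumes "t \<in> table_indices"
  shows "table t \<in> R"
proof -
  obtain q i j where t: "t = (q, i, j)" "i < m" "j < n"
    using assms by (auto simp: table_indices_def)
  have "h i \<in> R" "w j \<in> R" "b j \<in> R" "c j \<in> R" "d i j \<in> R"
    using pres t c_mem by (auto simp: presents_def)
  then show ?thesis
    using t subrng_mult[OF R] add_subgroup_of_nat_mult[OF subrng_add_subgroup[OF R]]
    by (auto simp: table_def base_table_def)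
qed

lemma b_mem: "i < n \<Longrightarrow> b i \<in> R"
  using pres by (auto simp: presents_def)

lemma prod_mem_block: "i < u \<Longrightarrow> j < u \<Longrightarrow> b i * b j \<in> block j"
  and card_block: "j < u \<Longrightarrow> card (block j) \<le> p ^ (k + v)"
  using pres unfolding block_def presents_def by blast+

lemma block_subset: "block j \<subseteq> R"
  using pres unfolding block_def by (intro group_closure_subset subrng_add_subgroup R) (auto simp: presents_def)

lemma final_code_mem: "final_code \<in> (\<Pi>\<^sub>E (i, j)\<in>{..<u} \<times> {..<u}. coords p n c ` block j)"
  using prod_mem_block by (auto simp: final_code_def)

end

section \<open>Two presented rings with the same code\<close>

locale presented_pair =
  A: presented_rng p n m k R u v c h w b d + B: presented_rng p n m k R' u' v' c' h' w' b' d'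
  for p n m k and R :: "'a::ring_1 set" and u v c h w b d
    and R' :: "'b::ring_1 set" and u' v' c' h' w' b' d' +
  assumes codes: "A.code = B.code" and mn: "m > 0"
begin

lemma u_eq: "u' = u" and v_eq: "v' = v"
  using codes by (auto simp: A.code_def B.code_def)

lemma table_coords: "t \<in> A.table_indices \<Longrightarrow> coords p n c (A.table t) = coords p n c' (B.table t)"
proof -
  assume t: "t \<in> A.table_indices"
  have "restrict (\<lambda>t. coords p n c (A.table t)) A.table_indices =
      restrict (\<lambda>t. coords p n c' (B.table t)) A.table_indices"
    using codes by (simp add: A.code_def B.code_def)
  from fun_cong[OF this, of t] t show ?thesis by simp
qed

definition transport where "transport x = digit_val n c' (coords p n c x)"

lemma transport_table: "t \<in> A.table_indices \<Longrightarrow> transport (A.table t) = B.table t"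
  using table_coords[of t] B.val_coords[OF B.table_mem[of t]] by (simp add: transport_def)

lemma chain_relation:
  assumes "i < n"
  shows "\<exists>\<epsilon>. of_nat p * c i = digit_val i c \<epsilon> \<and> of_nat p * c' i = digit_val i c' \<epsilon>"
proof -
  have "of_nat p * c i \<in> group_closure (c ` {..<i})" using A.chain assms by (simp add: digit_chain_def)
  then obtain \<epsilon> where \<epsilon>: "\<epsilon> \<in> digits p i" "of_nat p * c i = digit_val i c \<epsilon>"
    using ex_digit_val[OF A.p_pos A.chain less_imp_le[OF assms]] by blast
  \<comment> \<open>The expansion of length i is continued by zeros up to n and by
    \<open>undefined\<close> beyond, so that it is the member of \<open>digits p n\<close> that
    \<open>coords\<close> returns.\<close>
  define \<epsilon>' where "\<epsilon>' j = (if j < i then \<epsilon> j else if j < n then 0 else undefined)" for j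
  have \<epsilon>': "\<epsilon>' \<in> digits p n"
    using \<epsilon>(1) assms A.p_pos by (auto simp: digits_def \<epsilon>'_def PiE_iff extensional_def)
  have ext: "digit_val n x \<epsilon>' = digit_val i x \<epsilon>" for x :: "nat \<Rightarrow> 'c::ring_1"
  proof -
    have "digit_val n x \<epsilon>' = (\<Sum>j<n. if j < i then of_nat (\<epsilon> j) * x j else 0)"
      unfolding digit_val_def by (intro sum.cong) (auto simp: \<epsilon>'_def)
    also have "\<dots> = (\<Sum>j\<in>{..<n} \<inter> {j. j < i}. of_nat (\<epsilon> j) * x j)"
      by (simp add: sum.inter_restrict)
    also have "{..<n} \<inter> {j. j < i} = {..<i}" using assms by auto
    finally show ?thesis by (simp add: digit_val_def)
  qed
  have t: "(0, 0, i) \<in> A.table_indices" using mn assms by (simp add: A.table_indices_def)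
  have "coords p n c (of_nat p * c i) = \<epsilon>'"
    using A.coords_val[OF \<epsilon>'] ext[of c] \<epsilon>(2) by simp
  then have "of_nat p * c' i = digit_val n c' \<epsilon>'"
    using transport_table[OF t] by (simp add: transport_def A.table_def B.table_def base_table_def)
  with ext[of c'] \<epsilon>(2) show ?thesis by auto
qed

text \<open>Addition carries between digits, so additivity is not immediate. A combination and its
  digit expansion differ by an integer relation among the \<open>c j\<close>, and such relations
  transfer to the \<open>c' j\<close>.\<close>

lemma transport_int_comb: "transport (\<Sum>j<n. of_int (a j) * c j) = (\<Sum>j<n. of_int (a j) * c' j)"
proof -
  define \<alpha> where "\<alpha> = coords p n c (\<Sum>j<n. of_int (a j) * c j)"
  have "(\<Sum>j<n. of_int (a j) * c j) = (\<Sum>j<n. of_nat (\<alpha> j) * c j)"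
    using A.val_coords[OF A.int_comb_mem[of a]] by (simp add: \<alpha>_def digit_val_def)
  then have "(\<Sum>j<n. of_int (a j - int (\<alpha> j)) * c j) = 0"
    by (simp add: left_diff_distrib sum_subtractf)
  from digit_chain_relation_transfer[OF A.p A.chain chain_relation order_refl this]
  have "(\<Sum>j<n. of_int (a j - int (\<alpha> j)) * c' j) = 0" .
  then have "(\<Sum>j<n. of_int (a j) * c' j) = (\<Sum>j<n. of_nat (\<alpha> j) * c' j)"
    by (simp add: left_diff_distrib sum_subtractf)
  then show ?thesis by (simp add: transport_def \<alpha>_def digit_val_def)
qed

lemma ex_int_comb:
  assumes "x \<in> R"
  obtains a where "x = (\<Sum>j<n. of_int (a j) * c j)"
  using A.val_coords[OF assms] that[of "\<lambda>j. int (coords p n c x j)"] by (simp add: digit_val_def)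

lemma transport_diff:
  assumes "x \<in> R" "y \<in> R"
  shows "transport (x - y) = transport x - transport y"
proof -
  obtain a where a: "x = (\<Sum>j<n. of_int (a j) * c j)" using ex_int_comb[OF assms(1)] .
  obtain a' where a': "y = (\<Sum>j<n. of_int (a' j) * c j)" using ex_int_comb[OF assms(2)] .
  have "x - y = (\<Sum>j<n. of_int (a j - a' j) * c j)"
    by (simp add: a a' left_diff_distrib sum_subtractf)
  then have "transport (x - y) = (\<Sum>j<n. of_int (a j - a' j) * c' j)"
    by (simp only: transport_int_comb)
  also have "\<dots> = transport x - transport y"
    unfolding a a' transport_int_comb by (simp add: left_diff_distrib sum_subtractf)
  finally show ?thesis .
qed

lemma transport_zero: "transport 0 = 0"
  using transport_int_comb[of "\<lambda>_. 0"] by simp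

lemma transport_c: "i < n \<Longrightarrow> transport (c i) = c' i"
proof -
  assume i: "i < n"
  have sel: "(\<Sum>j<n. of_int (if j = i then 1 else 0) * x j) = x i" for x :: "nat \<Rightarrow> 'c::ring_1"
  proof -
    have "(\<Sum>j<n. of_int (if j = i then 1 else 0) * x j) = (\<Sum>j<n. if j = i then x j else 0)"
      by (intro sum.cong) auto
    then show ?thesis using i by simp
  qed
  show ?thesis using transport_int_comb[of "\<lambda>j. if j = i then 1 else 0"] unfolding sel .
qed

lemma bij_transport: "bij_betw transport R R'"
proof -
  have "bij_betw (coords p n c) R (digits p n)"
    unfolding coords_def by (rule bij_betw_inv_into[OF A.bij_val])
  from bij_betw_trans[OF this B.bij_val] show ?thesis
    by (simp add: transport_def[abs_def] comp_def)
qed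

lemma coords_transport: "x \<in> R \<Longrightarrow> coords p n c' (transport x) = coords p n c x"
  unfolding transport_def by (intro B.coords_val A.coords_digits)

lemma transport_entries:
  "i < m \<Longrightarrow> n > 0 \<Longrightarrow> transport (h i) = h' i"
  "i < m \<Longrightarrow> j < n \<Longrightarrow> transport (h i * c j) = h' i * c' j"
  "i < m \<Longrightarrow> j < n \<Longrightarrow> transport (c j * h i) = c' j * h' i"
  "j < n \<Longrightarrow> transport (w j) = w' j"
  "j < n \<Longrightarrow> transport (b j) = b' j"
  "i < k \<Longrightarrow> j < n \<Longrightarrow> transport (d i j) = d' i j"
proof -
  note defs = A.table_indices_def A.table_def B.table_def base_table_def
  show "i < m \<Longrightarrow> n > 0 \<Longrightarrow> transport (h i) = h' i"
    using transport_table[of "(1, i, 0)"] by (simp add: defs)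
  show "i < m \<Longrightarrow> j < n \<Longrightarrow> transport (h i * c j) = h' i * c' j"
    using transport_table[of "(2, i, j)"] by (simp add: defs)
  show "i < m \<Longrightarrow> j < n \<Longrightarrow> transport (c j * h i) = c' j * h' i"
    using transport_table[of "(3, i, j)"] by (simp add: defs)
  show "j < n \<Longrightarrow> transport (w j) = w' j"
    using transport_table[of "(4, 0, j)"] mn by (simp add: defs)
  show "j < n \<Longrightarrow> transport (b j) = b' j"
    using transport_table[of "(5, 0, j)"] mn by (simp add: defs)
  show "i < k \<Longrightarrow> j < n \<Longrightarrow> transport (d i j) = d' i j"
    using transport_table[of "(6, i, j)"] A.km by (simp add: defs)
qed

lemma transport_block:
  assumes "j < u"
  shows "transport ` A.block j \<subseteq> B.block j"
proof (rule image_subsetI)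
  fix x assume x: "x \<in> A.block j"
  have jn: "j < n" using assms A.uv_le by simp
  show "transport x \<in> B.block j"
  proof (rule group_closure_map[where f = transport])
    show "x \<in> group_closure ((\<lambda>i. d i j) ` {..<k} \<union> w ` {..<n})" using x by (simp add: A.block_def)
    show "transport s \<in> B.block j" if "s \<in> (\<lambda>i. d i j) ` {..<k} \<union> w ` {..<n}" for s
      using that jn transport_entries(4,6) unfolding B.block_def
      by (intro subset_group_closure[THEN subsetD]) auto
    show "transport (y - z) = transport y - transport z"
      if "y \<in> group_closure ((\<lambda>i. d i j) ` {..<k} \<union> w ` {..<n})"
        "z \<in> group_closure ((\<lambda>i. d i j) ` {..<k} \<union> w ` {..<n})" for y z
      using that A.block_subset[of j] by (intro transport_diff) (auto simp: A.block_def)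
  qed (simp_all add: transport_zero B.block_def)
qed

text \<open>In coordinates, the groups containing the products depend only on the code, so all rings
  with one code have their final codes in a common box.\<close>

lemma coords_block: "j < u \<Longrightarrow> coords p n c ` A.block j \<subseteq> coords p n c' ` B.block j"
proof (rule image_subsetI)
  fix x assume j: "j < u" and x: "x \<in> A.block j"
  then have "transport x \<in> B.block j" using transport_block by blast
  moreover have "coords p n c x = coords p n c' (transport x)"
    using x A.block_subset[of j] by (intro coords_transport[symmetric]) auto
  ultimately show "coords p n c x \<in> coords p n c' ` B.block j" by blast
qed

lemma transport_mult:
  assumes fin: "A.final_code = B.final_code" and xy: "x \<in> R" "y \<in> R"
  shows "transport (x * y) = transport x * transport y"
proof -
  obtain J Y where "nil_generators R m h u b J Y"
    using A.pres by (auto simp: presents_def)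
  note gens = this[unfolded nil_generators_def]
  have J: "subrng J" "J \<subseteq> R" "\<And>x. x \<in> J \<Longrightarrow> \<exists>q. x ^ q = 0"
    and J': "Y \<subseteq> J" "Y \<subseteq> h ` {..<m}"
      "R \<subseteq> group_closure (rng_closure (h ` {..<m}) \<union> J)" "b ` {..<u} \<subseteq> J"
      "J \<subseteq> group_closure (b ` {..<u} \<union> {x * y |x y. x \<in> J \<and> y \<in> Y})"
    using gens by auto
  have hR: "h ` {..<m} \<subseteq> R" using A.pres by (auto simp: presents_def)
  have left: "transport (g * z) = transport g * transport z" and right: "transport (z * g) = transport z * transport g"
    if g: "g \<in> h ` {..<m} \<union> Y" and z: "z \<in> R" for g z
  proof -
    obtain i where i: "i < m" "g = h i" using g J'(2) by auto
    have gR: "g \<in> R" using i hR by auto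
    have "transport (g * z) = transport g * transport z \<and> transport (z * g) = transport z * transport g"
    \<comment> \<open>For n = 0 the index set of the table is empty and gives nothing about
      \<open>h i\<close>, but then the ring is {0}.\<close>
    proof (cases "n = 0")
      case True
      then have "R = {0}" using A.closure_c by simp
      then show ?thesis using gR z by (simp add: transport_zero)
    next
      case False
      define K where "K = {z \<in> R. transport (g * z) = transport g * transport z \<and> transport (z * g) = transport z * transport g}"
      have "add_subgroup K"
        using gR add_subgroup_diff[OF subrng_add_subgroup[OF A.R]] add_subgroup_zero[OF subrng_add_subgroup[OF A.R]]
          subrng_mult[OF A.R]
        by (auto simp: K_def add_subgroup_def transport_zero transport_diff right_diff_distrib left_diff_distrib)
      moreover have "c ` {..<n} \<subseteq> K"
        using False i transport_entries transport_c A.c_mem by (auto simp: K_def)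
      ultimately have "R \<subseteq> K" using A.closure_c group_closure_subset by blast
      with z show ?thesis by (auto simp: K_def)
    qed
    then show "transport (g * z) = transport g * transport z" "transport (z * g) = transport z * transport g" by auto
  qed
  have BB: "transport (b i * b j) = transport (b i) * transport (b j)" if ij: "i < u" "j < u" for i j
  proof -
    have ijn: "i < n" "j < n" using ij A.uv_le by auto
    have "coords p n c (b i * b j) = coords p n c' (b' i * b' j)"
    proof -
      have "A.final_code (i, j) = coords p n c (b i * b j)" using ij by (simp add: A.final_code_def)
      moreover have "B.final_code (i, j) = coords p n c' (b' i * b' j)"
        using ij unfolding u_eq[symmetric] by (simp add: B.final_code_def)
      ultimately show ?thesis using fin by simp
    qed
    then have "transport (b i * b j) = b' i * b' j"
      using B.val_coords[of "b' i * b' j"] subrng_mult[OF B.R B.b_mem[OF ijn(1)] B.b_mem[OF ijn(2)]]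
      by (simp add: transport_def)
    with transport_entries(5) ijn show ?thesis by simp
  qed
  show ?thesis
    by (rule mult_hom_of_generators[where \<psi> = transport, OF A.R transport_diff J(1) finite_subset[OF J(2) A.finR] J(2,3)
          hR J'(3,1,4,5) left right _ xy]) (use BB in auto)
qed

end

section \<open>The upper bound\<close>

lemma (in presented_rng) code_mem:
  "code \<in> {..n} \<times> {..n} \<times> (table_indices \<rightarrow>\<^sub>E digits p n)"
  using uv_le table_mem coords_digits by (auto simp: code_def)

lemma (in presented_rng) card_final_codes_le:
  "card (\<Pi>\<^sub>E (i, j)\<in>{..<u} \<times> {..<u}. coords p n c ` block j) \<le> p ^ ((k + v) * (u * u))"
proof -
  have "card (coords p n c ` block j) \<le> p ^ (k + v)" if "j < u" for j
    using card_block[OF that] card_image_le[OF finite_subset[OF block_subset finR], of "coords p n c" j] by simp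
  then have "(\<Prod>(i, j)\<in>{..<u} \<times> {..<u}. card (coords p n c ` block j)) \<le> (\<Prod>(i, j)\<in>{..<u} \<times> {..<u}. p ^ (k + v))"
    by (intro prod_mono) auto
  also have "\<dots> = (\<Prod>x\<in>{..<u} \<times> {..<u}. p ^ (k + v))" by (simp add: case_prod_beta)
  also have "\<dots> = p ^ ((k + v) * (u * u))"
    by (simp only: prod_constant card_cartesian_product card_lessThan power_mult)
  finally show ?thesis by (simp add: card_PiE case_prod_beta)
qed

lemma (in presented_rng) finite_final_codes:
  "finite (\<Pi>\<^sub>E (i, j)\<in>{..<u} \<times> {..<u}. coords p n c ` block j)"
  using finite_subset[OF block_subset finR] by (intro finite_PiE) auto

lemma (in presented_pair) final_code_mem_pair:
  "A.final_code \<in> (\<Pi>\<^sub>E (i, j)\<in>{..<u'} \<times> {..<u'}. coords p n c' ` B.block j)"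
proof -
  have "(\<Pi>\<^sub>E (i, j)\<in>{..<u} \<times> {..<u}. coords p n c ` A.block j) \<subseteq>
      (\<Pi>\<^sub>E (i, j)\<in>{..<u} \<times> {..<u}. coords p n c' ` B.block j)"
    by (rule PiE_mono) (use coords_block in \<open>simp add: case_prod_beta mem_Times_iff\<close>)
  with A.final_code_mem show ?thesis unfolding u_eq by blast
qed

definition rngs_of_card :: "nat \<Rightarrow> 'a::ring_1 set set" where
  "rngs_of_card q = {R. (\<exists>e. finite_rng R e) \<and> card R = q}"

text \<open>The code depends on a chosen presentation and is no isomorphism invariant; for an upper
  bound it suffices that equal codes force isomorphism. In the count, two factors n + 1 are for u
  and v, and the table has 7 m n entries of n digits each.\<close>

theorem ex_ring_code:
  fixes p n k s L M :: nat
  assumes p: "Factorial_Ring.prime p" and n: "n > 0" and s: "p ^ n < 2 ^ Suc (s * s)" and L: "p ^ n < 2 ^ 2 ^ L"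
    and k: "n \<le> k * k" "k > 0" and M: "\<And>u v. u + v \<le> n \<Longrightarrow> (k + v) * (u * u) \<le> M"
  defines "m \<equiv> 2 * s + 2 + L + k"
  shows "\<exists>code :: 'a::ring_1 set \<Rightarrow>
      (nat \<times> nat \<times> (nat \<times> nat \<times> nat \<Rightarrow> nat \<Rightarrow> nat)) \<times> (nat \<times> nat \<Rightarrow> nat \<Rightarrow> nat).
    finite (code ` rngs_of_card (p ^ n)) \<and>
    card (code ` rngs_of_card (p ^ n)) \<le> (Suc n * Suc n * p ^ (n * (7 * (m * n)))) * p ^ M \<and>
    (\<forall>R\<in>rngs_of_card (p ^ n). \<forall>R'\<in>rngs_of_card (p ^ n). code R = code R' \<longrightarrow>
       (\<exists>\<psi>. bij_betw \<psi> R R' \<and> (\<forall>x\<in>R. \<forall>y\<in>R. \<psi> (x - y) = \<psi> x - \<psi> y \<and> \<psi> (x * y) = \<psi> x * \<psi> y)))"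
proof -
  let ?\<R> = "rngs_of_card (p ^ n) :: 'a set set"
  have "\<exists>u v c h w b d. presents p n m k R u v c h w b d" if "R \<in> ?\<R>" for R
  proof -
    from that obtain e where e: "finite_rng R e" and c: "card R = p ^ n" by (auto simp: rngs_of_card_def)
    interpret finite_rng R e by (rule e)
    show ?thesis unfolding m_def using ex_presents[OF p c n _ _ k] s L c by metis
  qed
  then obtain u v c h w b d where pres: "\<And>R. R \<in> ?\<R> \<Longrightarrow> presents p n m k R (u R) (v R) (c R) (h R) (w R) (b R) (d R)"
    by metis
  have pr: "presented_rng p n m k R (u R) (v R) (c R) (h R) (w R) (b R) (d R)" if "R \<in> ?\<R>" for R
    using pres[OF that] that p
    by (auto simp: presented_rng_def rngs_of_card_def finite_rng_def m_def)
  define base where "base R = presented_rng.code p n m (u R) (v R) (c R) (h R) (w R) (b R) (d R)" for R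
  define final where "final R = presented_rng.final_code p n (u R) (c R) (b R)" for R
  have pair: "presented_pair p n m k R (u R) (v R) (c R) (h R) (w R) (b R) (d R)
      R' (u R') (v R') (c R') (h R') (w R') (b R') (d R')"
    if "R \<in> ?\<R>" "R' \<in> ?\<R>" "base R = base R'" for R R'
    using pr that unfolding presented_pair_def presented_pair_axioms_def base_def m_def by simp
  let ?T = "{..n} \<times> {..n} \<times> (({..<7::nat} \<times> {..<m} \<times> {..<n}) \<rightarrow>\<^sub>E digits p n)"
  have base: "base ` ?\<R> \<subseteq> ?T"
  proof (rule image_subsetI)
    fix R assume "R \<in> ?\<R>"
    interpret presented_rng p n m k R "u R" "v R" "c R" "h R" "w R" "b R" "d R" by (rule pr) fact
    show "base R \<in> ?T" unfolding base_def using code_mem by (simp only: table_indices_def)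
  qed
  have finT: "finite ?T" by (intro finite_cartesian_product finite_PiE) (auto simp: finite_digits)
  have cardT: "card ?T = Suc n * Suc n * p ^ (n * (7 * (m * n)))"
  proof -
    have "card (({..<7::nat} \<times> {..<m} \<times> {..<n}) \<rightarrow>\<^sub>E digits p n) = (p ^ n) ^ (7 * (m * n))"
      by (simp add: card_cartesian_product card_PiE card_digits)
    then show ?thesis by (simp only: card_cartesian_product card_atMost power_mult[of p n] mult.assoc)
  qed
  \<comment> \<open>One ring \<open>R0\<close> is fixed for each first code x; its box contains the
    final codes of all rings with that first code.\<close>
  have finals: "finite {final R |R. R \<in> ?\<R> \<and> base R = x} \<and> card {final R |R. R \<in> ?\<R> \<and> base R = x} \<le> p ^ M" for x
  proof (cases "\<exists>R\<in>?\<R>. base R = x")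
    case True
    then obtain R0 where R0: "R0 \<in> ?\<R>" "base R0 = x" by blast
    interpret presented_rng p n m k R0 "u R0" "v R0" "c R0" "h R0" "w R0" "b R0" "d R0" by (rule pr) fact
    let ?F = "\<Pi>\<^sub>E (i, j)\<in>{..<u R0} \<times> {..<u R0}. coords p n (c R0) ` block j"
    have sub: "{final R |R. R \<in> ?\<R> \<and> base R = x} \<subseteq> ?F"
    proof clarify
      fix R assume R: "R \<in> ?\<R>" "x = base R"
      interpret presented_pair p n m k R "u R" "v R" "c R" "h R" "w R" "b R" "d R"
        R0 "u R0" "v R0" "c R0" "h R0" "w R0" "b R0" "d R0"
        by (rule pair) (use R R0 in auto)
      show "final R \<in> ?F" unfolding final_def by (rule final_code_mem_pair)
    qed
    have "card ?F \<le> p ^ ((k + v R0) * (u R0 * u R0))" by (rule card_final_codes_le)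
    also have "\<dots> \<le> p ^ M" using M[OF uv_le] p_pos by (intro power_increasing) auto
    finally show ?thesis
      using card_mono[OF finite_final_codes sub] finite_subset[OF sub finite_final_codes] by auto
  next
    case False
    then have empty: "{final R |R. R \<in> ?\<R> \<and> base R = x} = {}" by blast
    show ?thesis unfolding empty by simp
  qed
  let ?code = "\<lambda>R. (base R, final R)"
  let ?S = "SIGMA x:base ` ?\<R>. {final R |R. R \<in> ?\<R> \<and> base R = x}"
  have sub: "?code ` ?\<R> \<subseteq> ?S" by auto
  have finb: "finite (base ` ?\<R>)" using base finT finite_subset by blast
  have finS: "finite ?S" using finb finals by (intro finite_SigmaI) auto
  have "card (?code ` ?\<R>) \<le> card ?S" by (rule card_mono[OF finS sub])
  also have "\<dots> = (\<Sum>x\<in>base ` ?\<R>. card {final R |R. R \<in> ?\<R> \<and> base R = x})"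
    using finb finals by (intro card_SigmaI) auto
  also have "\<dots> \<le> (\<Sum>x\<in>base ` ?\<R>. p ^ M)" using finals by (intro sum_mono) auto
  also have "\<dots> = card (base ` ?\<R>) * p ^ M" by simp
  also have "\<dots> \<le> card ?T * p ^ M" using card_mono[OF finT base] by simp
  finally have "card (?code ` ?\<R>) \<le> (Suc n * Suc n * p ^ (n * (7 * (m * n)))) * p ^ M"
    by (simp only: cardT)
  moreover have "finite (?code ` ?\<R>)" using finite_subset[OF sub finS] .
  moreover have "\<exists>\<psi>. bij_betw \<psi> R R' \<and> (\<forall>x\<in>R. \<forall>y\<in>R. \<psi> (x - y) = \<psi> x - \<psi> y \<and> \<psi> (x * y) = \<psi> x * \<psi> y)"
    if R: "R \<in> ?\<R>" "R' \<in> ?\<R>" "?code R = ?code R'" for R R'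
  proof -
    interpret presented_pair p n m k R "u R" "v R" "c R" "h R" "w R" "b R" "d R"
        R' "u R'" "v R'" "c R'" "h R'" "w R'" "b R'" "d R'"
      by (rule pair) (use R in auto)
    have "A.final_code = B.final_code" using R(3) unfolding final_def by simp
    then show ?thesis
      using bij_transport transport_diff transport_mult by (intro exI[of _ transport]) auto
  qed
  ultimately show ?thesis by (intro exI[of _ ?code] conjI ballI impI)
qed

section \<open>All finite rings inside one product ring\<close>

definition prod_ring_carrier :: "(nat ring \<Rightarrow> nat) set" where
  "prod_ring_carrier = {f. \<forall>S. if ring S then f S \<in> carrier S else f S = undefined}"

lemma ring_ops_closed:
  assumes "ring S"
  shows "\<zero>\<^bsub>S\<^esub> \<in> carrier S" "\<one>\<^bsub>S\<^esub> \<in> carrier S"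
    "\<lbrakk>x \<in> carrier S; y \<in> carrier S\<rbrakk> \<Longrightarrow> x \<oplus>\<^bsub>S\<^esub> y \<in> carrier S"
    "\<lbrakk>x \<in> carrier S; y \<in> carrier S\<rbrakk> \<Longrightarrow> x \<otimes>\<^bsub>S\<^esub> y \<in> carrier S"
    "\<lbrakk>x \<in> carrier S; y \<in> carrier S\<rbrakk> \<Longrightarrow> x \<ominus>\<^bsub>S\<^esub> y \<in> carrier S"
    "x \<in> carrier S \<Longrightarrow> \<ominus>\<^bsub>S\<^esub> x \<in> carrier S"
proof -
  interpret ring S by (rule assms)
  show "\<zero>\<^bsub>S\<^esub> \<in> carrier S" "\<one>\<^bsub>S\<^esub> \<in> carrier S"
    "\<lbrakk>x \<in> carrier S; y \<in> carrier S\<rbrakk> \<Longrightarrow> x \<oplus>\<^bsub>S\<^esub> y \<in> carrier S"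
    "\<lbrakk>x \<in> carrier S; y \<in> carrier S\<rbrakk> \<Longrightarrow> x \<otimes>\<^bsub>S\<^esub> y \<in> carrier S"
    "\<lbrakk>x \<in> carrier S; y \<in> carrier S\<rbrakk> \<Longrightarrow> x \<ominus>\<^bsub>S\<^esub> y \<in> carrier S"
    "x \<in> carrier S \<Longrightarrow> \<ominus>\<^bsub>S\<^esub> x \<in> carrier S" by simp_all
qed

text \<open>A single type that contains a copy of every finite ring, so that ring elements can be handled by
  the type class \<^class>\<open>ring_1\<close>.\<close>

typedef prod_ring = prod_ring_carrier
proof
  show "(\<lambda>S. if ring S then \<zero>\<^bsub>S\<^esub> else undefined) \<in> prod_ring_carrier"
    by (auto simp: prod_ring_carrier_def ring_ops_closed)
qed

definition prod_ring_of :: "(nat ring \<Rightarrow> nat) \<Rightarrow> prod_ring" where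
  "prod_ring_of f = Abs_prod_ring (\<lambda>S. if ring S then f S else undefined)"

lemma Rep_prod_ring_of:
  assumes "\<And>S. ring S \<Longrightarrow> f S \<in> carrier S"
  shows "Rep_prod_ring (prod_ring_of f) S = (if ring S then f S else undefined)"
  unfolding prod_ring_of_def using assms
  by (subst Abs_prod_ring_inverse) (auto simp: prod_ring_carrier_def)

lemma Rep_prod_ring_closed: "ring S \<Longrightarrow> Rep_prod_ring x S \<in> carrier S"
  using Rep_prod_ring[of x] by (auto simp: prod_ring_carrier_def)

lemma prod_ring_eqI: "(\<And>S. ring S \<Longrightarrow> Rep_prod_ring x S = Rep_prod_ring y S) \<Longrightarrow> x = y"
proof -
  assume *: "\<And>S. ring S \<Longrightarrow> Rep_prod_ring x S = Rep_prod_ring y S"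
  have "Rep_prod_ring x S = Rep_prod_ring y S" for S
    using * Rep_prod_ring[of x] Rep_prod_ring[of y] by (cases "ring S") (auto simp: prod_ring_carrier_def)
  then show "x = y" by (metis Rep_prod_ring_inject ext)
qed

instantiation prod_ring :: ring_1
begin

definition "0 = prod_ring_of (\<lambda>S. \<zero>\<^bsub>S\<^esub>)"
definition "1 = prod_ring_of (\<lambda>S. \<one>\<^bsub>S\<^esub>)"
definition "x + y = prod_ring_of (\<lambda>S. Rep_prod_ring x S \<oplus>\<^bsub>S\<^esub> Rep_prod_ring y S)"
definition "x * y = prod_ring_of (\<lambda>S. Rep_prod_ring x S \<otimes>\<^bsub>S\<^esub> Rep_prod_ring y S)"
definition "- x = prod_ring_of (\<lambda>S. \<ominus>\<^bsub>S\<^esub> Rep_prod_ring x S)"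
definition "x - y = prod_ring_of (\<lambda>S. Rep_prod_ring x S \<ominus>\<^bsub>S\<^esub> Rep_prod_ring y S)"

lemma Rep_prod_ring_simps:
  assumes "ring S"
  shows "Rep_prod_ring 0 S = \<zero>\<^bsub>S\<^esub>" "Rep_prod_ring 1 S = \<one>\<^bsub>S\<^esub>"
    "Rep_prod_ring (x + y) S = Rep_prod_ring x S \<oplus>\<^bsub>S\<^esub> Rep_prod_ring y S"
    "Rep_prod_ring (x * y) S = Rep_prod_ring x S \<otimes>\<^bsub>S\<^esub> Rep_prod_ring y S"
    "Rep_prod_ring (- x) S = \<ominus>\<^bsub>S\<^esub> Rep_prod_ring x S"
    "Rep_prod_ring (x - y) S = Rep_prod_ring x S \<ominus>\<^bsub>S\<^esub> Rep_prod_ring y S"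
  using assms
  by (simp_all add: zero_prod_ring_def one_prod_ring_def plus_prod_ring_def times_prod_ring_def
      uminus_prod_ring_def minus_prod_ring_def Rep_prod_ring_of Rep_prod_ring_closed ring_ops_closed)

instance
proof
  note simps = Rep_prod_ring_simps Rep_prod_ring_closed
  fix x y z :: prod_ring
  show "x + y + z = x + (y + z)"
    by (rule prod_ring_eqI) (simp add: simps ring.ring_simprules)
  show "x + y = y + x"
    by (rule prod_ring_eqI) (simp add: simps ring.ring_simprules)
  show "0 + x = x"
    by (rule prod_ring_eqI) (simp add: simps ring.ring_simprules)
  show "- x + x = 0"
    by (rule prod_ring_eqI) (simp add: simps ring.ring_simprules)
  show "x - y = x + - y"
    by (rule prod_ring_eqI) (simp add: simps ring.ring_simprules)
  show "x * y * z = x * (y * z)"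
    by (rule prod_ring_eqI) (simp add: simps ring.ring_simprules)
  show "1 * x = x" "x * 1 = x"
    by (rule prod_ring_eqI, simp add: simps ring.ring_simprules monoid.r_one[OF ring.is_monoid])+
  show "(x + y) * z = x * z + y * z"
    by (rule prod_ring_eqI) (simp add: simps ring.ring_simprules)
  show "x * (y + z) = x * y + x * z"
    by (rule prod_ring_eqI) (simp add: simps ring.ring_simprules)
  show "(0::prod_ring) \<noteq> 1"
  proof
    assume "(0::prod_ring) = 1"
    \<comment> \<open>The type class demands that 0 and 1 differ, so one non-trivial factor is
      exhibited: a copy of the integers with carrier in \<open>nat\<close>.\<close>
    obtain f :: "int \<Rightarrow> nat" where f: "inj f" by blast
    let ?S = "image_ring f \<Z>"
    have S: "ring ?S"
      using f by (intro ring.inj_imp_image_ring_is_ring cring.axioms(1) int_is_cring) (auto simp: inj_on_def)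
    have "f \<in> ring_iso \<Z> ?S"
      using f by (intro inj_imp_image_ring_iso) (auto simp: inj_on_def)
    then have "\<zero>\<^bsub>?S\<^esub> = f 0" "\<one>\<^bsub>?S\<^esub> = f 1"
      by (simp_all add: image_ring_zero image_ring_one)
    moreover have "\<zero>\<^bsub>?S\<^esub> = \<one>\<^bsub>?S\<^esub>"
      using \<open>(0::prod_ring) = 1\<close> Rep_prod_ring_simps(1,2)[OF S] by simp
    ultimately show False using f by (metis injD zero_neq_one)
  qed
qed

end

text \<open>The inclusion of one factor of the product. It respects sums and products but sends the
  identity of \<open>R\<close> to an idempotent, which serves as the \<open>e\<close> of
  \<open>finite_rng\<close>.\<close>

definition embed :: "nat ring \<Rightarrow> nat \<Rightarrow> prod_ring" where
  "embed R x = prod_ring_of (\<lambda>S. if S = R then x else \<zero>\<^bsub>S\<^esub>)"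

lemma Rep_embed:
  assumes "x \<in> carrier R" "ring S"
  shows "Rep_prod_ring (embed R x) S = (if S = R then x else \<zero>\<^bsub>S\<^esub>)"
  using assms by (simp add: embed_def Rep_prod_ring_of ring_ops_closed)

lemma embed_inj: "ring R \<Longrightarrow> inj_on (embed R) (carrier R)"
  by (rule inj_on_inverseI[where g = "\<lambda>f. Rep_prod_ring f R"]) (simp add: Rep_embed)

lemma embed_hom:
  assumes R: "ring R" and xy: "x \<in> carrier R" "y \<in> carrier R"
  shows "embed R (x \<oplus>\<^bsub>R\<^esub> y) = embed R x + embed R y" "embed R (x \<otimes>\<^bsub>R\<^esub> y) = embed R x * embed R y"
    "embed R (x \<ominus>\<^bsub>R\<^esub> y) = embed R x - embed R y" "embed R \<zero>\<^bsub>R\<^esub> = 0"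
proof -
  interpret ring R by (rule R)
  have zero: "\<zero>\<^bsub>S\<^esub> \<oplus>\<^bsub>S\<^esub> \<zero>\<^bsub>S\<^esub> = \<zero>\<^bsub>S\<^esub>" "\<zero>\<^bsub>S\<^esub> \<otimes>\<^bsub>S\<^esub> \<zero>\<^bsub>S\<^esub> = \<zero>\<^bsub>S\<^esub>" "\<zero>\<^bsub>S\<^esub> \<ominus>\<^bsub>S\<^esub> \<zero>\<^bsub>S\<^esub> = \<zero>\<^bsub>S\<^esub>"
    if "ring S" for S :: "nat ring"
  proof -
    interpret S: ring S by (rule that)
    show "\<zero>\<^bsub>S\<^esub> \<oplus>\<^bsub>S\<^esub> \<zero>\<^bsub>S\<^esub> = \<zero>\<^bsub>S\<^esub>" "\<zero>\<^bsub>S\<^esub> \<otimes>\<^bsub>S\<^esub> \<zero>\<^bsub>S\<^esub> = \<zero>\<^bsub>S\<^esub>" by simp_all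
    show "\<zero>\<^bsub>S\<^esub> \<ominus>\<^bsub>S\<^esub> \<zero>\<^bsub>S\<^esub> = \<zero>\<^bsub>S\<^esub>" by (simp add: S.minus_eq)
  qed
  show "embed R (x \<oplus>\<^bsub>R\<^esub> y) = embed R x + embed R y"
    by (rule prod_ring_eqI) (simp add: Rep_embed Rep_prod_ring_simps xy zero)
  show "embed R (x \<otimes>\<^bsub>R\<^esub> y) = embed R x * embed R y"
    by (rule prod_ring_eqI) (simp add: Rep_embed Rep_prod_ring_simps xy zero)
  show "embed R (x \<ominus>\<^bsub>R\<^esub> y) = embed R x - embed R y"
    by (rule prod_ring_eqI) (simp add: Rep_embed Rep_prod_ring_simps xy zero)
  show "embed R \<zero>\<^bsub>R\<^esub> = 0"
    by (rule prod_ring_eqI) (simp add: Rep_embed Rep_prod_ring_simps)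
qed

lemma embed_image:
  assumes R: "R \<in> rings_of_card q"
  shows "embed R ` carrier R \<in> rngs_of_card q"
proof -
  have ring: "ring R" and fin: "finite (carrier R)" and card: "card (carrier R) = q"
    using R by (auto simp: rings_of_card_def)
  interpret ring R by (rule ring)
  note hom = embed_hom[OF ring]
  have "finite_rng (embed R ` carrier R) (embed R \<one>\<^bsub>R\<^esub>)"
    unfolding finite_rng_def subrng_def add_subgroup_def
    using fin hom(4)[of "\<zero>\<^bsub>R\<^esub>" "\<zero>\<^bsub>R\<^esub>"]
    by (auto simp flip: hom intro!: image_eqI[OF _ zero_closed])
  then show ?thesis
    using card card_image[OF embed_inj[OF ring]] by (auto simp: rngs_of_card_def)
qed

lemma ring_iso_of_embed:
  assumes R: "R \<in> rings_of_card q" "S \<in> rings_of_card q"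
    and \<psi>: "bij_betw \<psi> (embed R ` carrier R) (embed S ` carrier S)"
    and hom: "\<And>x y. x \<in> embed R ` carrier R \<Longrightarrow> y \<in> embed R ` carrier R \<Longrightarrow>
      \<psi> (x - y) = \<psi> x - \<psi> y \<and> \<psi> (x * y) = \<psi> x * \<psi> y"
  shows "R \<simeq> S"
proof -
  have ring: "ring R" "ring S" using R by (auto simp: rings_of_card_def)
  interpret R: ring R by (rule ring)
  interpret S: ring S by (rule ring)
  define \<phi> where "\<phi> x = inv_into (carrier S) (embed S) (\<psi> (embed R x))" for x
  have \<phi>: "\<phi> x \<in> carrier S" "embed S (\<phi> x) = \<psi> (embed R x)" if "x \<in> carrier R" for x
  proof -
    have "\<psi> (embed R x) \<in> embed S ` carrier S" using that \<psi> by (auto simp: bij_betw_def)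
    then show "\<phi> x \<in> carrier S" "embed S (\<phi> x) = \<psi> (embed R x)"
      unfolding \<phi>_def by (auto intro: inv_into_into f_inv_into_f)
  qed
  have inj: "x = y" if "embed S x = embed S y" "x \<in> carrier S" "y \<in> carrier S" for x y
    using embed_inj[OF ring(2)] that by (auto dest: inj_onD)
  have "bij_betw (inv_into (carrier S) (embed S)) (embed S ` carrier S) (carrier S)"
    by (rule bij_betw_inv_into) (simp add: bij_betw_def embed_inj ring)
  from bij_betw_trans[OF bij_betw_trans[OF _ \<psi>] this, of "embed R" "carrier R"]
  have bij: "bij_betw \<phi> (carrier R) (carrier S)"
    by (simp add: bij_betw_def[of "embed R"] embed_inj ring comp_def \<phi>_def[abs_def])
  have mult: "\<phi> (x \<otimes>\<^bsub>R\<^esub> y) = \<phi> x \<otimes>\<^bsub>S\<^esub> \<phi> y" if "x \<in> carrier R" "y \<in> carrier R" for x y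
    using that hom by (intro inj) (simp_all add: \<phi> embed_hom ring)
  have diff: "\<phi> (x \<ominus>\<^bsub>R\<^esub> y) = \<phi> x \<ominus>\<^bsub>S\<^esub> \<phi> y" if "x \<in> carrier R" "y \<in> carrier R" for x y
    using that hom by (intro inj) (simp_all add: \<phi> embed_hom ring)
  have zero: "\<phi> \<zero>\<^bsub>R\<^esub> = \<zero>\<^bsub>S\<^esub>"
  proof -
    have "\<phi> (\<zero>\<^bsub>R\<^esub> \<ominus>\<^bsub>R\<^esub> \<zero>\<^bsub>R\<^esub>) = \<phi> \<zero>\<^bsub>R\<^esub> \<ominus>\<^bsub>S\<^esub> \<phi> \<zero>\<^bsub>R\<^esub>" by (intro diff) auto
    then show ?thesis using \<phi>(1)[of "\<zero>\<^bsub>R\<^esub>"] by (simp add: a_minus_def R.r_neg S.r_neg)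
  qed
  have neg: "\<phi> (\<ominus>\<^bsub>R\<^esub> y) = \<ominus>\<^bsub>S\<^esub> \<phi> y" if "y \<in> carrier R" for y
    using diff[of "\<zero>\<^bsub>R\<^esub>" y] that \<phi>(1) by (simp add: zero a_minus_def)
  have add: "\<phi> (x \<oplus>\<^bsub>R\<^esub> y) = \<phi> x \<oplus>\<^bsub>S\<^esub> \<phi> y" if "x \<in> carrier R" "y \<in> carrier R" for x y
    using diff[of x "\<ominus>\<^bsub>R\<^esub> y"] that \<phi>(1) by (simp add: neg a_minus_def)
  \<comment> \<open>Surjectivity gives x mapped to the identity of \<open>S\<close>, and then the
    image of the identity of \<open>R\<close> equals the image of its product with x.\<close>
  have one: "\<phi> \<one>\<^bsub>R\<^esub> = \<one>\<^bsub>S\<^esub>"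
  proof -
    obtain x where x: "x \<in> carrier R" "\<phi> x = \<one>\<^bsub>S\<^esub>"
      using bij by (metis S.one_closed bij_betw_def image_iff)
    have "\<phi> \<one>\<^bsub>R\<^esub> = \<phi> \<one>\<^bsub>R\<^esub> \<otimes>\<^bsub>S\<^esub> \<phi> x" using x \<phi>(1) by simp
    also have "\<dots> = \<phi> (\<one>\<^bsub>R\<^esub> \<otimes>\<^bsub>R\<^esub> x)" using x by (intro mult[symmetric]) auto
    finally show ?thesis using x by simp
  qed
  have "\<phi> \<in> ring_iso R S"
    using \<phi> mult add one bij by (intro ring_iso_memI) auto
  then show ?thesis by (auto simp: is_ring_iso_def)
qed

text \<open>f may take several values on one class; a chosen representative gives an injection,
  because equal values force equivalence.\<close>

lemma card_quotient_le:
  assumes "equiv A r" "finite (f ` A)" "\<And>x y. x \<in> A \<Longrightarrow> y \<in> A \<Longrightarrow> f x = f y \<Longrightarrow> (x, y) \<in> r"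
  shows "finite (A // r)" "card (A // r) \<le> card (f ` A)"
proof -
  define g where "g C = f (SOME x. x \<in> C)" for C
  have some: "(SOME x. x \<in> C) \<in> C" if "C \<in> A // r" for C
    using that in_quotient_imp_non_empty[OF assms(1)] by (metis all_not_in_conv someI_ex)
  have mem: "(SOME x. x \<in> C) \<in> A" if "C \<in> A // r" for C
    using some[OF that] in_quotient_imp_subset[OF assms(1) that] by blast
  have inj: "inj_on g (A // r)"
  proof (rule inj_onI)
    fix C D assume AB: "C \<in> A // r" "D \<in> A // r" "g C = g D"
    then have "((SOME x. x \<in> C), (SOME x. x \<in> D)) \<in> r"
      unfolding g_def using mem by (intro assms(3)) auto
    then show "C = D" using AB some quotient_eqI[OF assms(1)] by blast
  qed
  have sub: "g ` (A // r) \<subseteq> f ` A" using mem by (auto simp: g_def)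
  show "finite (A // r)" using inj sub assms(2) finite_subset finite_imageD by blast
  show "card (A // r) \<le> card (f ` A)" using card_inj_on_le[OF inj sub assms(2)] .
qed

text \<open>Finiteness is stated too, since \<open>card\<close> of an infinite set is 0; the lower
  bound takes it as a hypothesis.\<close>

theorem num_rings_upper:
  fixes p n k s L M :: nat
  assumes "Factorial_Ring.prime p" "n > 0" "p ^ n < 2 ^ Suc (s * s)" "p ^ n < 2 ^ 2 ^ L"
    "n \<le> k * k" "k > 0" "\<And>u v. u + v \<le> n \<Longrightarrow> (k + v) * (u * u) \<le> M"
  shows "finite (rings_of_card (p ^ n) // ring_iso_rel (p ^ n))"
    "num_rings_upto_iso (p ^ n) \<le> (Suc n * Suc n * p ^ (n * (7 * ((2 * s + 2 + L + k) * n)))) * p ^ M"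
proof -
  let ?X = "rings_of_card (p ^ n)"
  obtain code :: "prod_ring set \<Rightarrow>
      (nat \<times> nat \<times> (nat \<times> nat \<times> nat \<Rightarrow> nat \<Rightarrow> nat)) \<times> (nat \<times> nat \<Rightarrow> nat \<Rightarrow> nat)" where
    code: "finite (code ` rngs_of_card (p ^ n))"
      "card (code ` rngs_of_card (p ^ n)) \<le> (Suc n * Suc n * p ^ (n * (7 * ((2 * s + 2 + L + k) * n)))) * p ^ M"
    and iso: "\<forall>R\<in>rngs_of_card (p ^ n). \<forall>R'\<in>rngs_of_card (p ^ n). code R = code R' \<longrightarrow>
       (\<exists>\<psi>. bij_betw \<psi> R R' \<and> (\<forall>x\<in>R. \<forall>y\<in>R. \<psi> (x - y) = \<psi> x - \<psi> y \<and> \<psi> (x * y) = \<psi> x * \<psi> y))"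
    using ex_ring_code[OF assms] by blast
  define f where "f R = code (embed R ` carrier R)" for R
  have sub: "f ` ?X \<subseteq> code ` rngs_of_card (p ^ n)"
    using embed_image by (auto simp: f_def)
  have rel: "(R, S) \<in> ring_iso_rel (p ^ n)" if RS: "R \<in> ?X" "S \<in> ?X" "f R = f S" for R S
  proof -
    obtain \<psi> where "bij_betw \<psi> (embed R ` carrier R) (embed S ` carrier S)"
      "\<forall>x\<in>embed R ` carrier R. \<forall>y\<in>embed R ` carrier R. \<psi> (x - y) = \<psi> x - \<psi> y \<and> \<psi> (x * y) = \<psi> x * \<psi> y"
      using iso[rule_format, OF embed_image[OF RS(1)] embed_image[OF RS(2)]] RS(3) by (auto simp: f_def)
    then have "R \<simeq> S" using RS by (intro ring_iso_of_embed[where \<psi> = \<psi>]) auto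
    then show ?thesis using RS by (simp add: ring_iso_rel_def)
  qed
  note le = card_quotient_le[OF equiv_ring_iso_rel finite_subset[OF sub code(1)] rel]
  show "finite (?X // ring_iso_rel (p ^ n))" using le(1) by blast
  have "num_rings_upto_iso (p ^ n) \<le> card (f ` ?X)" unfolding num_rings_upto_iso_def using le(2) by blast
  also have "\<dots> \<le> card (code ` rngs_of_card (p ^ n))" by (rule card_mono[OF code(1) sub])
  finally show "num_rings_upto_iso (p ^ n) \<le> (Suc n * Suc n * p ^ (n * (7 * ((2 * s + 2 + L + k) * n)))) * p ^ M"
    using code(2) by linarith
qed

section \<open>The lower bound\<close>

lemma sum_mod_cong:
  fixes f g :: "'b \<Rightarrow> int"
  assumes "\<And>x. x \<in> A \<Longrightarrow> f x mod q = g x mod q"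
  shows "sum f A mod q = sum g A mod q"
proof -
  have "(\<Sum>x\<in>A. f x mod q) = (\<Sum>x\<in>A. g x mod q)" using assms by (rule sum.cong[OF refl])
  then show ?thesis by (metis mod_sum_eq)
qed

locale square_zero_extension =
  fixes p n r :: nat
  assumes p: "Factorial_Ring.prime p" and rn: "r < n"
begin

text \<open>Coordinate \<open>0\<close> is the scalar part, coordinates \<open>1..r\<close> span \<open>V\<close> and the remaining ones span \<open>W\<close>;
  \<open>B\<close> holds the structure constants of a bilinear map from \<open>V \<times> V\<close> to \<open>W\<close>.\<close>

definition form :: "(nat \<times> nat \<times> nat \<Rightarrow> nat) \<Rightarrow> (nat \<Rightarrow> int) \<Rightarrow> (nat \<Rightarrow> int) \<Rightarrow> nat \<Rightarrow> int" where
  "form B f g i = (\<Sum>a\<in>{1..r}. \<Sum>b\<in>{1..r}. int (B (a, b, i)) * f a * g b)"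

text \<open>The product before reduction. The ring laws hold already over the integers and pass to
  residues by congruence.\<close>

definition mult_int where
  "mult_int B f g i = (if i = 0 then f 0 * g 0 else if i \<le> r then f 0 * g i + f i * g 0
     else f 0 * g i + f i * g 0 + form B f g i)"

definition red :: "(nat \<Rightarrow> int) \<Rightarrow> nat \<Rightarrow> int" where
  "red f i = (if i < n then f i mod int p else 0)"

definition C :: "(nat \<Rightarrow> int) set" where
  "C = {f. red f = f}"

definition alg :: "(nat \<times> nat \<times> nat \<Rightarrow> nat) \<Rightarrow> (nat \<Rightarrow> int) ring" where
  "alg B = \<lparr>carrier = C, monoid.mult = (\<lambda>f g. red (mult_int B f g)), one = (\<lambda>i. if i = 0 then 1 else 0),
     ring.zero = (\<lambda>_. 0), ring.add = (\<lambda>f g. red (\<lambda>i. f i + g i))\<rparr>"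

lemma p1: "p > 1"
  by (rule prime_gt_1_nat[OF p])

lemma red_eqI: "(\<And>i. i < n \<Longrightarrow> f i mod int p = g i mod int p) \<Longrightarrow> red f = red g"
  by (auto simp: red_def fun_eq_iff)

lemma red_eqD: "red f = red g \<Longrightarrow> i < n \<Longrightarrow> f i mod int p = g i mod int p"
  by (metis red_def)

lemma red_red [simp]: "red (red f) = red f"
  by (rule red_eqI) (simp add: red_def)

lemma red_mem [simp]: "red f \<in> C"
  by (simp add: C_def)

lemma C_red: "f \<in> C \<Longrightarrow> red f = f"
  by (simp add: C_def)

lemma unit_mem: "j < n \<Longrightarrow> (\<lambda>i. if i = j then 1 else 0) \<in> C"
  using p1 by (auto simp: C_def red_def fun_eq_iff)

lemma zero_mem: "(\<lambda>_. 0) \<in> C"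
  by (auto simp: C_def red_def fun_eq_iff)

lemma mult_int_cong:
  assumes f: "red f = red f'" and g: "red g = red g'"
  shows "red (mult_int B f g) = red (mult_int B f' g')"
proof (rule red_eqI)
  fix i assume i: "i < n"
  note m = red_eqD[OF f] red_eqD[OF g]
  have "form B f g i mod int p = form B f' g' i mod int p"
    unfolding form_def using rn by (intro sum_mod_cong mod_mult_cong m refl) auto
  then show "mult_int B f g i mod int p = mult_int B f' g' i mod int p"
    unfolding mult_int_def using i rn by (auto intro!: mod_add_cong mod_mult_cong m)
qed

lemma form_eqI:
  "(\<And>a. a \<in> {1..r} \<Longrightarrow> f a = f' a) \<Longrightarrow> (\<And>a. a \<in> {1..r} \<Longrightarrow> g a = g' a) \<Longrightarrow> form B f g i = form B f' g' i"
  unfolding form_def by (intro sum.cong) auto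

lemma form_linear:
  "form B (\<lambda>a. x * f a + y * f' a) g i = x * form B f g i + y * form B f' g i"
  "form B f (\<lambda>a. x * g a + y * g' a) i = x * form B f g i + y * form B f g' i"
  by (simp_all add: form_def algebra_simps sum.distrib sum_distrib_left)

text \<open>\<open>form\<close> sees only the V-coordinates, where a product is f 0 times g plus g 0
  times f. So no form of a form occurs, and associativity holds for every table of structure
  constants.\<close>

lemma mult_int_assoc: "mult_int B (mult_int B f g) h = mult_int B f (mult_int B g h)"
proof
  fix i
  have left: "form B (mult_int B f g) h i = f 0 * form B g h i + g 0 * form B f h i"
    unfolding form_linear(1)[symmetric] by (rule form_eqI) (auto simp: mult_int_def)
  have right: "form B f (mult_int B g h) i = g 0 * form B f h i + h 0 * form B f g i"
    unfolding form_linear(2)[symmetric] by (rule form_eqI) (auto simp: mult_int_def)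
  show "mult_int B (mult_int B f g) h i = mult_int B f (mult_int B g h) i"
  proof (cases "i \<le> r")
    case True
    then show ?thesis by (auto simp: mult_int_def algebra_simps)
  next
    case False
    then show ?thesis
      unfolding mult_int_def[of B _ h i] mult_int_def[of B f _ i] left right
      by (simp add: mult_int_def algebra_simps)
  qed
qed

lemma mult_int_add:
  "mult_int B (\<lambda>i. f i + f' i) g = (\<lambda>i. mult_int B f g i + mult_int B f' g i)"
  "mult_int B f (\<lambda>i. g i + g' i) = (\<lambda>i. mult_int B f g i + mult_int B f g' i)"
  using form_linear(1)[of B 1 f 1 f' g] form_linear(2)[of B f 1 g 1 g']
  by (auto simp: mult_int_def fun_eq_iff algebra_simps)

lemma form_zero: "(\<And>a. a \<in> {1..r} \<Longrightarrow> f a = 0) \<Longrightarrow> form B f g i = 0" "(\<And>a. a \<in> {1..r} \<Longrightarrow> g a = 0) \<Longrightarrow> form B f g i = 0"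
  by (simp_all add: form_def)

lemma mult_int_one:
  "mult_int B (\<lambda>i. if i = 0 then 1 else 0) f = f" "mult_int B f (\<lambda>i. if i = 0 then 1 else 0) = f"
proof -
  have "form B (\<lambda>i. if i = 0 then 1 else 0) f i = 0" "form B f (\<lambda>i. if i = 0 then 1 else 0) i = 0" for i
    by (rule form_zero; simp)+
  then show "mult_int B (\<lambda>i. if i = 0 then 1 else 0) f = f" "mult_int B f (\<lambda>i. if i = 0 then 1 else 0) = f"
    by (auto simp: mult_int_def fun_eq_iff)
qed

lemma red_add_cong:
  "red f = red f' \<Longrightarrow> red g = red g' \<Longrightarrow> red (\<lambda>i. f i + g i) = red (\<lambda>i. f' i + g' i)"
  by (rule red_eqI) (auto intro!: mod_add_cong dest: red_eqD)

lemma ring_alg: "ring (alg B)"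
proof (rule ringI)
  show "abelian_group (alg B)"
  proof (rule abelian_groupI)
    fix x y z assume xyz: "x \<in> carrier (alg B)" "y \<in> carrier (alg B)" "z \<in> carrier (alg B)"
    have "red (\<lambda>i. red (\<lambda>i. x i + y i) i + z i) = red (\<lambda>i. (x i + y i) + z i)"
      by (rule red_add_cong) simp_all
    also have "\<dots> = red (\<lambda>i. x i + (y i + z i))" by (simp add: add.assoc)
    also have "\<dots> = red (\<lambda>i. x i + red (\<lambda>i. y i + z i) i)"
      by (rule red_add_cong) simp_all
    finally show "x \<oplus>\<^bsub>alg B\<^esub> y \<oplus>\<^bsub>alg B\<^esub> z = x \<oplus>\<^bsub>alg B\<^esub> (y \<oplus>\<^bsub>alg B\<^esub> z)" by (simp add: alg_def)
  next
    fix x assume x: "x \<in> carrier (alg B)"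
    have "red (\<lambda>i. red (\<lambda>i. - x i) i + x i) = red (\<lambda>i. - x i + x i)"
      by (rule red_add_cong) simp_all
    also have "\<dots> = (\<lambda>_. 0)" by (simp add: red_def fun_eq_iff)
    finally show "\<exists>y\<in>carrier (alg B). y \<oplus>\<^bsub>alg B\<^esub> x = \<zero>\<^bsub>alg B\<^esub>"
      by (intro bexI[of _ "red (\<lambda>i. - x i)"]) (simp_all add: alg_def)
  qed (auto simp: alg_def zero_mem C_red add.commute)
  show "monoid (alg B)"
  proof (rule monoidI)
    fix x y z assume "x \<in> carrier (alg B)" "y \<in> carrier (alg B)" "z \<in> carrier (alg B)"
    have "red (mult_int B (red (mult_int B x y)) z) = red (mult_int B (mult_int B x y) z)"
      by (rule mult_int_cong) simp_all
    also have "\<dots> = red (mult_int B x (red (mult_int B y z)))"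
      unfolding mult_int_assoc by (rule mult_int_cong) simp_all
    finally show "x \<otimes>\<^bsub>alg B\<^esub> y \<otimes>\<^bsub>alg B\<^esub> z = x \<otimes>\<^bsub>alg B\<^esub> (y \<otimes>\<^bsub>alg B\<^esub> z)" by (simp add: alg_def)
  qed (use rn in \<open>auto simp: alg_def mult_int_one C_red intro!: unit_mem\<close>)
  fix x y z assume "x \<in> carrier (alg B)" "y \<in> carrier (alg B)" "z \<in> carrier (alg B)"
  have "red (mult_int B (red (\<lambda>i. x i + y i)) z) = red (mult_int B (\<lambda>i. x i + y i) z)"
    by (rule mult_int_cong) simp_all
  also have "\<dots> = red (\<lambda>i. red (mult_int B x z) i + red (mult_int B y z) i)"
    unfolding mult_int_add by (rule red_add_cong) simp_all
  finally show "(x \<oplus>\<^bsub>alg B\<^esub> y) \<otimes>\<^bsub>alg B\<^esub> z = x \<otimes>\<^bsub>alg B\<^esub> z \<oplus>\<^bsub>alg B\<^esub> y \<otimes>\<^bsub>alg B\<^esub> z" by (simp add: alg_def)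
  have "red (mult_int B z (red (\<lambda>i. x i + y i))) = red (mult_int B z (\<lambda>i. x i + y i))"
    by (rule mult_int_cong) simp_all
  also have "\<dots> = red (\<lambda>i. red (mult_int B z x) i + red (mult_int B z y) i)"
    unfolding mult_int_add by (rule red_add_cong) simp_all
  finally show "z \<otimes>\<^bsub>alg B\<^esub> (x \<oplus>\<^bsub>alg B\<^esub> y) = z \<otimes>\<^bsub>alg B\<^esub> x \<oplus>\<^bsub>alg B\<^esub> z \<otimes>\<^bsub>alg B\<^esub> y" by (simp add: alg_def)
qed

lemma bij_C: "bij_betw (\<lambda>f. restrict f {..<n}) C ({..<n} \<rightarrow>\<^sub>E {0..<int p})"
proof (rule bij_betwI[where g = "\<lambda>g i. if i < n then g i else 0"])
  show "(\<lambda>f. restrict f {..<n}) \<in> C \<rightarrow> ({..<n} \<rightarrow>\<^sub>E {0..<int p})"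
  proof
    fix f assume "f \<in> C"
    then have "f i \<in> {0..<int p}" if "i < n" for i
      using C_red[of f] p1 that by (metis atLeastLessThan_iff of_nat_0_less_iff pos_mod_bound pos_mod_sign red_def less_trans zero_less_one)
    then show "restrict f {..<n} \<in> {..<n} \<rightarrow>\<^sub>E {0..<int p}" by auto
  qed
  show "(\<lambda>g i. if i < n then g i else 0) \<in> ({..<n} \<rightarrow>\<^sub>E {0..<int p}) \<rightarrow> C"
    by (auto simp: C_def red_def fun_eq_iff PiE_iff)
  show "(\<lambda>i. if i < n then restrict x {..<n} i else 0) = x" if "x \<in> C" for x
  proof
    fix i
    show "(if i < n then restrict x {..<n} i else 0) = x i"
      using fun_cong[OF C_red[OF that], of i] by (simp add: red_def split: if_splits)
  qed
  show "restrict (\<lambda>i. if i < n then y i else 0) {..<n} = y" if "y \<in> {..<n} \<rightarrow>\<^sub>E {0..<int p}" for y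
    using that by (auto simp: fun_eq_iff PiE_iff extensional_def)
qed

lemma finite_C: "finite C" and card_C: "card C = p ^ n"
  using bij_betw_finite[OF bij_C] bij_betw_same_card[OF bij_C] by (simp_all add: finite_PiE card_PiE)

text \<open>Nothing is assumed about \<open>add'\<close>, not even a zero element, so f is built
  from unit vectors by additions with positive multiplicities only.\<close>

lemma additive_eqI:
  assumes \<psi>: "\<And>f g. f \<in> C \<Longrightarrow> g \<in> C \<Longrightarrow> \<psi> (red (\<lambda>i. f i + g i)) = add' (\<psi> f) (\<psi> g)"
    and \<psi>': "\<And>f g. f \<in> C \<Longrightarrow> g \<in> C \<Longrightarrow> \<psi>' (red (\<lambda>i. f i + g i)) = add' (\<psi>' f) (\<psi>' g)"
    and unit: "\<And>j. j < n \<Longrightarrow> \<psi> (\<lambda>i. if i = j then 1 else 0) = \<psi>' (\<lambda>i. if i = j then 1 else 0)"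
    and f: "f \<in> C"
  shows "\<psi> f = \<psi>' f"
proof -
  have add: "\<psi> (red (\<lambda>i. f i + g i)) = \<psi>' (red (\<lambda>i. f i + g i))"
    if "\<psi> (red f) = \<psi>' (red f)" "\<psi> (red g) = \<psi>' (red g)" for f g
  proof -
    have "red (\<lambda>i. f i + g i) = red (\<lambda>i. red f i + red g i)" by (rule red_add_cong) simp_all
    then show ?thesis using \<psi>[of "red f" "red g"] \<psi>'[of "red f" "red g"] that by simp
  qed
  have mult: "\<psi> (red (\<lambda>i. if i = j then int t else 0)) = \<psi>' (red (\<lambda>i. if i = j then int t else 0))"
    if "j < n" "t > 0" for j t
    using that(2)
  proof (induction t rule: nat_induct_non_zero)
    case 1
    show ?case unfolding of_nat_1 C_red[OF unit_mem[OF that(1)]] by (rule unit[OF that(1)])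
  next
    case (Suc t)
    have eq: "(\<lambda>i. if i = j then int (Suc t) else 0) =
        (\<lambda>i. (if i = j then int t else 0) + (if i = j then 1 else 0))" by auto
    show ?case
      unfolding eq by (rule add[OF Suc.IH]) (unfold C_red[OF unit_mem[OF that(1)]], rule unit[OF that(1)])
  qed
  have "\<psi> (red (\<lambda>i. if i < k then f i else 0)) = \<psi>' (red (\<lambda>i. if i < k then f i else 0))" if "k \<le> n" for k
    using that
  proof (induction k)
    case 0
    \<comment> \<open>The zero vector is obtained as p times a unit vector.\<close>
    have "red (\<lambda>i. if i = 0 then int p else 0) = red (\<lambda>i. if i < 0 then f i else 0)"
      by (rule red_eqI) auto
    then show ?case using mult[of 0 p] rn p1 by simp
  next
    case (Suc k)
    \<comment> \<open>Adding p keeps the multiplicity positive without changing the residue.\<close>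
    define t where "t = nat (f k mod int p) + p"
    have t: "int t mod int p = f k mod int p" "t > 0" using p1 by (simp_all add: t_def)
    have "red (\<lambda>i. if i < Suc k then f i else 0) =
        red (\<lambda>i. (if i < k then f i else 0) + (if i = k then int t else 0))"
      by (rule red_eqI) (use t in \<open>auto simp: less_Suc_eq\<close>)
    then show ?case using add[OF Suc.IH mult[OF _ t(2)], of k] Suc.prems by simp
  qed
  moreover have "red (\<lambda>i. if i < n then f i else 0) = f"
    using C_red[OF f] red_eqI[of "\<lambda>i. if i < n then f i else 0" f] by simp
  ultimately show ?thesis by (metis order_refl)
qed

section \<open>Counting tables and isomorphisms\<close>

definition tables :: "(nat \<times> nat \<times> nat \<Rightarrow> nat) set" where
  "tables = {1..r} \<times> {1..r} \<times> {Suc r..<n} \<rightarrow>\<^sub>E {..<p}"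

lemma finite_tables: "finite tables" and card_tables: "card tables = p ^ (r * (r * (n - Suc r)))"
  by (simp_all add: tables_def finite_PiE card_PiE card_cartesian_product)

text \<open>The product of the unit vectors at a and b has coordinate \<open>B (a, b, i)\<close> at
  i > r, as the scalar parts vanish for a, b >= 1.\<close>

lemma tables_eqI:
  assumes B: "B \<in> tables" "B' \<in> tables"
    and eq: "\<And>f g. f \<in> C \<Longrightarrow> g \<in> C \<Longrightarrow> red (mult_int B f g) = red (mult_int B' f g)"
  shows "B = B'"
proof (rule PiE_ext)
  show "B \<in> {1..r} \<times> {1..r} \<times> {Suc r..<n} \<rightarrow>\<^sub>E {..<p}" "B' \<in> {1..r} \<times> {1..r} \<times> {Suc r..<n} \<rightarrow>\<^sub>E {..<p}"
    using B by (simp_all add: tables_def)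
  fix x assume x: "x \<in> {1..r} \<times> {1..r} \<times> {Suc r..<n}"
  obtain a b i where abi: "x = (a, b, i)" by (cases x)
  let ?f = "\<lambda>i. if i = a then 1 else 0 :: int" and ?g = "\<lambda>i. if i = b then 1 else 0 :: int"
  have form: "form D ?f ?g i = int (D (a, b, i))" for D
  proof -
    have "form D ?f ?g i = (\<Sum>a'\<in>{1..r}. \<Sum>b'\<in>{1..r}. if b' = b then (if a' = a then int (D (a', b', i)) else 0) else 0)"
      unfolding form_def by (intro sum.cong) auto
    also have "\<dots> = (\<Sum>a'\<in>{1..r}. if a' = a then int (D (a', b, i)) else 0)"
      using x abi by (intro sum.cong) auto
    finally show ?thesis using x abi by simp
  qed
  have "mult_int D ?f ?g i = int (D (a, b, i))" for D
    using x abi form[of D] by (auto simp: mult_int_def)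
  moreover have "mult_int B ?f ?g i mod int p = mult_int B' ?f ?g i mod int p"
    using eq[OF unit_mem unit_mem, of a b] x abi rn by (intro red_eqD) auto
  moreover have "B (a, b, i) < p" "B' (a, b, i) < p"
    using B x abi by (auto simp: tables_def PiE_iff)
  ultimately show "B x = B' x" by (simp add: abi)
qed

text \<open>An isomorphism onto \<open>S\<close> is additive, hence fixed by its values on n unit
  vectors, which leaves at most (p^n)^n choices; and it determines the table, because the product is
  the pullback of that of \<open>S\<close>.\<close>

lemma card_iso_tables_le: "card {B \<in> tables. alg B \<simeq> S} \<le> p ^ (n * n)" if S: "S = alg B0" for S B0
proof -
  define \<psi> where "\<psi> B = (SOME \<psi>. \<psi> \<in> ring_iso (alg B) S)" for B
  have \<psi>: "\<psi> B \<in> ring_iso (alg B) S" if "B \<in> {B \<in> tables. alg B \<simeq> S}" for B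
    unfolding \<psi>_def using that by (intro someI_ex[of "\<lambda>\<psi>. \<psi> \<in> ring_iso (alg B) S"]) (auto simp: is_ring_iso_def)
  define u where "u j = (\<lambda>i. if i = j then 1 else 0 :: int)" for j :: nat
  define F where "F B = (\<lambda>j\<in>{..<n}. \<psi> B (u j))" for B
  have "inj_on F {B \<in> tables. alg B \<simeq> S}"
  proof (rule inj_onI)
    fix B B' assume B: "B \<in> {B \<in> tables. alg B \<simeq> S}" "B' \<in> {B \<in> tables. alg B \<simeq> S}" and F: "F B = F B'"
    note iso = ring_iso_memE[OF \<psi>[OF B(1)]] and iso' = ring_iso_memE[OF \<psi>[OF B(2)]]
    have same: "\<psi> B f = \<psi> B' f" if "f \<in> C" for f
    proof (rule additive_eqI[OF _ _ _ that])
      show "\<psi> B (red (\<lambda>i. f i + g i)) = \<psi> B f \<oplus>\<^bsub>S\<^esub> \<psi> B g" if "f \<in> C" "g \<in> C" for f g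
        using iso(3)[of f g] that by (simp add: alg_def)
      show "\<psi> B' (red (\<lambda>i. f i + g i)) = \<psi> B' f \<oplus>\<^bsub>S\<^esub> \<psi> B' g" if "f \<in> C" "g \<in> C" for f g
        using iso'(3)[of f g] that by (simp add: alg_def)
      show "\<psi> B (\<lambda>i. if i = j then 1 else 0) = \<psi> B' (\<lambda>i. if i = j then 1 else 0)" if "j < n" for j
        using fun_cong[OF F, of j] that by (simp add: F_def u_def)
    qed
    have "red (mult_int B f g) = red (mult_int B' f g)" if fg: "f \<in> C" "g \<in> C" for f g
    proof -
      have "\<psi> B (red (mult_int B f g)) = \<psi> B f \<otimes>\<^bsub>S\<^esub> \<psi> B g"
        using iso(2)[of f g] fg by (simp add: alg_def)
      also have "\<dots> = \<psi> B' (red (mult_int B' f g))"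
        using iso'(2)[of f g] fg by (simp add: alg_def same)
      also have "\<dots> = \<psi> B (red (mult_int B' f g))" by (simp add: same)
      finally show ?thesis
        using bij_betw_imp_inj_on[OF iso(5)] by (auto simp: alg_def dest: inj_onD)
    qed
    then show "B = B'" using B by (intro tables_eqI) auto
  qed
  moreover have "F ` {B \<in> tables. alg B \<simeq> S} \<subseteq> {..<n} \<rightarrow>\<^sub>E C"
  proof (rule image_subsetI)
    fix B assume B: "B \<in> {B \<in> tables. alg B \<simeq> S}"
    show "F B \<in> {..<n} \<rightarrow>\<^sub>E C"
      using ring_iso_memE(1)[OF \<psi>[OF B]] unit_mem by (auto simp: F_def u_def S alg_def)
  qed
  moreover have "finite ({..<n} \<rightarrow>\<^sub>E C)" by (simp add: finite_PiE finite_C)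
  ultimately have "card {B \<in> tables. alg B \<simeq> S} \<le> card ({..<n} \<rightarrow>\<^sub>E C)"
    by (rule card_inj_on_le)
  then show ?thesis by (simp add: card_PiE card_C power_mult)
qed

theorem num_rings_lower:
  assumes fin: "finite (rings_of_card (p ^ n) // ring_iso_rel (p ^ n))"
  shows "p ^ (r * (r * (n - Suc r))) \<le> p ^ (n * n) * num_rings_upto_iso (p ^ n)"
proof -
  let ?X = "rings_of_card (p ^ n)"
  have "\<exists>S. S \<in> ?X \<and> alg B \<simeq> S" for B
    using finite_ring_iso_nat_ring[OF ring_alg, of B] finite_C card_C by (auto simp: alg_def)
  then obtain N where N: "\<And>B. N B \<in> ?X" "\<And>B. alg B \<simeq> N B" by metis
  define F where "F B = ring_iso_rel (p ^ n) `` {N B}" for B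
  have iso: "alg B \<simeq> alg B'" if "F B = F B'" for B B'
  proof -
    have "(N B, N B') \<in> ring_iso_rel (p ^ n)"
      using that N eq_equiv_class[OF _ equiv_ring_iso_rel] unfolding F_def by blast
    then have "N B \<simeq> N B'" by (simp add: ring_iso_rel_def)
    from ring_iso_trans[OF ring_iso_trans[OF N(2) this] ring_iso_sym[OF ring_alg N(2)]]
    show ?thesis .
  qed
  have "card tables \<le> p ^ (n * n) * card (F ` tables)"
  proof (rule card_le_mult_card_image[OF finite_tables])
    fix y assume "y \<in> F ` tables"
    then obtain B0 where B0: "y = F B0" by blast
    have "{B \<in> tables. F B = y} \<subseteq> {B \<in> tables. alg B \<simeq> alg B0}" using iso B0 by blast
    then have "card {B \<in> tables. F B = y} \<le> card {B \<in> tables. alg B \<simeq> alg B0}"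
      using finite_tables by (intro card_mono) auto
    with card_iso_tables_le[OF refl, of B0] show "card {B \<in> tables. F B = y} \<le> p ^ (n * n)" by simp
  qed
  moreover have "F ` tables \<subseteq> ?X // ring_iso_rel (p ^ n)" using N by (auto simp: F_def quotientI)
  then have "card (F ` tables) \<le> num_rings_upto_iso (p ^ n)"
    unfolding num_rings_upto_iso_def by (rule card_mono[OF fin])
  ultimately show ?thesis by (simp add: card_tables) (meson le_trans mult_le_mono2)
qed

end

section \<open>The asymptotics\<close>

text \<open>The origin of 4/27: the difference of the two sides is (u - 2v)^2 (4u + v), which
  vanishes at u = 2v.\<close>

lemma cubic_bound: "27 * (u * u * v) \<le> 4 * (u + v) ^ 3" for u v :: nat
proof -
  have "4 * (real u + real v) ^ 3 - 27 * (real u * real u * real v) = (real u - 2 * real v)\<^sup>2 * (4 * real u + real v)"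
    by (simp add: power2_eq_square power3_eq_cube algebra_simps)
  moreover have "(real u - 2 * real v)\<^sup>2 * (4 * real u + real v) \<ge> 0"
    by (intro mult_nonneg_nonneg) auto
  ultimately have "27 * (real u * real u * real v) \<le> 4 * (real u + real v) ^ 3" by linarith
  then have "real (27 * (u * u * v)) \<le> real (4 * (u + v) ^ 3)" by simp
  then show ?thesis by (simp only: of_nat_le_iff)
qed

text \<open>The choices s = p k and L = 2 p k are generous but linear in k. With them at most 7 p k
  elements are recorded, and seven kinds of entries give 49 p; the 3 collects 2 n from the factors n
  + 1 and k n^2 from \<open>M\<close>.\<close>

lemma num_rings_upper_powr:
  assumes p: "Factorial_Ring.prime (p::nat)" and n: "n > 0" and k: "n \<le> k * k" "k > 0"
  shows "num_rings_upto_iso (p ^ n) \<le> p ^ (4 * n ^ 3 div 27 + (49 * p + 3) * (k * (n * n)))"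
    and "finite (rings_of_card (p ^ n) // ring_iso_rel (p ^ n))"
proof -
  have p1: "p > 1" by (rule prime_gt_1_nat[OF p])
  have pn: "p ^ n \<le> 2 ^ (p * n)"
    using power_mono[of p "2 ^ p" n] less_exp[of p] by (simp add: power_mult)
  have "n * p \<le> (k * k) * (p * p)"
    using k p1 by (intro mult_mono) auto
  then have pnk: "p * n \<le> (p * k) * (p * k)" by (simp add: mult_ac)
  have s: "p ^ n < 2 ^ Suc ((p * k) * (p * k))"
  proof -
    have "p ^ n \<le> 2 ^ ((p * k) * (p * k))"
      using pn power_increasing[OF pnk, of "2::nat"] by linarith
    also have "\<dots> < 2 ^ Suc ((p * k) * (p * k))" by simp
    finally show ?thesis .
  qed
  have L: "p ^ n < 2 ^ 2 ^ (2 * p * k)"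
  proof -
    have "(p * k) * (p * k) < 2 ^ (p * k) * 2 ^ (p * k)"
      by (intro mult_strict_mono less_exp) auto
    also have "\<dots> = 2 ^ (2 * p * k)" by (simp add: power_add[symmetric] mult_2 distrib_right)
    finally have "p * n < 2 ^ (2 * p * k)" using pnk by linarith
    then have "(2::nat) ^ (p * n) < 2 ^ 2 ^ (2 * p * k)" by simp
    with pn show ?thesis by linarith
  qed
  define M where "M = 4 * n ^ 3 div 27 + k * (n * n)"
  have M: "(k + v) * (u * u) \<le> M" if uv: "u + v \<le> n" for u v
  proof -
    have "27 * (u * u * v) \<le> 4 * n ^ 3"
      using cubic_bound[of u v] power_mono[OF uv, of 3] by linarith
    then have "u * u * v \<le> 4 * n ^ 3 div 27" by linarith
    moreover have "k * (u * u) \<le> k * (n * n)"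
      using uv by (intro mult_mono) auto
    moreover have "(k + v) * (u * u) = k * (u * u) + u * u * v" by (simp add: algebra_simps)
    ultimately show ?thesis unfolding M_def by linarith
  qed
  note up = num_rings_upper[OF p n s L k M]
  show "finite (rings_of_card (p ^ n) // ring_iso_rel (p ^ n))" using up(1) .
  have "Suc n \<le> 2 ^ n" by (rule Suc_leI[OF less_exp])
  also have "\<dots> \<le> p ^ n" using p1 by (intro power_mono) auto
  finally have n1: "Suc n \<le> p ^ n" .
  have "Suc n * Suc n \<le> p ^ n * p ^ n" using n1 by (intro mult_mono) auto
  also have "\<dots> = p ^ (2 * n)" by (simp add: power_add[symmetric] mult_2)
  finally have sq: "Suc n * Suc n \<le> p ^ (2 * n)" .
  have exp: "n * (7 * ((2 * (p * k) + 2 + 2 * p * k + k) * n)) \<le> 49 * p * (k * (n * n))"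
  proof -
    have "1 * 1 \<le> p * k" "1 * k \<le> p * k" using p1 k by (intro mult_mono; simp)+
    moreover have "2 * p * k = 2 * (p * k)" by simp
    ultimately have "2 * (p * k) + 2 + 2 * p * k + k \<le> 7 * (p * k)" by linarith
    then have "(7 * (n * n)) * (2 * (p * k) + 2 + 2 * p * k + k) \<le> (7 * (n * n)) * (7 * (p * k))"
      by (rule mult_le_mono2)
    then show ?thesis by (simp add: algebra_simps)
  qed
  have "num_rings_upto_iso (p ^ n) \<le> (p ^ (2 * n) * p ^ (49 * p * (k * (n * n)))) * p ^ M"
  proof -
    note up(2)
    also have "(Suc n * Suc n * p ^ (n * (7 * ((2 * (p * k) + 2 + 2 * p * k + k) * n)))) * p ^ M
        \<le> (p ^ (2 * n) * p ^ (49 * p * (k * (n * n)))) * p ^ M"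
      using p1 by (intro mult_mono sq power_increasing exp) auto
    finally show ?thesis .
  qed
  also have "\<dots> = p ^ (2 * n + 49 * p * (k * (n * n)) + M)" by (simp add: power_add)
  also have "\<dots> \<le> p ^ (4 * n ^ 3 div 27 + (49 * p + 3) * (k * (n * n)))"
  proof (rule power_increasing)
    have "1 * n \<le> k * (n * n)" using k n by (intro mult_mono) auto
    then show "2 * n + 49 * p * (k * (n * n)) + M \<le> 4 * n ^ 3 div 27 + (49 * p + 3) * (k * (n * n))"
      by (simp add: M_def algebra_simps)
  qed (use p1 in simp)
  finally show "num_rings_upto_iso (p ^ n) \<le> p ^ (4 * n ^ 3 div 27 + (49 * p + 3) * (k * (n * n)))" .
qed

text \<open>With dim V = r rounded down from 2n/3, dim W is n - r - 1 because one coordinate holds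
  the scalars; rounding and this coordinate cost only O(n^2).\<close>

lemma two_thirds_bound:
  fixes n :: nat
  assumes "n > 0"
  defines "r \<equiv> 2 * n div 3"
  shows "real (r * (r * (n - Suc r))) \<ge> 4 / 27 * real n ^ 3 - real n ^ 2"
\<comment> \<open>For n < 3 the factor n/3 - 1 is negative and the estimates cannot be multiplied;
  the claimed bound is then at most 0.\<close>
proof (cases "n < 3")
  case True
  then have "n = 1 \<or> n = 2" using assms(1) by linarith
  then have "4 / 27 * real n ^ 3 \<le> real n ^ 2" by auto
  moreover have "0 \<le> real (r * (r * (n - Suc r)))" by simp
  ultimately show ?thesis by linarith
next
  case False
  have r: "2 * real n / 3 - 2 / 3 \<le> real r" "real r \<le> 2 * real n / 3" "r < n"
    using assms by (auto simp: r_def)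
  have "(2 * real n / 3 - 2 / 3)\<^sup>2 \<le> real r ^ 2"
    using r False by (intro power_mono) auto
  moreover have "real n / 3 - 1 \<le> real (n - Suc r)" using r by (simp add: of_nat_diff)
  ultimately have "(2 * real n / 3 - 2 / 3)\<^sup>2 * (real n / 3 - 1) \<le> real r ^ 2 * real (n - Suc r)"
    using False by (intro mult_mono) auto
  moreover have "(2 * real n / 3 - 2 / 3)\<^sup>2 * (real n / 3 - 1) \<ge> 4 / 27 * real n ^ 3 - real n ^ 2"
  proof -
    have "(2 * real n / 3 - 2 / 3)\<^sup>2 * (real n / 3 - 1) - (4 / 27 * real n ^ 3 - real n ^ 2)
        = (7 * (real n)\<^sup>2 + 28 * real n - 12) / 27"
      by (simp add: power2_eq_square power3_eq_cube field_simps)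
    moreover have "7 * (real n)\<^sup>2 + 28 * real n - 12 \<ge> 0"
      using False zero_le_power2[of "real n"] by linarith
    ultimately show ?thesis by simp
  qed
  ultimately show ?thesis by (simp add: power2_eq_square)
qed

theorem theorem3p9:
  fixes p :: nat
  assumes "Factorial_Ring.prime p"
  shows "\<exists>(\<delta> :: nat \<Rightarrow> real) (C :: real). \<forall>n\<ge>1.
           real (num_rings_upto_iso (p ^ n)) = real p powr \<delta> n \<and>
           \<bar>\<delta> n - 4 / 27 * real n ^ 3\<bar> \<le> C * real n powr (5 / 2)"
proof (intro exI allI impI)
  fix n :: nat assume n: "n \<ge> 1"
  let ?N = "num_rings_upto_iso (p ^ n)"
  let ?\<delta> = "\<lambda>n. log (real p) (real (num_rings_upto_iso (p ^ n)))"
  have p1: "real p > 1" using prime_gt_1_nat[OF assms] by simp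
  define k where "k = nat \<lceil>sqrt (real n)\<rceil>"
  have sq: "1 \<le> sqrt (real n)" using n by simp
  have k_ge: "sqrt (real n) \<le> real k" unfolding k_def by linarith
  have k_le: "real k \<le> 2 * sqrt (real n)" using sq unfolding k_def by linarith
  have "sqrt (real n) * sqrt (real n) \<le> real k * real k" using k_ge by (intro mult_mono) auto
  then have "real n \<le> real (k * k)" by simp
  then have k: "n \<le> k * k" by (simp only: of_nat_le_iff)
  have "k > 0" using k_ge sq by (cases k) auto
  note upper = num_rings_upper_powr[OF assms _ k this]
  define r where "r = 2 * n div 3"
  interpret square_zero_extension p n r
    using assms n by unfold_locales (auto simp: r_def)
  have lower: "p ^ (r * (r * (n - Suc r))) \<le> p ^ (n * n) * ?N"
    using num_rings_lower upper(2) n by simp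
  \<comment> \<open>Positivity of the count, needed for taking logarithms, is read off from the
    lower bound.\<close>
  have "0 < p ^ (r * (r * (n - Suc r)))" using p1 by simp
  with lower have "?N > 0" by (metis gr0I mult_0_right not_le)
  then have N: "real ?N > 0" by simp
  have powr: "real ?N = real p powr ?\<delta> n" using p1 N by simp
  have "real p ^ (r * (r * (n - Suc r))) \<le> real p ^ (n * n) * real ?N"
    using lower by (metis of_nat_le_iff of_nat_mult of_nat_power)
  then have "log p (real p ^ (r * (r * (n - Suc r)))) \<le> log p (real p ^ (n * n) * real ?N)"
    using p1 N by (subst log_le_cancel_iff) auto
  then have lo: "real (r * (r * (n - Suc r))) \<le> real (n * n) + ?\<delta> n"
    using p1 N by (simp add: log_mult log_nat_power)
  have "real ?N \<le> real p ^ (4 * n ^ 3 div 27 + (49 * p + 3) * (k * (n * n)))"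
    using upper(1) n by (metis of_nat_le_iff of_nat_power less_eq_Suc_le One_nat_def)
  then have "?\<delta> n \<le> log p (real p ^ (4 * n ^ 3 div 27 + (49 * p + 3) * (k * (n * n))))"
    using p1 N by (subst log_le_cancel_iff) auto
  then have up: "?\<delta> n \<le> real (4 * n ^ 3 div 27 + (49 * p + 3) * (k * (n * n)))"
    using p1 by (simp add: log_nat_power)
  have half: "real n powr (5 / 2) = sqrt (real n) * real n ^ 2"
  proof -
    have "real n powr (5 / 2) = real n powr (1 / 2 + 2)" by simp
    also have "\<dots> = real n powr (1 / 2) * real n powr 2" by (rule powr_add)
    finally show ?thesis using n by (simp add: powr_half_sqrt)
  qed
  define Q where "Q = sqrt (real n) * real n ^ 2"
  have n2: "real n ^ 2 \<le> Q" using sq mult_right_mono[OF sq, of "real n ^ 2"] by (simp add: Q_def)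
  have "real (4 * n ^ 3 div 27) \<le> 4 / 27 * real n ^ 3"
    using of_nat_mono[of "27 * (4 * n ^ 3 div 27)" "4 * n ^ 3", where 'a = real] by simp
  moreover have "real (k * (n * n)) \<le> 2 * Q"
    using mult_right_mono[OF k_le, of "real n ^ 2"] by (simp add: Q_def power2_eq_square mult_ac)
  then have "(49 * real p + 3) * real (k * (n * n)) \<le> (49 * real p + 3) * (2 * Q)"
    by (rule mult_left_mono) simp
  \<comment> \<open>The factor 98 p + 6 is twice 49 p + 3, since k <= 2 sqrt n for n >= 1.\<close>
  ultimately have "?\<delta> n - 4 / 27 * real n ^ 3 \<le> (98 * real p + 6) * Q"
    using up by (simp add: algebra_simps)
  moreover have "?\<delta> n - 4 / 27 * real n ^ 3 \<ge> - ((98 * real p + 6) * Q)"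
  proof -
    have "?\<delta> n - 4 / 27 * real n ^ 3 \<ge> - 2 * real n ^ 2"
      using lo two_thirds_bound[of n] n unfolding r_def by (simp add: power2_eq_square)
    moreover have "2 * Q \<le> (98 * real p + 6) * Q"
      using p1 n2 by (intro mult_right_mono) (auto intro: order_trans[OF zero_le_power2])
    ultimately show ?thesis using n2 by linarith
  qed
  ultimately show "real ?N = real p powr ?\<delta> n \<and>
      \<bar>?\<delta> n - 4 / 27 * real n ^ 3\<bar> \<le> (98 * real p + 6) * real n powr (5 / 2)"
    using powr unfolding half Q_def[symmetric] by (simp add: abs_le_iff)
qed

end
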